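(* Let $Y$ be a random symmetric $n\times n$ matrix with independent entries (up to symmetry), where $Y_{ii}\sim\mathrm{N}(0,2/n)$ and $Y_{ij}=Y_{ji}\sim\mathrm{N}(0,1/n)$ for $i<j$. Let $n$ be even, let $Y=\sum_{i=1}^n\lambda_iu_iu_i^T$ be its eigendecomposition with $\lambda_1\ge\dots\ge\lambda_n$, and let $Y^+=\sum_{i=1}^{n/2}\lambda_iu_iu_i^T$, $Y^-=\sum_{i=n/2+1}^n\lambda_iu_iu_i^T$. Then for every $k\in[n]$ and every constant $K>0$: $\mathbb{E}[Y^+_{kk}]=\frac{4}{3\pi}+o(1)$, $\mathbb{E}[Y^-_{kk}]=-\frac{4}{3\pi}+o(1)$, and $$\Pr\left[|Y^+_{kk}-\mathbb{E}Y^+_{kk}|\ge n^{-1/3}\right]=O(n^{-K}),\qquad \Pr\left[|Y^-_{kk}-\mathbb{E}Y^-_{kk}|\ge n^{-1/3}\right]=O(n^{-K}).$$ *)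

theory Defs
  imports "HOL-Probability.Probability" "HOL-Library.Landau_Symbols"
begin

definition goe_index :: "nat \<Rightarrow> (nat \<times> nat) set" where
  "goe_index n = {(i, j). i \<le> j \<and> j < n}"

text \<open>Centered Gaussian with variance v (normal_density takes the standard deviation).\<close>
definition gaussian :: "real \<Rightarrow> real measure" where
  "gaussian v = density lborel (normal_density 0 (sqrt v))"

definition GOE :: "nat \<Rightarrow> (nat \<times> nat \<Rightarrow> real) measure" where
  "GOE n = (\<Pi>\<^sub>M p \<in> goe_index n.
              gaussian (if fst p = snd p then 2 / real n else 1 / real n))"

definition goe_mat :: "(nat \<times> nat \<Rightarrow> real) \<Rightarrow> nat \<Rightarrow> nat \<Rightarrow> real" where
  "goe_mat \<omega> i j = (if i \<le> j then \<omega> (i, j) else \<omega> (j, i))"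

definition eigdecomp ::
    "nat \<Rightarrow> (nat \<Rightarrow> nat \<Rightarrow> real) \<Rightarrow> (nat \<Rightarrow> real) \<Rightarrow> (nat \<Rightarrow> nat \<Rightarrow> real) \<Rightarrow> bool" where
  "eigdecomp n A lam u \<longleftrightarrow>
     (\<forall>a<n. \<forall>b<n. (\<Sum>i<n. u a i * u b i) = (if a = b then 1 else 0)) \<and>
     (\<forall>i<n. \<forall>j<n. A i j = (\<Sum>l<n. lam l * u l i * u l j)) \<and>
     (\<forall>l. Suc l < n \<longrightarrow> lam (Suc l) \<le> lam l)"

end

theory Submission
  imports Defs
begin

text \<open>The positive part \<open>Y \<mapsto> max(Y, 0)\<close> is 1-Lipschitz in the Frobenius norm, so by dimension-free Gaussian
  concentration its diagonal entries fluctuate by \<open>O(n\<^sup>-\<^sup>1\<^sup>/\<^sup>2)\<close>. It differs from \<open>Y\<^sup>+\<close> only by the eigenvalues between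
  \<open>0\<close> and the median, which are smaller than \<open>n\<^sup>-\<^sup>1\<^sup>/\<^sup>3 / 8\<close> with overwhelming probability: otherwise the trace of a
  bounded, essentially odd function would exceed its mean, whereas the self-consistent equation
  \<open>s\<^sup>2 + z s + 1 = o(1)\<close> of the mean Stieltjes transform at \<open>z = \<i> n\<^sup>-\<^sup>1\<^sup>/\<^sup>3\<close> provides enough eigenvalues near \<open>0\<close> to make
  that mean negative. The equation comes from Gaussian integration by parts, and concentration follows from Maurey's
  property \<open>\<tau>\<close>, which only needs Lipschitz continuity and not differentiability. At fixed \<open>z = \<i> e\<close> the same equation
  gives the limit \<open>c(e)\<close> of \<open>Im (Y - z)\<^sup>-\<^sup>1\<^sub>k\<^sub>k\<close>, and the mean of \<open>\<bar>Y\<bar>\<^sub>k\<^sub>k\<close> is recovered from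
  \<open>\<pi> / 2 * \<bar>x\<bar> = \<integral> x\<^sup>2 / (x\<^sup>2 + e\<^sup>2) de\<close> together with \<open>\<integral> c(e)\<^sup>2 de = 4 / 3\<close>.\<close>

section \<open>One-dimensional Brunn--Minkowski and Prekopa--Leindler inequalities\<close>

text \<open>\<open>Yp\<close> is not a fixed spectral function of the matrix: its cut is at the
  random median and its eigenvectors are chosen. All probabilistic arguments therefore concern
  \<open>matfun\<close> with a fixed Lipschitz scalar function. Comparing two eigenbases yields for
  it independence of the diagonalization, Lipschitz continuity and hence measurability;
  \<open>Yp\<close> itself enters only through the pathwise inequality \<open>half_close\<close>.
  The scale n^(-1/3) leaves room everywhere. At e of this order the error 1/(n e^2) of the resolvent
  equation still vanishes, which keeps the mean Stieltjes transform near its value at 0. The trace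
  that locates the median has mean of order -n e but Lipschitz constant of order 1/e in the rescaled
  distance, so it is nonnegative with probability at most exp(-c n^2 e^4) = exp(-c n^(2/3)). The
  diagonal entry of the positive part deviates by order n^(-1/3) with probability at most 2 exp(-c
  n^(1/3)). Both bounds beat every power of n. On the exceptional event the second moment of row k
  controls what large eigenvalues contribute to the mean.\<close>

lemma brunn_minkowski_real_compact:
  fixes A B C :: "real set"
  assumes A: "compact A" "A \<noteq> {}" and B: "compact B" "B \<noteq> {}"
    and C: "C \<in> sets borel" and mid: "\<And>x y. x \<in> A \<Longrightarrow> y \<in> B \<Longrightarrow> (x + y) / 2 \<in> C"
  shows "emeasure lborel A + emeasure lborel B \<le> 2 * emeasure lborel C"
proof -
  obtain m where m: "m \<in> A" "\<And>x. x \<in> A \<Longrightarrow> x \<le> m"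
    using compact_attains_sup[OF A] by blast
  obtain w where w: "w \<in> B" "\<And>x. x \<in> B \<Longrightarrow> w \<le> x"
    using compact_attains_inf[OF B] by blast
  \<comment> \<open>Fixing one summand at an extreme point of its set puts both halved translates
    into C, with A' to the left and B' to the right of (m + w)/2; so their measures add up.\<close>
  define A' where "A' = (\<lambda>x. w/2 + (1/2) *\<^sub>R x) ` A"
  define B' where "B' = (\<lambda>x. m/2 + (1/2) *\<^sub>R x) ` B"
  have cA: "compact A'" and cB: "compact B'"
    unfolding A'_def B'_def by (intro compact_continuous_image continuous_intros A B)+
  have sub: "A' \<union> B' \<subseteq> C"
    unfolding A'_def B'_def using mid m w by (force simp: add_divide_distrib add.commute)
  have half: "2 * emeasure lborel ((\<lambda>x. c + (1/2) *\<^sub>R x) ` S) = emeasure lborel S"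
    if "compact S" for c :: real and S
  proof -
    have im: "(\<lambda>x. c + (1/2) *\<^sub>R x) ` S \<in> sets borel"
      by (intro borel_compact compact_continuous_image continuous_intros that)
    have "lborel = density (distr lborel borel (\<lambda>x. c + (1/2) *\<^sub>R x)) (\<lambda>_. ennreal (1/2))"
      using lborel_affine[of "1/2" c] by simp
    then have "emeasure lborel ((\<lambda>x. c + (1/2) *\<^sub>R x) ` S) =
        ennreal (1/2) * emeasure (distr lborel borel (\<lambda>x. c + (1/2) *\<^sub>R x)) ((\<lambda>x. c + (1/2) *\<^sub>R x) ` S)"
      using im by (metis emeasure_density_const sets_distr)
    also have "emeasure (distr lborel borel (\<lambda>x. c + (1/2) *\<^sub>R x)) ((\<lambda>x. c + (1/2) *\<^sub>R x) ` S)
        = emeasure lborel ((\<lambda>x. c + (1/2) *\<^sub>R x) -` (\<lambda>x. c + (1/2) *\<^sub>R x) ` S)"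
      using im by (subst emeasure_distr) auto
    also have "(\<lambda>x. c + (1/2) *\<^sub>R x) -` (\<lambda>x. c + (1/2) *\<^sub>R x) ` S = S"
      by (rule inj_vimage_image_eq) (auto simp: inj_def)
    finally have "2 * emeasure lborel ((\<lambda>x. c + (1/2) *\<^sub>R x) ` S) = (2 * ennreal (1/2)) * emeasure lborel S"
      by (simp add: mult.assoc)
    also have "2 * ennreal (1/2) = ennreal (2 * (1/2))"
      by (subst ennreal_mult') auto
    finally show ?thesis by simp
  qed
  have null: "emeasure lborel (A' \<inter> B') = 0"
  proof -
    have "A' \<inter> B' \<subseteq> {m/2 + w/2}"
    proof
      fix z assume "z \<in> A' \<inter> B'"
      then obtain x y where "x \<in> A" "y \<in> B" "z = w/2 + x/2" "z = m/2 + y/2"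
        unfolding A'_def B'_def by auto
      with m(2)[of x] w(2)[of y] show "z \<in> {m/2 + w/2}" by auto
    qed
    then have "emeasure lborel (A' \<inter> B') \<le> emeasure lborel {m/2 + w/2}"
      by (intro emeasure_mono) auto
    then show ?thesis by simp
  qed
  have "emeasure lborel A + emeasure lborel B = 2 * (emeasure lborel A' + emeasure lborel B')"
    unfolding distrib_left A'_def B'_def half[OF A(1)] half[OF B(1)] ..
  also have "emeasure lborel A' + emeasure lborel B' = emeasure lborel (A' \<union> B') + emeasure lborel (A' \<inter> B')"
    using cA cB by (intro emeasure_Un_Int) (auto intro: borel_compact)
  also have "\<dots> \<le> emeasure lborel C"
    unfolding null using sub C by (auto intro!: emeasure_mono)
  finally show ?thesis by (simp add: mult_left_mono)
qed

lemma lborel_inner_compact: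
  fixes A :: "real set"
  assumes "A \<in> sets borel" "bounded A" "A \<noteq> {}" "e > 0"
  obtains K where "compact K" "K \<subseteq> A" "K \<noteq> {}" "emeasure lborel A \<le> emeasure lborel K + ennreal e"
proof -
  have "A \<in> sets lebesgue" using assms(1) by auto
  then obtain T where T: "closed T" "T \<subseteq> A" "emeasure lebesgue (A - T) < ennreal e"
    using sets_lebesgue_inner_closed[of A e] \<open>e > 0\<close> by metis
  obtain a where a: "a \<in> A" using assms by blast
  \<comment> \<open>The point \<open>a\<close> keeps the approximating set nonempty, as the compact
    inequality demands.\<close>
  define K where "K = insert a T"
  have K: "compact K" "K \<subseteq> A" "K \<noteq> {}"
    unfolding K_def using T a assms(2) by (auto simp: compact_eq_bounded_closed intro: bounded_subset)
  have "emeasure lborel A = emeasure lborel (K \<union> (A - K))"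
    using K by (simp add: Un_absorb1)
  also have "\<dots> = emeasure lborel K + emeasure lborel (A - K)"
    using K assms(1) by (subst plus_emeasure) (auto intro: borel_compact)
  also have "emeasure lborel (A - K) \<le> emeasure lborel (A - T)"
    using T assms(1) K by (intro emeasure_mono) (auto simp: K_def)
  also have "\<dots> = emeasure lebesgue (A - T)"
    using T assms(1) by (subst emeasure_completion) auto
  also have "\<dots> \<le> ennreal e" using T by simp
  finally show ?thesis using that[OF K] by (simp add: add_left_mono)
qed

text \<open>Shrinking A and B preserves the midpoint hypothesis, so inner approximation reduces
  everything to compact sets. C is a separate Borel set because the set of midpoints of two Borel
  sets need not be Borel.\<close>

lemma brunn_minkowski_real:
  fixes A B C :: "real set"
  assumes A: "A \<in> sets borel" "bounded A" "A \<noteq> {}" and B: "B \<in> sets borel" "bounded B" "B \<noteq> {}"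
    and C: "C \<in> sets borel" and mid: "\<And>x y. x \<in> A \<Longrightarrow> y \<in> B \<Longrightarrow> (x + y) / 2 \<in> C"
  shows "emeasure lborel A + emeasure lborel B \<le> 2 * emeasure lborel C"
proof (rule ennreal_le_epsilon)
  fix e :: real assume "e > 0"
  then have e: "e / 2 > 0" by simp
  obtain K where K: "compact K" "K \<subseteq> A" "K \<noteq> {}" "emeasure lborel A \<le> emeasure lborel K + ennreal (e/2)"
    by (rule lborel_inner_compact[OF A e])
  obtain L where L: "compact L" "L \<subseteq> B" "L \<noteq> {}" "emeasure lborel B \<le> emeasure lborel L + ennreal (e/2)"
    by (rule lborel_inner_compact[OF B e])
  have "emeasure lborel A + emeasure lborel B \<le> (emeasure lborel K + emeasure lborel L) + (ennreal (e/2) + ennreal (e/2))"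
    using add_mono[OF K(4) L(4)] by (simp add: ac_simps)
  also have "ennreal (e/2) + ennreal (e/2) = ennreal e"
    using \<open>e > 0\<close> by (subst ennreal_plus[symmetric]) auto
  also have "emeasure lborel K + emeasure lborel L \<le> 2 * emeasure lborel C"
    using K L mid by (intro brunn_minkowski_real_compact C) auto
  finally show "emeasure lborel A + emeasure lborel B \<le> 2 * emeasure lborel C + ennreal e"
    by (simp add: add_right_mono)
qed

text \<open>Layer-cake formula cut off at height 1, where it integrates \<open>min 1 (h x)\<close>.
  The inequality serves the midpoint function, which may exceed 1, the equality the two normalized
  factors.\<close>

lemma nn_integral_superlevel_le:
  fixes h :: "real \<Rightarrow> real"
  assumes [measurable]: "h \<in> borel_measurable borel" and h: "\<And>x. 0 \<le> h x"
  shows "(\<integral>\<^sup>+t. indicator {0<..<1::real} t * emeasure lborel {x. t < h x} \<partial>lborel) \<le> (\<integral>\<^sup>+x. ennreal (h x) \<partial>lborel)"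
    and "(\<And>x. h x \<le> 1) \<Longrightarrow> (\<integral>\<^sup>+t. indicator {0<..<1::real} t * emeasure lborel {x. t < h x} \<partial>lborel) = (\<integral>\<^sup>+x. ennreal (h x) \<partial>lborel)"
proof -
  have 1: "(\<integral>\<^sup>+t. indicator {0<..<1::real} t * emeasure lborel {x. t < h x} \<partial>lborel) =
     (\<integral>\<^sup>+t. (\<integral>\<^sup>+x. indicator {0<..<1::real} t * indicator {x. t < h x} x \<partial>lborel) \<partial>lborel)"
    by (intro nn_integral_cong) (simp add: nn_integral_cmult)
  also have "\<dots> = (\<integral>\<^sup>+x. (\<integral>\<^sup>+t. indicator {0<..<1::real} t * indicator {t. t < h x} t \<partial>lborel) \<partial>lborel)"
    by (subst lborel_pair.Fubini') (auto intro!: nn_integral_cong simp: indicator_def)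
  also have "\<dots> = (\<integral>\<^sup>+x. emeasure lborel {0<..<min 1 (h x)} \<partial>lborel)"
  proof (intro nn_integral_cong)
    fix x
    have "(\<integral>\<^sup>+t. indicator {0<..<1::real} t * indicator {t. t < h x} t \<partial>lborel) =
      (\<integral>\<^sup>+t. indicator {0<..<min 1 (h x)} t \<partial>lborel)"
      by (intro nn_integral_cong) (auto simp: indicator_def)
    then show "(\<integral>\<^sup>+t. indicator {0<..<1::real} t * indicator {t. t < h x} t \<partial>lborel) = emeasure lborel {0<..<min 1 (h x)}"
      by simp
  qed
  finally have *: "(\<integral>\<^sup>+t. indicator {0<..<1::real} t * emeasure lborel {x. t < h x} \<partial>lborel) = (\<integral>\<^sup>+x. ennreal (min 1 (h x)) \<partial>lborel)"
    using h by simp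
  show "(\<integral>\<^sup>+t. indicator {0<..<1::real} t * emeasure lborel {x. t < h x} \<partial>lborel) \<le> (\<integral>\<^sup>+x. ennreal (h x) \<partial>lborel)"
    unfolding * by (intro nn_integral_mono ennreal_leI) auto
  show "(\<And>x. h x \<le> 1) \<Longrightarrow> (\<integral>\<^sup>+t. indicator {0<..<1::real} t * emeasure lborel {x. t < h x} \<partial>lborel) = (\<integral>\<^sup>+x. ennreal (h x) \<partial>lborel)"
    unfolding * by (intro nn_integral_cong) (simp add: min_def antisym)
qed

text \<open>At a height t in (0,1) the superlevel sets of a and b are nonempty and their midpoints
  lie in the superlevel set of h, so Brunn--Minkowski applies at each height and is integrated over
  t. The normalization of both suprema to 1 is what gives a sum, rather than a product, of integrals
  on the left.\<close>

lemma prekopa_leindler_normalized: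
  fixes a b h :: "real \<Rightarrow> real"
  assumes [measurable]: "a \<in> borel_measurable borel" "b \<in> borel_measurable borel" "h \<in> borel_measurable borel"
    and a: "\<And>x. 0 \<le> a x" "\<And>x. a x \<le> 1" and b: "\<And>x. 0 \<le> b x" "\<And>x. b x \<le> 1" and h: "\<And>x. 0 \<le> h x"
    and supa: "\<And>t. 0 < t \<Longrightarrow> t < 1 \<Longrightarrow> \<exists>x. t < a x" and supb: "\<And>t. 0 < t \<Longrightarrow> t < 1 \<Longrightarrow> \<exists>x. t < b x"
    and bda: "\<And>t. 0 < t \<Longrightarrow> bounded {x. t < a x}" and bdb: "\<And>t. 0 < t \<Longrightarrow> bounded {x. t < b x}"
    and mid: "\<And>x y. a x * b y \<le> (h ((x + y) / 2))\<^sup>2"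
  shows "(\<integral>\<^sup>+x. ennreal (a x) \<partial>lborel) + (\<integral>\<^sup>+x. ennreal (b x) \<partial>lborel) \<le> 2 * (\<integral>\<^sup>+x. ennreal (h x) \<partial>lborel)"
proof -
  have "(\<integral>\<^sup>+x. ennreal (a x) \<partial>lborel) + (\<integral>\<^sup>+x. ennreal (b x) \<partial>lborel) =
     (\<integral>\<^sup>+t. indicator {0<..<1::real} t * emeasure lborel {x. t < a x} \<partial>lborel) + (\<integral>\<^sup>+t. indicator {0<..<1::real} t * emeasure lborel {x. t < b x} \<partial>lborel)"
    by (subst (1 2) nn_integral_superlevel_le(2)) (use a b in auto)
  also have "\<dots> = (\<integral>\<^sup>+t. indicator {0<..<1::real} t * emeasure lborel {x. t < a x} + indicator {0<..<1::real} t * emeasure lborel {x. t < b x} \<partial>lborel)"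
    by (subst nn_integral_add) auto
  also have "\<dots> \<le> (\<integral>\<^sup>+t. 2 * (indicator {0<..<1::real} t * emeasure lborel {x. t < h x}) \<partial>lborel)"
  proof (intro nn_integral_mono)
    fix t :: real
    show "indicator {0<..<1::real} t * emeasure lborel {x. t < a x} + indicator {0<..<1::real} t * emeasure lborel {x. t < b x}
      \<le> 2 * (indicator {0<..<1::real} t * emeasure lborel {x. t < h x})"
    proof (cases "t \<in> {0<..<1}")
      case True
      have "emeasure lborel {x. t < a x} + emeasure lborel {x. t < b x} \<le> 2 * emeasure lborel {x. t < h x}"
      proof (rule brunn_minkowski_real)
        fix x y assume "x \<in> {x. t < a x}" "y \<in> {x. t < b x}"
        then have "t * t < a x * b y" using True a b by (intro mult_strict_mono) auto
        also note mid
        finally show "(x + y) / 2 \<in> {x. t < h x}"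
          using h by (auto simp: power2_eq_square[symmetric] intro: power_less_imp_less_base)
      qed (use True supa supb bda bdb in auto)
      then show ?thesis using True by simp
    qed simp
  qed
  also have "\<dots> = 2 * (\<integral>\<^sup>+t. indicator {0<..<1::real} t * emeasure lborel {x. t < h x} \<partial>lborel)"
    by (rule nn_integral_cmult) auto
  also have "\<dots> \<le> 2 * (\<integral>\<^sup>+x. ennreal (h x) \<partial>lborel)"
    by (intro mult_left_mono nn_integral_superlevel_le) (use h in auto)
  finally show ?thesis .
qed

section \<open>Gaussian concentration\<close>

lemma sets_gaussian [simp, measurable_cong]: "sets (gaussian s) = sets borel"
  by (simp add: gaussian_def)

lemma space_gaussian [simp]: "space (gaussian s) = UNIV"
  by (simp add: gaussian_def)

lemma prob_space_gaussian: "0 < s \<Longrightarrow> prob_space (gaussian s)"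
  unfolding gaussian_def by (rule prob_space_normal_density) simp

text \<open>Prekopa--Leindler for u p, v p and the Gaussian density p itself, whose integral is 1.
  Boundedness of u and v makes the suprema finite, so that the products can be normalized.\<close>

lemma gaussian_tau_bounded:
  fixes u v :: "real \<Rightarrow> real"
  assumes s: "0 < s"
    and [measurable]: "u \<in> borel_measurable borel" "v \<in> borel_measurable borel"
    and u: "\<And>x. 0 \<le> u x" "\<And>x. u x \<le> C" and v: "\<And>x. 0 \<le> v x" "\<And>x. v x \<le> C"
    and uv: "\<And>x y. u x * v y \<le> exp ((x - y)\<^sup>2 / (4 * s))"
  shows "(\<integral>\<^sup>+x. ennreal (u x) \<partial>gaussian s) * (\<integral>\<^sup>+x. ennreal (v x) \<partial>gaussian s) \<le> 1"
proof -
  define p where "p = normal_density 0 (sqrt s)"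
  have p0: "0 < p x" for x unfolding p_def using s by (simp add: normal_density_pos)
  have p_eq: "p x = 1 / sqrt (2 * pi * s) * exp (- x\<^sup>2 / (2 * s))" for x
    unfolding p_def normal_density_def using s by simp
  have pm[measurable]: "p \<in> borel_measurable borel" unfolding p_def by simp
  \<comment> \<open>The parallelogram identity x^2/2 + y^2/2 = (x - y)^2/4 + ((x + y)/2)^2 in the
    exponent; it dictates the cost (x - y)^2/(4 s).\<close>
  have pp: "p x * p y * exp ((x - y)\<^sup>2 / (4 * s)) = (p ((x + y) / 2))\<^sup>2" for x y
  proof -
    have "- x\<^sup>2 / (2 * s) + - y\<^sup>2 / (2 * s) + (x - y)\<^sup>2 / (4 * s) = 2 * (- ((x + y) / 2)\<^sup>2 / (2 * s))"
      using s by (simp add: field_simps power2_eq_square)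
    then have "exp (- x\<^sup>2 / (2 * s)) * exp (- y\<^sup>2 / (2 * s)) * exp ((x - y)\<^sup>2 / (4 * s)) = (exp (- ((x + y) / 2)\<^sup>2 / (2 * s)))\<^sup>2"
      by (simp flip: exp_add exp_double)
    moreover have "p x * p y * exp ((x - y)\<^sup>2 / (4 * s)) = (1 / sqrt (2 * pi * s))\<^sup>2 * (exp (- x\<^sup>2 / (2 * s)) * exp (- y\<^sup>2 / (2 * s)) * exp ((x - y)\<^sup>2 / (4 * s)))"
      unfolding p_eq power2_eq_square by (simp only: ac_simps)
    ultimately show ?thesis by (simp only: p_eq[of "(x + y) / 2"] power_mult_distrib)
  qed
  have int: "(\<integral>\<^sup>+x. ennreal (f x) \<partial>gaussian s) = (\<integral>\<^sup>+x. ennreal (f x * p x) \<partial>lborel)"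
    if "f \<in> borel_measurable borel" "\<And>x. 0 \<le> f x" for f
    unfolding gaussian_def p_def[symmetric] using that p0
    by (subst nn_integral_density) (auto intro!: nn_integral_cong simp: ennreal_mult'[symmetric] mult.commute less_imp_le)
  have p1: "(\<integral>\<^sup>+x. ennreal (p x) \<partial>lborel) = 1"
  proof -
    interpret prob_space "gaussian s" by (rule prob_space_gaussian[OF s])
    show ?thesis using int[of "\<lambda>_. 1"] emeasure_space_1 by simp
  qed
  define P where "P = 1 / sqrt (2 * pi * s)"
  have pP: "p x \<le> P" for x unfolding p_eq P_def using s by (simp add: mult_left_le divide_right_mono)
  have P0: "0 < P" using p0 pP less_le_trans by blast
  have C0: "0 \<le> C" using u order_trans by blast
  have bdd: "bdd_above (range (\<lambda>x. f x * p x))" if "\<And>x. 0 \<le> f x" "\<And>x. f x \<le> C" for f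
    using that pP P0 p0 C0 by (intro bdd_aboveI[of _ "C * P"]) (auto intro!: mult_mono simp: less_imp_le)
  \<comment> \<open>The normalizing suprema. If one of them is 0, the corresponding integral
    vanishes and there is nothing to prove.\<close>
  define al where "al = (SUP x. u x * p x)"
  define be where "be = (SUP x. v x * p x)"
  have le_al: "u x * p x \<le> al" and le_be: "v x * p x \<le> be" for x
    unfolding al_def be_def using u v by (auto intro!: cSUP_upper bdd)
  consider "al = 0" | "be = 0" | "al > 0" "be > 0"
    using le_al[of 0] le_be[of 0] u(1)[of 0] v(1)[of 0] p0[of 0]
    by (metis less_eq_real_def mult_nonneg_nonneg order_trans)
  then show ?thesis
  proof cases
    case 1
    have z: "u x * p x = 0" for x
      using le_al[of x] u(1)[of x] p0[of x] \<open>al = 0\<close> by (intro antisym) (auto intro: mult_nonneg_nonneg less_imp_le)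
    show ?thesis unfolding int[OF assms(2) u(1)] z by simp
  next
    case 2
    have z: "v x * p x = 0" for x
      using le_be[of x] v(1)[of x] p0[of x] \<open>be = 0\<close> by (intro antisym) (auto intro: mult_nonneg_nonneg less_imp_le)
    show ?thesis unfolding int[OF assms(3) v(1)] z by simp
  next
    case 3
    have sup: "\<exists>x. t < f x * p x / g" if "t < 1" "g = (SUP x. f x * p x)" "g > 0" "\<And>x. 0 \<le> f x" "\<And>x. f x \<le> C" for t f and g::real
    proof -
      note f = that(4,5)
      have "t * g < (SUP x. f x * p x)" using that by simp
      then obtain x where "t * g < f x * p x"
        using less_cSUP_iff[of UNIV "\<lambda>x. f x * p x" "t * g"] bdd[OF f] by auto
      then show ?thesis using that(3) by (auto simp: field_simps)
    qed
    have bd: "bounded {x. t < f x * p x / g}" if "0 < t" "g > 0" "\<And>x. 0 \<le> f x" "\<And>x. f x \<le> C" for t f and g::real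
    proof -
      \<comment> \<open>From exp(-y) <= 1/(1 + y) with y = x^2/(2 s): the superlevel set lies in x^2
        < R.\<close>
      define R where "R = C * P * (2 * s) / (t * g)"
      have "\<bar>x\<bar> \<le> R + 1" if x: "t < f x * p x / g" for x
      proof -
        have "t * g < f x * p x" using x \<open>g > 0\<close> by (simp add: field_simps)
        also have "\<dots> \<le> C * p x" using p0 that by (intro mult_right_mono) (auto simp: less_imp_le \<open>\<And>x. f x \<le> C\<close>)
        also have "p x \<le> P * (1 / (1 + x\<^sup>2 / (2 * s)))"
        proof -
          have "1 + x\<^sup>2 / (2 * s) \<le> exp (x\<^sup>2 / (2 * s))" by (rule exp_ge_add_one_self)
          moreover have "0 < 1 + x\<^sup>2 / (2 * s)" using s by (simp add: add_pos_nonneg)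
          ultimately have "exp (- (x\<^sup>2 / (2 * s))) \<le> 1 / (1 + x\<^sup>2 / (2 * s))"
            by (simp add: exp_minus inverse_eq_divide frac_le)
          then have "P * exp (- (x\<^sup>2 / (2 * s))) \<le> P * (1 / (1 + x\<^sup>2 / (2 * s)))"
            using P0 by (intro mult_left_mono) auto
          then show ?thesis unfolding p_eq P_def[symmetric] by simp
        qed
        finally have *: "t * g < C * (P * (1 / (1 + x\<^sup>2 / (2 * s))))" using C0 by (simp add: mult_left_mono)
        have "0 < 1 + x\<^sup>2 / (2 * s)" using s by (simp add: add_pos_nonneg)
        then have "t * g * (1 + x\<^sup>2 / (2 * s)) < C * P" using * by (simp add: field_simps)
        then have "t * g * (x\<^sup>2 / (2 * s)) < C * P" using \<open>0 < t\<close> \<open>g > 0\<close>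
          by (smt (verit) distrib_left mult_pos_pos mult.right_neutral)
        then have "x\<^sup>2 < R" unfolding R_def using \<open>0 < t\<close> \<open>g > 0\<close> s by (simp add: field_simps)
        moreover have "\<bar>x\<bar> \<le> x\<^sup>2 + 1"
          using sum_squares_bound[of "\<bar>x\<bar>" 1] by (simp add: power2_eq_square)
        ultimately show ?thesis by linarith
      qed
      then show ?thesis by (intro boundedI[of _ "R + 1"]) auto
    qed
    define I where "I = (\<integral>\<^sup>+x. ennreal (u x * p x) \<partial>lborel)"
    define J where "J = (\<integral>\<^sup>+x. ennreal (v x * p x) \<partial>lborel)"
    have "(\<integral>\<^sup>+x. ennreal (u x * p x / al) \<partial>lborel) + (\<integral>\<^sup>+x. ennreal (v x * p x / be) \<partial>lborel)
        \<le> 2 * (\<integral>\<^sup>+x. ennreal (p x / sqrt (al * be)) \<partial>lborel)"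
    proof (rule prekopa_leindler_normalized)
      show "0 < t \<Longrightarrow> t < 1 \<Longrightarrow> \<exists>x. t < u x * p x / al" for t using 3 by (intro sup al_def u) auto
      show "0 < t \<Longrightarrow> t < 1 \<Longrightarrow> \<exists>x. t < v x * p x / be" for t using 3 by (intro sup be_def v) auto
      show "0 < t \<Longrightarrow> bounded {x. t < u x * p x / al}" for t using 3 by (intro bd u) auto
      show "0 < t \<Longrightarrow> bounded {x. t < v x * p x / be}" for t using 3 by (intro bd v) auto
      fix x y
      have "u x * p x / al * (v y * p y / be) = (u x * v y) * (p x * p y) / (al * be)" by simp
      also have "\<dots> \<le> exp ((x - y)\<^sup>2 / (4 * s)) * (p x * p y) / (al * be)"
        using 3 p0 uv by (intro divide_right_mono mult_right_mono) (auto simp: less_imp_le)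
      also have "\<dots> = (p ((x + y) / 2))\<^sup>2 / (al * be)" by (simp flip: pp)
      also have "\<dots> = (p ((x + y) / 2) / sqrt (al * be))\<^sup>2" using 3 by (simp add: power_divide)
      finally show "u x * p x / al * (v y * p y / be) \<le> (p ((x + y) / 2) / sqrt (al * be))\<^sup>2" .
    qed (use 3 p0 u v le_al le_be in \<open>auto simp: less_imp_le\<close>)
    also have "(\<integral>\<^sup>+x. ennreal (u x * p x / al) \<partial>lborel) = I / ennreal al"
      unfolding I_def using 3 u p0 by (subst nn_integral_divide[symmetric]) (auto simp: divide_ennreal less_imp_le)
    also have "(\<integral>\<^sup>+x. ennreal (v x * p x / be) \<partial>lborel) = J / ennreal be"
      unfolding J_def using 3 v p0 by (subst nn_integral_divide[symmetric]) (auto simp: divide_ennreal less_imp_le)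
    also have "(\<integral>\<^sup>+x. ennreal (p x / sqrt (al * be)) \<partial>lborel) = 1 / ennreal (sqrt (al * be))"
      using 3 p0 p1 by (subst p1[symmetric], subst nn_integral_divide[symmetric]) (auto simp: divide_ennreal less_imp_le)
    finally have *: "I / ennreal al + J / ennreal be \<le> 2 * (1 / ennreal (sqrt (al * be)))" .
    have fin: "(\<integral>\<^sup>+x. ennreal (f x * p x) \<partial>lborel) < \<infinity>" if "\<And>x. 0 \<le> f x" "\<And>x. f x \<le> C" for f
    proof -
      have "(\<integral>\<^sup>+x. ennreal (f x * p x) \<partial>lborel) \<le> (\<integral>\<^sup>+x. ennreal C * ennreal (p x) \<partial>lborel)"
        using that p0 C0 by (intro nn_integral_mono) (auto simp: ennreal_mult'[symmetric] less_imp_le intro!: ennreal_leI mult_right_mono)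
      also have "\<dots> = ennreal C" by (subst nn_integral_cmult) (auto simp: p1)
      finally show ?thesis by (simp add: le_less_trans[OF _ ennreal_less_top])
    qed
    obtain i where i: "I = ennreal i" "0 \<le> i"
      using fin[of u] u unfolding I_def[symmetric] by (cases I) auto
    obtain j where j: "J = ennreal j" "0 \<le> j"
      using fin[of v] v unfolding J_def[symmetric] by (cases J) auto
    have "ennreal (i / al + j / be) = I / ennreal al + J / ennreal be"
      using 3 i j by (simp add: divide_ennreal)
    also note *
    also have "2 * (1 / ennreal (sqrt (al * be))) = ennreal 2 * ennreal (1 / sqrt (al * be))"
      using 3 divide_ennreal[of 1 "sqrt (al * be)"] by simp
    also have "\<dots> = ennreal (2 / sqrt (al * be))"
      using 3 by (subst ennreal_mult[symmetric]) auto
    finally have "ennreal (i / al + j / be) \<le> ennreal (2 / sqrt (al * be))" .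
    then have le: "i / al + j / be \<le> 2 / sqrt (al * be)" using 3 by (simp add: ennreal_le_iff)
    \<comment> \<open>By 4 a b <= (a + b)^2 the bound on the sum of the normalized integrals becomes
      one on their product, in which al * be cancels.\<close>
    have "4 * (i / al * (j / be)) \<le> (i / al + j / be)\<^sup>2"
      using sum_squares_bound[of "i/al" "j/be"] by (simp add: power2_sum)
    also have "\<dots> \<le> (2 / sqrt (al * be))\<^sup>2"
      using le i j 3 by (intro power_mono) auto
    also have "\<dots> = 4 / (al * be)" using 3 by (simp add: power_divide)
    finally have "i * j \<le> 1" using 3 by (simp add: field_simps)
    then have "I * J \<le> 1" using i j by (simp add: ennreal_mult'[symmetric] flip: ennreal_1)
    then show ?thesis using int[of u] int[of v] u v unfolding I_def J_def by simp
  qed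
qed

text \<open>Truncation at height N and monotone convergence. Values in \<open>ennreal\<close> are
  allowed because the induction over coordinates applies this to partial integrals whose finiteness
  is not known.\<close>

lemma gaussian_tau:
  fixes u v :: "real \<Rightarrow> ennreal"
  assumes s: "0 < s"
    and [measurable]: "u \<in> borel_measurable borel" "v \<in> borel_measurable borel"
    and uv: "\<And>x y. u x * v y \<le> ennreal (exp ((x - y)\<^sup>2 / (4 * s)))"
  shows "(\<integral>\<^sup>+x. u x \<partial>gaussian s) * (\<integral>\<^sup>+x. v x \<partial>gaussian s) \<le> 1"
proof -
  define U where "U = (\<lambda>N::nat. \<integral>\<^sup>+x. min (u x) (of_nat N) \<partial>gaussian s)"
  define V where "V = (\<lambda>N::nat. \<integral>\<^sup>+x. min (v x) (of_nat N) \<partial>gaussian s)"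
  have en: "min (w x) (of_nat N) = ennreal (enn2real (min (w x) (of_nat N)))" for w :: "real \<Rightarrow> ennreal" and N x
    by (rule ennreal_enn2real[symmetric]) (simp add: min_less_iff_disj of_nat_less_top)
  have UV: "U N * V N \<le> 1" for N
    unfolding U_def V_def
  proof (subst en, subst (2) en, rule gaussian_tau_bounded[OF s])
    fix x y
    show "enn2real (min (u x) (of_nat N)) \<le> real N" "enn2real (min (v x) (of_nat N)) \<le> real N"
      by (auto intro!: enn2real_leI simp: ennreal_of_nat_eq_real_of_nat)
    have "ennreal (enn2real (min (u x) (of_nat N)) * enn2real (min (v y) (of_nat N)))
       = min (u x) (of_nat N) * min (v y) (of_nat N)"
      by (subst (1 2) en) (simp only: ennreal_mult enn2real_nonneg)
    also have "\<dots> \<le> u x * v y" by (intro mult_mono) auto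
    also note uv
    finally show "enn2real (min (u x) (of_nat N)) * enn2real (min (v y) (of_nat N)) \<le> exp ((x - y)\<^sup>2 / (4 * s))"
      by (simp only: ennreal_le_iff exp_ge_zero)
  qed auto
  have mono: "incseq U" "incseq V"
    unfolding U_def V_def by (auto simp: incseq_def intro!: nn_integral_mono min.mono)
  have sup: "(\<integral>\<^sup>+x. w x \<partial>gaussian s) = (SUP N. \<integral>\<^sup>+x. min (w x) (of_nat N) \<partial>gaussian s)"
    if [measurable]: "w \<in> borel_measurable borel" for w :: "real \<Rightarrow> ennreal"
  proof -
    have "w x = (SUP N::nat. min (w x) (of_nat N))" for x
    proof -
      have "(SUP N::nat. min (w x) (of_nat N)) = min (w x) (SUP N::nat. of_nat N)"
        by (simp add: inf_min[symmetric] inf_SUP)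
      then show ?thesis by (simp add: ennreal_SUP_of_nat_eq_top)
    qed
    then have "(\<integral>\<^sup>+x. w x \<partial>gaussian s) = (\<integral>\<^sup>+x. (SUP N::nat. min (w x) (of_nat N)) \<partial>gaussian s)"
      by (intro nn_integral_cong)
    also have "\<dots> = (SUP N. \<integral>\<^sup>+x. min (w x) (of_nat N) \<partial>gaussian s)"
      by (intro nn_integral_monotone_convergence_SUP) (auto simp: incseq_def le_fun_def intro!: min.coboundedI2)
    finally show ?thesis .
  qed
  \<comment> \<open>Separate truncation levels, so that the two suprema can be taken one after the
    other.\<close>
  have "U M * V N \<le> 1" for M N
  proof -
    have "U M * V N \<le> U (max M N) * V (max M N)"
      using mono by (intro mult_mono) (auto simp: incseq_def)
    also note UV
    finally show ?thesis .
  qed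
  then have "(SUP N. V N) * U M \<le> 1" for M
    by (subst SUP_mult_right_ennreal) (auto intro!: SUP_least simp: mult.commute)
  then have "(SUP M. U M) * (SUP N. V N) \<le> 1"
    by (subst SUP_mult_right_ennreal) (auto intro!: SUP_least simp: mult.commute)
  then show ?thesis using sup[of u] sup[of v] unfolding U_def V_def by simp
qed

section \<open>Tensorization of property (tau)\<close>

abbreviation gaussians :: "('i \<Rightarrow> real) \<Rightarrow> 'i set \<Rightarrow> ('i \<Rightarrow> real) measure" where
  "gaussians s I \<equiv> \<Pi>\<^sub>M i\<in>I. gaussian (s i)"

text \<open>Euclidean distance after rescaling every coordinate to unit variance; with respect to it
  the concentration constants do not depend on the dimension.\<close>

abbreviation gauss_dist :: "('i \<Rightarrow> real) \<Rightarrow> 'i set \<Rightarrow> ('i \<Rightarrow> real) \<Rightarrow> ('i \<Rightarrow> real) \<Rightarrow> real" where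
  "gauss_dist s I x y \<equiv> sqrt (\<Sum>i\<in>I. (x i - y i)\<^sup>2 / s i)"

text \<open>The cost is a sum over coordinates. For fixed values t and r of the new coordinate the
  induction hypothesis bounds the product of the partial integrals by the cost of (t, r), which is
  the hypothesis of the one-dimensional case. Only extensional arguments matter, as these are the
  points of the product space.\<close>

lemma PiM_gaussian_tau:
  fixes u v :: "('i \<Rightarrow> real) \<Rightarrow> ennreal" and s :: "'i \<Rightarrow> real"
  assumes "finite I" and s: "\<And>i. 0 < s i"
    and "u \<in> borel_measurable (gaussians s I)" "v \<in> borel_measurable (gaussians s I)"
    and "\<And>x y. x \<in> extensional I \<Longrightarrow> y \<in> extensional I \<Longrightarrow>
           u x * v y \<le> ennreal (exp (\<Sum>i\<in>I. (x i - y i)\<^sup>2 / (4 * s i)))"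
  shows "(\<integral>\<^sup>+x. u x \<partial>gaussians s I) * (\<integral>\<^sup>+x. v x \<partial>gaussians s I) \<le> 1"
  using assms(1,3-)
proof (induction I arbitrary: u v rule: finite_induct)
  case empty
  show ?case using empty(3)[of "\<lambda>_. undefined" "\<lambda>_. undefined"] empty(1,2)
    by (simp add: PiM_empty nn_integral_count_space_finite)
next
  case (insert j I)
  interpret product_sigma_finite "\<lambda>i. gaussian (s i)"
    by (simp add: product_sigma_finite_def prob_space_imp_sigma_finite prob_space_gaussian s)
  note [measurable] = insert.prems(1,2)
  define U where "U = (\<lambda>t. \<integral>\<^sup>+x. u (x(j := t)) \<partial>gaussians s I)"
  define V where "V = (\<lambda>t. \<integral>\<^sup>+x. v (x(j := t)) \<partial>gaussians s I)"
  interpret sigma_finite_measure "gaussians s I"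
    by (rule sigma_finite[OF insert.hyps(1)])
  have [measurable]: "(\<lambda>x. x(j := t)) \<in> measurable (gaussians s I) (gaussians s (insert j I))" for t
    by (rule measurable_fun_upd[where J=I]) auto
  have [measurable]: "(\<lambda>(t, x). x(j := t)) \<in> measurable (borel \<Otimes>\<^sub>M (gaussians s I)) (gaussians s (insert j I))"
    unfolding case_prod_beta by (rule measurable_fun_upd[where J=I]) auto
  have "(\<lambda>p. u ((\<lambda>(t, x). x(j := t)) p)) \<in> borel_measurable (borel \<Otimes>\<^sub>M (gaussians s I))"
    "(\<lambda>p. v ((\<lambda>(t, x). x(j := t)) p)) \<in> borel_measurable (borel \<Otimes>\<^sub>M (gaussians s I))"
    by measurable
  then have [measurable]: "U \<in> borel_measurable borel" "V \<in> borel_measurable borel"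
    unfolding U_def V_def by (auto intro!: borel_measurable_nn_integral simp: case_prod_beta)
  have UV: "U t * V r \<le> ennreal (exp ((t - r)\<^sup>2 / (4 * s j)))" for t r
  proof -
    \<comment> \<open>Dividing u by the cost of the new coordinate leaves exactly the cost over
      I.\<close>
    define c where "c = exp ((t - r)\<^sup>2 / (4 * s j))"
    have c: "0 < c" by (simp add: c_def)
    have "(\<integral>\<^sup>+x. u (x(j := t)) * inverse (ennreal c) \<partial>gaussians s I) * V r \<le> 1"
      unfolding V_def
    proof (rule insert.IH)
      fix x y :: "'i \<Rightarrow> real" assume "x \<in> extensional I" "y \<in> extensional I"
      then have "x(j := t) \<in> extensional (insert j I)" "y(j := r) \<in> extensional (insert j I)"
        by (auto simp: extensional_def)
      then have "u (x(j := t)) * v (y(j := r)) \<le> ennreal (exp (\<Sum>i\<in>insert j I. ((x(j := t)) i - (y(j := r)) i)\<^sup>2 / (4 * s i)))"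
        by (rule insert.prems)
      also have "(\<Sum>i\<in>insert j I. ((x(j := t)) i - (y(j := r)) i)\<^sup>2 / (4 * s i)) =
          (t - r)\<^sup>2 / (4 * s j) + (\<Sum>i\<in>I. (x i - y i)\<^sup>2 / (4 * s i))"
        using insert.hyps by (simp, intro sum.cong) auto
      also have "ennreal (exp \<dots>) = ennreal (exp (\<Sum>i\<in>I. (x i - y i)\<^sup>2 / (4 * s i))) * ennreal c"
        by (simp add: exp_add c_def ennreal_mult' mult.commute)
      finally have "u (x(j := t)) * v (y(j := r)) * inverse (ennreal c) \<le> ennreal (exp (\<Sum>i\<in>I. (x i - y i)\<^sup>2 / (4 * s i))) * ennreal c * inverse (ennreal c)"
        by (rule mult_right_mono) simp
      also have "\<dots> = ennreal (exp (\<Sum>i\<in>I. (x i - y i)\<^sup>2 / (4 * s i)))"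
        using c by (simp add: mult.assoc inverse_ennreal flip: ennreal_mult')
      finally show "u (x(j := t)) * inverse (ennreal c) * v (y(j := r)) \<le> ennreal (exp (\<Sum>i\<in>I. (x i - y i)\<^sup>2 / (4 * s i)))"
        by (simp add: ac_simps)
    qed measurable
    also have "(\<integral>\<^sup>+x. u (x(j := t)) * inverse (ennreal c) \<partial>gaussians s I) = U t * inverse (ennreal c)"
      unfolding U_def by (rule nn_integral_multc) measurable
    finally have "U t * inverse (ennreal c) * V r * ennreal c \<le> 1 * ennreal c"
      by (rule mult_right_mono) simp
    also have "U t * inverse (ennreal c) * V r * ennreal c = U t * V r * (inverse (ennreal c) * ennreal c)"
      by (simp only: ac_simps)
    also have "inverse (ennreal c) * ennreal c = 1"
      using c by (simp add: inverse_ennreal flip: ennreal_mult')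
    finally show ?thesis by (simp add: c_def)
  qed
  have "(\<integral>\<^sup>+x. u x \<partial>gaussians s (insert j I)) = (\<integral>\<^sup>+t. U t \<partial>gaussian (s j))"
    "(\<integral>\<^sup>+x. v x \<partial>gaussians s (insert j I)) = (\<integral>\<^sup>+t. V t \<partial>gaussian (s j))"
    unfolding U_def V_def using insert.hyps by (auto intro!: product_nn_integral_insert_rev)
  then show ?case using gaussian_tau[OF s, of U V j] UV by simp
qed

text \<open>The infimum convolution of an \<open>L\<close>-Lipschitz function with the quadratic cost lowers it by at most \<open>L\<^sup>2\<close>,
  because \<open>L d - d\<^sup>2 / 4 \<le> L\<^sup>2\<close>.\<close>

lemma PiM_gaussian_laplace:
  fixes F :: "('i \<Rightarrow> real) \<Rightarrow> real" and s :: "'i \<Rightarrow> real"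
  defines "G \<equiv> gaussians s"
  assumes I: "finite I" and s: "\<And>i. 0 < s i" and L: "0 \<le> L"
    and F[measurable]: "F \<in> borel_measurable (G I)"
    and lip: "\<And>x y. x \<in> extensional I \<Longrightarrow> y \<in> extensional I \<Longrightarrow>
           \<bar>F x - F y\<bar> \<le> L * gauss_dist s I x y"
  shows "(\<integral>\<^sup>+x. ennreal (exp (F x)) \<partial>G I) * (\<integral>\<^sup>+x. ennreal (exp (- F x)) \<partial>G I) \<le> ennreal (exp (L\<^sup>2))"
proof -
  have "(\<integral>\<^sup>+x. ennreal (exp (F x - L\<^sup>2)) \<partial>G I) * (\<integral>\<^sup>+x. ennreal (exp (- F x)) \<partial>G I) \<le> 1"
    unfolding G_def
  proof (rule PiM_gaussian_tau[OF I s])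
    fix x y :: "'i \<Rightarrow> real" assume xy: "x \<in> extensional I" "y \<in> extensional I"
    define d where "d = gauss_dist s I x y"
    have "F x - F y \<le> L * d" using lip[OF xy] unfolding d_def by linarith
    moreover have "L * d \<le> L\<^sup>2 + d\<^sup>2 / 4"
      using sum_squares_bound[of L "d/2"] by (simp add: power_divide)
    moreover have "d\<^sup>2 = (\<Sum>i\<in>I. (x i - y i)\<^sup>2 / s i)"
      unfolding d_def using s by (intro real_sqrt_pow2 sum_nonneg divide_nonneg_nonneg) (auto simp: less_imp_le)
    moreover have "(\<Sum>i\<in>I. (x i - y i)\<^sup>2 / s i) / 4 = (\<Sum>i\<in>I. (x i - y i)\<^sup>2 / (4 * s i))"
      by (simp add: sum_divide_distrib mult.commute)
    ultimately have "F x - L\<^sup>2 + - F y \<le> (\<Sum>i\<in>I. (x i - y i)\<^sup>2 / (4 * s i))" by linarith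
    then show "ennreal (exp (F x - L\<^sup>2)) * ennreal (exp (- F y)) \<le> ennreal (exp (\<Sum>i\<in>I. (x i - y i)\<^sup>2 / (4 * s i)))"
      by (simp flip: ennreal_mult' exp_add)
  qed (use F in \<open>auto simp: G_def\<close>)
  moreover have "(\<integral>\<^sup>+x. ennreal (exp (F x)) \<partial>G I) = ennreal (exp (L\<^sup>2)) * (\<integral>\<^sup>+x. ennreal (exp (F x - L\<^sup>2)) \<partial>G I)"
    by (subst nn_integral_cmult[symmetric]) (auto simp flip: ennreal_mult' exp_add)
  ultimately show ?thesis
    using mult_left_mono[of _ 1 "ennreal (exp (L\<^sup>2))"] by (simp add: mult.assoc)
qed

section \<open>Moments and tails of Lipschitz functions of Gaussian vectors\<close>

lemma prob_space_PiM_gaussian: "(\<And>i. 0 < s i) \<Longrightarrow> prob_space (gaussians s I)"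
  by (intro prob_space_PiM prob_space_gaussian)

text \<open>The Laplace estimate is applied to all multiples t F. Jensen's inequality bounds the
  factor with -t F from below, which leaves the moment generating function of F minus its mean
  bounded by exp(t^2 L^2). Markov's inequality turns this into the tail, and x^2 <= exp x + exp(-x)
  - 2 at x = (F - mean)/L into the variance, with 2 exp 1 - 2 <= 4.\<close>

lemma PiM_gaussian_lipschitz:
  fixes F :: "('i \<Rightarrow> real) \<Rightarrow> real" and s :: "'i \<Rightarrow> real"
  defines "G \<equiv> gaussians s"
  assumes I: "finite I" and s: "\<And>i. 0 < s i" and L: "0 < L"
    and F[measurable]: "F \<in> borel_measurable (G I)"
    and lip: "\<And>x y. x \<in> extensional I \<Longrightarrow> y \<in> extensional I \<Longrightarrow>
           \<bar>F x - F y\<bar> \<le> L * gauss_dist s I x y"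
  shows integrable_PiM_gaussian_lipschitz: "integrable (G I) F"
    and integrable_square_PiM_gaussian_lipschitz: "integrable (G I) (\<lambda>x. (F x)\<^sup>2)"
    and variance_PiM_gaussian_lipschitz: "(\<integral>x. (F x - (\<integral>x. F x \<partial>G I))\<^sup>2 \<partial>G I) \<le> 4 * L\<^sup>2"
    and tail_PiM_gaussian_lipschitz:
      "0 < r \<Longrightarrow> measure (G I) {x \<in> space (G I). (\<integral>x. F x \<partial>G I) + r \<le> F x} \<le> exp (- (r\<^sup>2 / (4 * L\<^sup>2)))"
proof -
  interpret prob_space "G I" unfolding G_def by (rule prob_space_PiM_gaussian[OF s])
  have prod: "(\<integral>\<^sup>+x. ennreal (exp (t * F x)) \<partial>G I) * (\<integral>\<^sup>+x. ennreal (exp (- (t * F x))) \<partial>G I) \<le> ennreal (exp (t\<^sup>2 * L\<^sup>2))" for t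
  proof -
    have "(\<integral>\<^sup>+x. ennreal (exp (t * F x)) \<partial>G I) * (\<integral>\<^sup>+x. ennreal (exp (- (t * F x))) \<partial>G I) \<le> ennreal (exp ((\<bar>t\<bar> * L)\<^sup>2))"
      unfolding G_def
    proof (rule PiM_gaussian_laplace[OF I s])
      fix x y :: "'i \<Rightarrow> real" assume xy: "x \<in> extensional I" "y \<in> extensional I"
      have "\<bar>t * F x - t * F y\<bar> = \<bar>t\<bar> * \<bar>F x - F y\<bar>" by (simp add: abs_mult flip: right_diff_distrib)
      then show "\<bar>t * F x - t * F y\<bar> \<le> \<bar>t\<bar> * L * gauss_dist s I x y"
        using lip[OF xy] by (simp add: mult.assoc mult_left_mono)
    qed (use L F in \<open>auto simp: G_def\<close>)
    then show ?thesis by (simp add: power_mult_distrib)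
  qed
  \<comment> \<open>Neither factor of the finite product is 0, so neither is infinite: this is how
    integrability of exp(t F) is obtained.\<close>
  have pos: "(\<integral>\<^sup>+x. ennreal (exp (t * F x)) \<partial>G I) \<noteq> 0" for t
  proof
    assume "(\<integral>\<^sup>+x. ennreal (exp (t * F x)) \<partial>G I) = 0"
    then have "AE x in G I. ennreal (exp (t * F x)) = 0" by (subst (asm) nn_integral_0_iff_AE) auto
    then have "AE x in G I. False" by (rule AE_mp) auto
    then show False by (simp add: AE_False)
  qed
  have fin: "integrable (G I) (\<lambda>x. exp (t * F x))" for t
  proof -
    have "(\<integral>\<^sup>+x. ennreal (exp (t * F x)) \<partial>G I) < \<infinity>"
    proof (rule ccontr)
      assume "\<not> (\<integral>\<^sup>+x. ennreal (exp (t * F x)) \<partial>G I) < \<infinity>"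
      then have "(\<integral>\<^sup>+x. ennreal (exp (t * F x)) \<partial>G I) = top" by (simp add: less_top[symmetric])
      then show False using prod[of t] pos[of "-t"] by (auto simp: ennreal_top_mult top_unique)
    qed
    then show ?thesis by (intro integrableI_bounded) auto
  qed
  \<comment> \<open>By cosh x = 1 + 2 (sinh (x/2))^2 and |sinh y| >= |y|.\<close>
  have ex2: "x\<^sup>2 \<le> exp x + exp (- x) - 2" for x :: real
  proof -
    have "1 + x\<^sup>2 / 2 \<le> cosh x"
    proof -
      have "cosh x = 1 + 2 * (sinh (x/2))\<^sup>2"
        using cosh_double_cosh[of "x/2"] cosh_square_eq[of "x/2"] by simp
      moreover have "(x/2)\<^sup>2 \<le> (sinh (x/2))\<^sup>2"
      proof (rule abs_le_square_iff[THEN iffD1])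
        have "\<bar>x/2\<bar> \<le> sinh \<bar>x/2\<bar>"
        proof (cases "x = 0")
          case False
          then have p: "0 < \<bar>x/2\<bar>" by simp
          have "\<exists>z>0. z < \<bar>x/2\<bar> \<and> sinh \<bar>x/2\<bar> - sinh 0 = (\<bar>x/2\<bar> - 0) * cosh z"
            by (rule MVT2[OF p]) (auto intro!: derivative_eq_intros)
          then obtain z where "sinh \<bar>x/2\<bar> = \<bar>x/2\<bar> * cosh z" by auto
          then show ?thesis using cosh_real_ge_1[of z] p mult_left_mono[of 1 "cosh z" "\<bar>x/2\<bar>"] by auto
        qed auto
        also have "sinh \<bar>x/2\<bar> = \<bar>sinh (x/2)\<bar>" by (simp add: abs_if)
        finally show "\<bar>x/2\<bar> \<le> \<bar>sinh (x/2)\<bar>" .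
      qed
      ultimately show ?thesis by (simp add: power_divide)
    qed
    then show ?thesis by (simp add: cosh_def)
  qed
  have int2: "integrable (G I) (\<lambda>x. exp (F x) + exp (- F x))"
    using fin[of 1] fin[of "-1"] by simp
  show sq: "integrable (G I) (\<lambda>x. (F x)\<^sup>2)"
  proof (rule Bochner_Integration.integrable_bound[OF int2])
    show "AE x in G I. norm ((F x)\<^sup>2) \<le> norm (exp (F x) + exp (- F x))"
    proof (rule AE_I2)
      fix x
      show "norm ((F x)\<^sup>2) \<le> norm (exp (F x) + exp (- F x))"
        using ex2[of "F x"] exp_gt_zero[of "F x"] exp_gt_zero[of "- F x"] zero_le_power2[of "F x"]
        unfolding real_norm_def by linarith
    qed
  qed measurable
  show iF: "integrable (G I) F"
    by (rule square_integrable_imp_integrable[OF F sq])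
  define \<mu> where "\<mu> = (\<integral>x. F x \<partial>G I)"
  have mgf: "(\<integral>x. exp (t * (F x - \<mu>)) \<partial>G I) \<le> exp (t\<^sup>2 * L\<^sup>2)" for t
  proof -
    \<comment> \<open>Jensen's inequality through the tangent line of the exponential at the
      mean.\<close>
    have "exp (- (t * \<mu>)) = (\<integral>x. exp (- (t * \<mu>)) * (1 - t * (F x - \<mu>)) \<partial>G I)"
      using iF by (simp add: prob_space \<mu>_def)
    also have "\<dots> \<le> (\<integral>x. exp (- t * F x) \<partial>G I)"
    proof (rule integral_mono)
      show "integrable (G I) (\<lambda>x. exp (- t * F x))" using fin[of "-t"] by simp
      fix x
      have "1 - t * (F x - \<mu>) \<le> exp (- (t * (F x - \<mu>)))"
        using exp_ge_add_one_self[of "- (t * (F x - \<mu>))"] by simp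
      then have "exp (- (t * \<mu>)) * (1 - t * (F x - \<mu>)) \<le> exp (- (t * \<mu>)) * exp (- (t * (F x - \<mu>)))"
        by (rule mult_left_mono) simp
      also have "\<dots> = exp (- t * F x)" by (simp add: algebra_simps flip: exp_add)
      finally show "exp (- (t * \<mu>)) * (1 - t * (F x - \<mu>)) \<le> exp (- t * F x)" .
    qed (use iF in auto)
    finally have 1: "exp (- (t * \<mu>)) \<le> (\<integral>x. exp (- t * F x) \<partial>G I)" .
    have "ennreal ((\<integral>x. exp (t * F x) \<partial>G I) * (\<integral>x. exp (- t * F x) \<partial>G I)) \<le> ennreal (exp (t\<^sup>2 * L\<^sup>2))"
      using prod[of t] fin[of t] fin[of "-t"]
      by (subst ennreal_mult) (auto simp: nn_integral_eq_integral)
    then have 2: "(\<integral>x. exp (t * F x) \<partial>G I) * (\<integral>x. exp (- t * F x) \<partial>G I) \<le> exp (t\<^sup>2 * L\<^sup>2)"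
      by (simp add: ennreal_le_iff)
    have "(\<integral>x. exp (t * (F x - \<mu>)) \<partial>G I) = (\<integral>x. exp (t * F x) * exp (- (t * \<mu>)) \<partial>G I)"
      by (intro Bochner_Integration.integral_cong) (auto simp: algebra_simps simp flip: exp_add)
    also have "\<dots> = (\<integral>x. exp (t * F x) \<partial>G I) * exp (- (t * \<mu>))" by simp
    also have "\<dots> \<le> (\<integral>x. exp (t * F x) \<partial>G I) * (\<integral>x. exp (- t * F x) \<partial>G I)"
      by (intro mult_left_mono 1) simp
    finally show ?thesis using 2 by simp
  qed
  have fin': "integrable (G I) (\<lambda>x. exp (t * (F x - \<mu>)))" for t
  proof -
    have "(\<lambda>x. exp (t * (F x - \<mu>))) = (\<lambda>x. exp (t * F x) * exp (- (t * \<mu>)))"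
      by (auto simp: algebra_simps simp flip: exp_add)
    then show ?thesis using fin[of t] by simp
  qed
  have sq': "integrable (G I) (\<lambda>x. (F x - \<mu>)\<^sup>2)"
    unfolding power2_diff using sq iF by auto
  have "(1/L)\<^sup>2 * (\<integral>x. (F x - \<mu>)\<^sup>2 \<partial>G I) = (\<integral>x. (1/L * (F x - \<mu>))\<^sup>2 \<partial>G I)"
    by (subst power_mult_distrib) simp
  also have "\<dots> \<le> (\<integral>x. exp (1/L * (F x - \<mu>)) + exp (- 1/L * (F x - \<mu>)) - 2 \<partial>G I)"
    by (rule integral_mono)
       (use ex2[of "1/L * (F x - \<mu>)" for x] sq' fin'[of "1/L"] fin'[of "-1/L"] in \<open>auto simp: power_mult_distrib power_divide\<close>)
  also have "\<dots> = (\<integral>x. exp (1/L * (F x - \<mu>)) \<partial>G I) + (\<integral>x. exp (- 1/L * (F x - \<mu>)) \<partial>G I) - 2"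
    using fin'[of "1/L"] fin'[of "-1/L"] by (simp add: prob_space)
  also have "\<dots> \<le> exp 1 + exp 1 - 2"
    using mgf[of "1/L"] mgf[of "-1/L"] L by (simp add: power_divide)
  also have "\<dots> \<le> 4" using exp_le by simp
  finally show "(\<integral>x. (F x - (\<integral>x. F x \<partial>G I))\<^sup>2 \<partial>G I) \<le> 4 * L\<^sup>2"
    unfolding \<mu>_def[symmetric] using L by (simp add: power_divide field_simps)
  assume r: "0 < r"
  \<comment> \<open>The minimizer of t^2 L^2 - t r.\<close>
  define t where "t = r / (2 * L\<^sup>2)"
  have t: "0 < t" using r L by (simp add: t_def)
  have "measure (G I) {x \<in> space (G I). \<mu> + r \<le> F x} = measure (G I) {x \<in> space (G I). exp (t * r) \<le> exp (t * (F x - \<mu>))}"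
    using t by (intro arg_cong[where f="measure (G I)"]) auto
  also have "\<dots> \<le> (\<integral>x. exp (t * (F x - \<mu>)) \<partial>G I) / exp (t * r)"
    by (rule integral_Markov_inequality_measure[where A="{}"]) (use fin' in auto)
  also have "\<dots> \<le> exp (t\<^sup>2 * L\<^sup>2) / exp (t * r)" by (intro divide_right_mono mgf) simp
  also have "\<dots> = exp (t\<^sup>2 * L\<^sup>2 - t * r)" by (simp add: exp_diff)
  also have "t\<^sup>2 * L\<^sup>2 - t * r = - (r\<^sup>2 / (4 * L\<^sup>2))"
    using L unfolding t_def by (simp add: field_simps power2_eq_square)
  finally show "measure (G I) {x \<in> space (G I). (\<integral>x. F x \<partial>G I) + r \<le> F x} \<le> exp (- (r\<^sup>2 / (4 * L\<^sup>2)))"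
    unfolding \<mu>_def .
qed

section \<open>Spectral calculus\<close>

definition orthonormal_rows :: "nat \<Rightarrow> (nat \<Rightarrow> nat \<Rightarrow> real) \<Rightarrow> bool" where
  "orthonormal_rows n u \<longleftrightarrow> (\<forall>a<n. \<forall>b<n. (\<Sum>i<n. u a i * u b i) = (if a = b then 1 else 0))"

text \<open>\<open>eigdecomp\<close> without the ordering of the eigenvalues; the functional
  calculus is insensitive to the order.\<close>

definition diagonalizes :: "nat \<Rightarrow> (nat \<Rightarrow> nat \<Rightarrow> real) \<Rightarrow> (nat \<Rightarrow> real) \<Rightarrow> (nat \<Rightarrow> nat \<Rightarrow> real) \<Rightarrow> bool" where
  "diagonalizes n A lam u \<longleftrightarrow> orthonormal_rows n u \<and> (\<forall>i<n. \<forall>j<n. A i j = (\<Sum>l<n. lam l * u l i * u l j))"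

lemma sum_delta_lt:
  fixes a n :: nat and f :: "nat \<Rightarrow> real"
  assumes "a < n"
  shows "(\<Sum>l<n. (if a = l then 1 else 0) * f l) = f a"
    "(\<Sum>l<n. (if l = a then 1 else 0) * f l) = f a"
proof -
  have "(if a = l then 1 else 0) * f l = (if a = l then f l else 0)"
    "(if l = a then 1 else 0) * f l = (if l = a then f l else 0)" for l
    by auto
  then show "(\<Sum>l<n. (if a = l then 1 else 0) * f l) = f a" "(\<Sum>l<n. (if l = a then 1 else 0) * f l) = f a"
    using assms by (simp_all only: sum.delta sum.delta' finite_lessThan lessThan_iff if_True)
qed

text \<open>Bessel's inequality, with equality because the squared norms of the columns add up to \<open>n\<close>.\<close>

lemma orthonormal_rows_complete:
  assumes u: "orthonormal_rows n u" and ij: "i < n" "j < n"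
  shows "(\<Sum>l<n. u l i * u l j) = (if i = j then 1 else 0)"
proof -
  define P where "P = (\<lambda>i j. \<Sum>l<n. u l i * u l j)"
  have orth: "(\<Sum>i<n. u a i * u b i) = (if a = b then 1 else 0)" if "a < n" "b < n" for a b
    using u that unfolding orthonormal_rows_def by blast
  have PP: "(\<Sum>j<n. P i j * P i j) = P i i" for i
  proof -
    have "(\<Sum>j<n. P i j * P i j) = (\<Sum>j<n. \<Sum>l<n. \<Sum>m<n. (u l i * u m i) * (u l j * u m j))"
      unfolding P_def sum_product by (intro sum.cong refl) (simp add: ac_simps)
    also have "\<dots> = (\<Sum>l<n. \<Sum>j<n. \<Sum>m<n. (u l i * u m i) * (u l j * u m j))"
      by (rule sum.swap)
    also have "\<dots> = (\<Sum>l<n. \<Sum>m<n. \<Sum>j<n. (u l i * u m i) * (u l j * u m j))"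
      by (intro sum.cong refl sum.swap)
    also have "\<dots> = (\<Sum>l<n. \<Sum>m<n. (u l i * u m i) * (if l = m then 1 else 0))"
      by (intro sum.cong refl) (simp add: orth flip: sum_distrib_left)
    also have "\<dots> = P i i" unfolding P_def
      by (intro sum.cong refl) (simp add: if_distrib[of "\<lambda>x. _ * x"] cong: if_cong)
    finally show ?thesis .
  qed
  \<comment> \<open>P is a symmetric projection, so the squared distance of its row i from the unit
    vector is 1 - P i i. These numbers are nonnegative and will be seen to add up to 0.\<close>
  have sq: "(\<Sum>j<n. ((if i = j then 1 else 0) - P i j)\<^sup>2) = 1 - P i i" if "i < n" for i
  proof -
    have "(\<Sum>j<n. ((if i = j then 1 else 0) - P i j)\<^sup>2) =
      (\<Sum>j<n. (if i = j then 1 else 0) * (1 - 2 * P i j) + P i j * P i j)"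
      by (intro sum.cong refl) (auto simp: power2_eq_square algebra_simps)
    also have "\<dots> = 1 - 2 * P i i + P i i"
      unfolding sum.distrib PP sum_delta_lt(1)[OF that] ..
    finally show ?thesis by simp
  qed
  have nn: "0 \<le> 1 - P i i" if "i < n" for i
    unfolding sq[OF that, symmetric] by (intro sum_nonneg) simp
  have "(\<Sum>i<n. 1 - P i i) = real n - (\<Sum>l<n. \<Sum>i<n. u l i * u l i)"
    unfolding P_def sum_subtractf by (subst sum.swap) simp
  also have "\<dots> = 0" by (simp add: orth)
  finally have "1 - P i i = 0"
    using nn ij(1) by (subst (asm) sum_nonneg_eq_0_iff) auto
  then have "(\<Sum>j<n. ((if i = j then 1 else 0) - P i j)\<^sup>2) = 0"
    using sq[OF ij(1)] by simp
  then have "((if i = j then 1 else 0) - P i j)\<^sup>2 = 0"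
    using ij by (subst (asm) sum_nonneg_eq_0_iff) auto
  then show ?thesis unfolding P_def by simp
qed

text \<open>The orthonormality equations are closed and force entries into [-1, 1]. Setting the
  entries outside the n by n block to 0 places the set in a product of intervals and singletons,
  which is compact by Tychonoff's theorem.\<close>

lemma compact_orthonormal_rows:
  "compact {u :: nat \<times> nat \<Rightarrow> real. orthonormal_rows n (curry u) \<and> (\<forall>p. p \<notin> {..<n} \<times> {..<n} \<longrightarrow> u p = 0)}"
  (is "compact ?O")
proof -
  define S where "S = (\<lambda>p. if p \<in> {..<n} \<times> {..<n} then {-1..1::real} else {0})"
  have "compactin (product_topology (\<lambda>_. euclidean) UNIV) (PiE UNIV S)"
    unfolding compactin_PiE by (auto simp: S_def)
  then have c: "compact (PiE UNIV S)"
    by (simp add: euclidean_product_topology)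
  have co: "continuous_on UNIV (\<lambda>u. u p)" for p :: "nat \<times> nat"
    by (rule continuous_on_product_coordinates)
  have "closed ?O"
  proof -
    have "?O = (\<Inter>a\<in>{..<n}. \<Inter>b\<in>{..<n}. {u. (\<Sum>i<n. u (a, i) * u (b, i)) = (if a = b then 1 else 0)}) \<inter>
        (\<Inter>p\<in>- ({..<n} \<times> {..<n}). {u. u p = 0})"
      by (auto simp: orthonormal_rows_def)
    moreover have "closed \<dots>"
      by (intro closed_Int closed_INT ballI closed_Collect_eq continuous_on_sum continuous_on_mult continuous_on_const co)
    ultimately show ?thesis by simp
  qed
  moreover have "?O \<subseteq> PiE UNIV S"
  proof
    fix u assume u: "u \<in> ?O"
    have "\<bar>u (a, i)\<bar> \<le> 1" if "a < n" "i < n" for a i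
    proof -
      have "u (a, i) * u (a, i) \<le> (\<Sum>i<n. u (a, i) * u (a, i))"
        using that by (intro member_le_sum) auto
      also have "\<dots> = 1" using u that by (auto simp: orthonormal_rows_def)
      finally have "(u (a, i))\<^sup>2 \<le> 1" by (simp only: power2_eq_square)
      then show ?thesis by (simp only: abs_square_le_1)
    qed
    moreover have "u p = 0" if "p \<notin> {..<n} \<times> {..<n}" for p
      using u that by blast
    ultimately have "u p \<in> S p" for p
      unfolding S_def by (cases p) (auto simp: abs_le_iff minus_le_iff)
    then show "u \<in> PiE UNIV S" by (simp add: PiE_UNIV_domain)
  qed
  ultimately show ?thesis using compact_Int_closed[OF c, of ?O] by (simp only: Int_absorb1)
qed

section \<open>Diagonalization by Jacobi rotations\<close>

definition quad :: "nat \<Rightarrow> (nat \<Rightarrow> nat \<Rightarrow> real) \<Rightarrow> (nat \<Rightarrow> real) \<Rightarrow> (nat \<Rightarrow> real) \<Rightarrow> real" where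
  "quad n A x y = (\<Sum>i<n. \<Sum>j<n. x i * A i j * y j)"

lemma quad_linear:
  "quad n A (\<lambda>i. c * x i + d * y i) z = c * quad n A x z + d * quad n A y z"
  "quad n A z (\<lambda>i. c * x i + d * y i) = c * quad n A z x + d * quad n A z y"
  unfolding quad_def sum_distrib_left sum.distrib[symmetric]
  by (auto intro!: sum.cong simp: algebra_simps)

lemma quad_commute:
  assumes "\<And>i j. i < n \<Longrightarrow> j < n \<Longrightarrow> A i j = A j i"
  shows "quad n A x y = quad n A y x"
  unfolding quad_def by (subst sum.swap) (auto intro!: sum.cong simp: assms)

text \<open>Rotation by half the polar angle of the vector (al - ga, 2 be) diagonalizes the 2 by 2
  block. The sum of the diagonal entries is kept while their difference grows to D, so the sum of
  their squares gains 2 be^2.\<close>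

lemma quad_rotation:
  assumes sym: "\<And>i j. i < n \<Longrightarrow> j < n \<Longrightarrow> A i j = A j i" and beta: "quad n A x y \<noteq> 0"
  obtains c d where "c\<^sup>2 + d\<^sup>2 = 1"
    "(quad n A x x)\<^sup>2 + (quad n A y y)\<^sup>2 <
     (quad n A (\<lambda>i. c * x i + d * y i) (\<lambda>i. c * x i + d * y i))\<^sup>2 +
     (quad n A (\<lambda>i. (-d) * x i + c * y i) (\<lambda>i. (-d) * x i + c * y i))\<^sup>2"
proof -
  define al ga be where "al = quad n A x x" and "ga = quad n A y y" and "be = quad n A x y"
  have be': "quad n A y x = be" unfolding be_def by (rule quad_commute[OF sym])
  define D where "D = sqrt ((al - ga)\<^sup>2 + (2 * be)\<^sup>2)"
  have D2: "D\<^sup>2 = (al - ga)\<^sup>2 + (2 * be)\<^sup>2" unfolding D_def by simp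
  have D: "0 < D" unfolding D_def using beta by (simp add: be_def add_nonneg_pos)
  have "((al - ga) / D)\<^sup>2 + (2 * be / D)\<^sup>2 = 1"
    unfolding power_divide add_divide_distrib[symmetric] D2[symmetric] using D by simp
  then obtain t where t: "(al - ga) / D = cos t" "2 * be / D = sin t"
    using sincos_total_2pi by metis
  define c d where "c = cos (t / 2)" and "d = sin (t / 2)"
  have cd: "c\<^sup>2 + d\<^sup>2 = 1" unfolding c_def d_def by simp
  have cs: "cos t = c\<^sup>2 - d\<^sup>2" "sin t = 2 * c * d"
    unfolding c_def d_def using cos_double[of "t/2"] sin_double[of "t/2"] by auto
  define al' where "al' = quad n A (\<lambda>i. c * x i + d * y i) (\<lambda>i. c * x i + d * y i)"
  define ga' where "ga' = quad n A (\<lambda>i. (-d) * x i + c * y i) (\<lambda>i. (-d) * x i + c * y i)"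
  have al': "al' = c\<^sup>2 * al + 2 * c * d * be + d\<^sup>2 * ga"
    unfolding al'_def quad_linear al_def[symmetric] ga_def[symmetric] be_def[symmetric] be'
    by (simp add: power2_eq_square algebra_simps)
  have ga': "ga' = d\<^sup>2 * al - 2 * c * d * be + c\<^sup>2 * ga"
    unfolding ga'_def quad_linear al_def[symmetric] ga_def[symmetric] be_def[symmetric] be'
    by (simp add: power2_eq_square algebra_simps)
  have "al' + ga' = (c\<^sup>2 + d\<^sup>2) * (al + ga)" unfolding al' ga' by (simp add: algebra_simps)
  then have sum: "al' + ga' = al + ga" using cd by simp
  have "al' - ga' = (c\<^sup>2 - d\<^sup>2) * (al - ga) + 2 * c * d * (2 * be)"
    unfolding al' ga' by (simp add: algebra_simps)
  also have "\<dots> = (al - ga) / D * (al - ga) + 2 * be / D * (2 * be)"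
    unfolding t cs ..
  also have "\<dots> = D\<^sup>2 / D" unfolding D2 by (simp add: add_divide_distrib power2_eq_square)
  finally have diff: "al' - ga' = D" using D by (simp add: power2_eq_square)
  have "al'\<^sup>2 + ga'\<^sup>2 = ((al' + ga')\<^sup>2 + (al' - ga')\<^sup>2) / 2" by (simp add: power2_eq_square algebra_simps)
  also have "\<dots> = ((al + ga)\<^sup>2 + ((al - ga)\<^sup>2 + (2 * be)\<^sup>2)) / 2" unfolding sum diff D2 ..
  also have "\<dots> = al\<^sup>2 + ga\<^sup>2 + 2 * be\<^sup>2" by (simp add: power2_eq_square algebra_simps)
  finally have "al\<^sup>2 + ga\<^sup>2 < al'\<^sup>2 + ga'\<^sup>2" using beta by (simp add: be_def)
  then show ?thesis using that[OF cd] unfolding al_def ga_def al'_def ga'_def by blast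
qed

text \<open>Jacobi's method: an orthonormal basis maximizing the sum of the squared diagonal entries diagonalizes,
  since a nonzero off-diagonal entry could be moved to the diagonal by a rotation.\<close>

lemma symmetric_diagonalizes:
  assumes sym: "\<And>i j. i < n \<Longrightarrow> j < n \<Longrightarrow> A i j = A j i"
  shows "\<exists>lam u. diagonalizes n A lam u"
proof -
  define O' where "O' = {u :: nat \<times> nat \<Rightarrow> real. orthonormal_rows n (curry u) \<and> (\<forall>p. p \<notin> {..<n} \<times> {..<n} \<longrightarrow> u p = 0)}"
  define Ph where "Ph = (\<lambda>u :: nat \<times> nat \<Rightarrow> real. \<Sum>a<n. (quad n A (curry u a) (curry u a))\<^sup>2)"
  have comp: "compact O'" unfolding O'_def by (rule compact_orthonormal_rows)
  define e where "e = (\<lambda>(a, i). if a = i \<and> a < n then 1 else 0 :: real)"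
  have "(\<Sum>i<n. e (a, i) * e (b, i)) = (if a = b then 1 else 0)" if "a < n" "b < n" for a b
  proof -
    have "(\<Sum>i<n. e (a, i) * e (b, i)) = (\<Sum>i<n. (if a = i then 1 else 0) * e (b, i))"
      using that by (intro sum.cong refl) (simp add: e_def)
    also have "\<dots> = e (b, a)" using that by (simp only: sum_delta_lt)
    finally show ?thesis using that by (auto simp: e_def)
  qed
  then have "orthonormal_rows n (curry e)" by (simp add: orthonormal_rows_def)
  moreover have "e p = 0" if "p \<notin> {..<n} \<times> {..<n}" for p
    using that by (cases p) (auto simp: e_def)
  ultimately have "e \<in> O'" unfolding O'_def by blast
  then have ne: "O' \<noteq> {}" by blast
  have co: "continuous_on X (\<lambda>u. u p)" for p :: "nat \<times> nat" and X :: "(nat \<times> nat \<Rightarrow> real) set"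
    by (rule continuous_on_subset[OF continuous_on_product_coordinates]) auto
  have "continuous_on O' Ph"
    unfolding Ph_def quad_def curry_def
    by (intro continuous_on_sum continuous_on_power continuous_on_mult continuous_on_const co)
  then obtain w where w: "w \<in> O'" "\<And>v. v \<in> O' \<Longrightarrow> Ph v \<le> Ph w"
    using continuous_attains_sup[OF comp ne] by blast
  define u where "u = curry w"
  have u: "orthonormal_rows n u" using w(1) unfolding u_def O'_def by auto
  have orth: "(\<Sum>i<n. u a i * u b i) = (if a = b then 1 else 0)" if "a < n" "b < n" for a b
    using u that unfolding orthonormal_rows_def by blast
  have off: "quad n A (u a) (u b) = 0" if ab: "a < n" "b < n" "a \<noteq> b" for a b
  proof (rule ccontr)
    assume nz: "quad n A (u a) (u b) \<noteq> 0"
    obtain c d where cd: "c\<^sup>2 + d\<^sup>2 = 1" and less: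
      "(quad n A (u a) (u a))\<^sup>2 + (quad n A (u b) (u b))\<^sup>2 <
       (quad n A (\<lambda>i. c * u a i + d * u b i) (\<lambda>i. c * u a i + d * u b i))\<^sup>2 +
       (quad n A (\<lambda>i. (-d) * u a i + c * u b i) (\<lambda>i. (-d) * u a i + c * u b i))\<^sup>2"
      by (rule quad_rotation[OF sym nz])
    \<comment> \<open>Only the rows a and b change, so all other diagonal entries contribute to
      \<open>Ph\<close> as before.\<close>
    define v where "v = (\<lambda>l i. if l = a then c * u a i + d * u b i else if l = b then (-d) * u a i + c * u b i else u l i)"
    have va: "v a = (\<lambda>i. c * u a i + d * u b i)" and vb: "v b = (\<lambda>i. (-d) * u a i + c * u b i)"
      using ab by (auto simp: v_def)
    have vl: "v l = u l" if "l \<noteq> a" "l \<noteq> b" for l using that by (auto simp: v_def)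
    have lin: "(\<Sum>i<n. (p * x i + q * y i) * z i) = p * (\<Sum>i<n. x i * z i) + q * (\<Sum>i<n. y i * z i)"
      "(\<Sum>i<n. z i * (p * x i + q * y i)) = p * (\<Sum>i<n. z i * x i) + q * (\<Sum>i<n. z i * y i)" for p q :: real and x y z :: "nat \<Rightarrow> real"
      by (simp_all add: sum_distrib_left algebra_simps sum.distrib)
    have cd': "c * c + d * d = 1" using cd by (simp only: power2_eq_square)
    have ips: "(\<Sum>i<n. v a i * v a i) = 1" "(\<Sum>i<n. v b i * v b i) = 1" "(\<Sum>i<n. v a i * v b i) = 0"
      unfolding va vb lin using ab cd' by (simp_all add: orth)
    have ipl: "(\<Sum>i<n. v a i * u l i) = 0" "(\<Sum>i<n. v b i * u l i) = 0" if "l < n" "l \<noteq> a" "l \<noteq> b" for l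
      unfolding va vb lin using ab that by (simp_all add: orth)
    have "(\<Sum>i<n. v l i * v m i) = (if l = m then 1 else 0)" if lm: "l < n" "m < n" for l m
    proof -
      have comm: "(\<Sum>i<n. v m i * v l i) = (\<Sum>i<n. v l i * v m i)" by (simp only: mult.commute)
      consider "l = a" "m = a" | "l = a" "m = b" | "l = a" "m \<noteq> a" "m \<noteq> b" | "l = b" "m = a" | "l = b" "m = b"
        | "l = b" "m \<noteq> a" "m \<noteq> b" | "l \<noteq> a" "l \<noteq> b" "m = a" | "l \<noteq> a" "l \<noteq> b" "m = b"
        | "l \<noteq> a" "l \<noteq> b" "m \<noteq> a" "m \<noteq> b"
        by blast
      then show ?thesis
        by cases (use comm ips ipl[of l] ipl[of m] lm ab in \<open>simp_all add: vl orth\<close>)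
    qed
    then have "orthonormal_rows n v" unfolding orthonormal_rows_def by blast
    moreover have "v l i = 0" if "\<not> (l < n \<and> i < n)" for l i
      using that w(1) ab unfolding v_def u_def O'_def by auto
    ultimately have "case_prod v \<in> O'" unfolding O'_def by auto
    then have "Ph (case_prod v) \<le> Ph w" by (rule w(2))
    moreover have "Ph w < Ph (case_prod v)"
    proof -
      have split: "(\<Sum>l<n. f l) = f a + (f b + (\<Sum>l\<in>{..<n} - {a} - {b}. f l))" for f :: "nat \<Rightarrow> real"
        using ab by (subst sum.remove[of _ a], simp, simp, subst sum.remove[of _ b]) auto
      have "(\<Sum>l\<in>{..<n} - {a} - {b}. (quad n A (v l) (v l))\<^sup>2) = (\<Sum>l\<in>{..<n} - {a} - {b}. (quad n A (u l) (u l))\<^sup>2)"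
        by (intro sum.cong refl) (auto simp: vl)
      then show ?thesis
        unfolding Ph_def split using less unfolding va[symmetric] vb[symmetric]
        by (simp add: u_def[symmetric])
    qed
    ultimately show False by simp
  qed
  have "A i j = (\<Sum>l<n. quad n A (u l) (u l) * u l i * u l j)" if ij: "i < n" "j < n" for i j
  proof -
    \<comment> \<open>Adding the vanishing off-diagonal terms gives the full expansion of A in the
      basis, which completeness collapses once in each index.\<close>
    have "(\<Sum>l<n. quad n A (u l) (u l) * u l i * u l j) = (\<Sum>l<n. \<Sum>m<n. quad n A (u l) (u m) * (u l i * u m j))"
    proof (intro sum.cong refl)
      fix l assume l: "l \<in> {..<n}"
      have "(\<Sum>m<n. quad n A (u l) (u m) * (u l i * u m j)) = (\<Sum>m<n. (if l = m then 1 else 0) * (quad n A (u l) (u m) * (u l i * u m j)))"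
        using off l by (intro sum.cong refl) auto
      then show "quad n A (u l) (u l) * u l i * u l j = (\<Sum>m<n. quad n A (u l) (u m) * (u l i * u m j))"
        using l by (simp add: sum_delta_lt)
    qed
    also have "\<dots> = (\<Sum>l<n. \<Sum>m<n. \<Sum>p<n. \<Sum>q<n. (u l i * u l p) * (u m q * u m j) * A p q)"
      unfolding quad_def sum_distrib_right by (intro sum.cong refl) (simp add: ac_simps)
    also have "\<dots> = (\<Sum>l<n. \<Sum>p<n. \<Sum>m<n. \<Sum>q<n. (u l i * u l p) * (u m q * u m j) * A p q)"
      by (intro sum.cong refl sum.swap)
    also have "\<dots> = (\<Sum>p<n. \<Sum>l<n. \<Sum>m<n. \<Sum>q<n. (u l i * u l p) * (u m q * u m j) * A p q)"
      by (rule sum.swap)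
    also have "\<dots> = (\<Sum>p<n. \<Sum>l<n. \<Sum>q<n. \<Sum>m<n. (u l i * u l p) * (u m q * u m j) * A p q)"
      by (intro sum.cong refl sum.swap)
    also have "\<dots> = (\<Sum>p<n. \<Sum>q<n. \<Sum>l<n. \<Sum>m<n. (u l i * u l p) * (u m q * u m j) * A p q)"
      by (intro sum.cong refl sum.swap)
    also have "\<dots> = (\<Sum>p<n. \<Sum>q<n. (\<Sum>l<n. u l i * u l p) * (\<Sum>m<n. u m q * u m j) * A p q)"
    proof -
      have "(\<Sum>l<n. \<Sum>m<n. x l * y m * c) = (\<Sum>l<n. x l) * (\<Sum>m<n. y m) * c" for x y :: "nat \<Rightarrow> real" and c
        unfolding sum_distrib_right[symmetric] by (simp only: sum_product)
      then show ?thesis by simp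
    qed
    also have "\<dots> = (\<Sum>p<n. (if i = p then 1 else 0) * (\<Sum>q<n. (if q = j then 1 else 0) * A p q))"
      using ij by (intro sum.cong refl) (simp add: orthonormal_rows_complete[OF u] sum_distrib_left mult.assoc)
    also have "\<dots> = A i j" using ij by (simp only: sum_delta_lt)
    finally show ?thesis ..
  qed
  then have "diagonalizes n A (\<lambda>l. quad n A (u l) (u l)) u"
    using u by (simp add: diagonalizes_def)
  then show ?thesis by blast
qed

section \<open>Functional calculus and its Lipschitz continuity\<close>

definition matfun :: "nat \<Rightarrow> (real \<Rightarrow> real) \<Rightarrow> (nat \<Rightarrow> nat \<Rightarrow> real) \<Rightarrow> nat \<Rightarrow> nat \<Rightarrow> real" where
  "matfun n f A i j =
     (let (lam, u) = (SOME (lam, u). diagonalizes n A lam u) in \<Sum>l<n. f (lam l) * u l i * u l j)"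

definition frob2 :: "nat \<Rightarrow> (nat \<Rightarrow> nat \<Rightarrow> real) \<Rightarrow> real" where
  "frob2 n A = (\<Sum>i<n. \<Sum>j<n. (A i j)\<^sup>2)"

text \<open>Entries of the orthogonal matrix that relates two eigenbases.\<close>

definition overlap :: "nat \<Rightarrow> (nat \<Rightarrow> nat \<Rightarrow> real) \<Rightarrow> (nat \<Rightarrow> nat \<Rightarrow> real) \<Rightarrow> nat \<Rightarrow> nat \<Rightarrow> real" where
  "overlap n u v l m = (\<Sum>i<n. u l i * v m i)"

lemma orthonormal_rowsD:
  "orthonormal_rows n u \<Longrightarrow> a < n \<Longrightarrow> b < n \<Longrightarrow> (\<Sum>i<n. u a i * u b i) = (if a = b then 1 else 0)"
  unfolding orthonormal_rows_def by blast

lemma overlap_expand: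
  assumes u: "orthonormal_rows n u" and v: "orthonormal_rows n v"
  shows "l < n \<Longrightarrow> b < n \<Longrightarrow> (\<Sum>m<n. overlap n u v l m * v m b) = u l b"
    and "m < n \<Longrightarrow> a < n \<Longrightarrow> (\<Sum>l<n. u l a * overlap n u v l m) = v m a"
proof -
  assume "l < n" "b < n"
  have "(\<Sum>m<n. overlap n u v l m * v m b) = (\<Sum>m<n. \<Sum>i<n. u l i * (v m i * v m b))"
    unfolding overlap_def sum_distrib_right by (simp only: mult.assoc)
  also have "\<dots> = (\<Sum>i<n. u l i * (\<Sum>m<n. v m i * v m b))"
    by (subst sum.swap) (simp only: sum_distrib_left)
  also have "\<dots> = (\<Sum>i<n. (if i = b then 1 else 0) * u l i)"
    using \<open>b < n\<close> by (intro sum.cong refl) (simp add: orthonormal_rows_complete[OF v])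
  also have "\<dots> = u l b" using \<open>b < n\<close> by (simp only: sum_delta_lt)
  finally show "(\<Sum>m<n. overlap n u v l m * v m b) = u l b" .
next
  assume "m < n" "a < n"
  have "(\<Sum>l<n. u l a * overlap n u v l m) = (\<Sum>l<n. \<Sum>i<n. (u l i * u l a) * v m i)"
    unfolding overlap_def sum_distrib_left by (simp only: ac_simps)
  also have "\<dots> = (\<Sum>i<n. (\<Sum>l<n. u l i * u l a) * v m i)"
    by (subst sum.swap) (simp only: sum_distrib_right)
  also have "\<dots> = (\<Sum>i<n. (if i = a then 1 else 0) * v m i)"
    using \<open>a < n\<close> by (intro sum.cong refl) (simp add: orthonormal_rows_complete[OF u])
  also have "\<dots> = v m a" using \<open>a < n\<close> by (simp only: sum_delta_lt)
  finally show "(\<Sum>l<n. u l a * overlap n u v l m) = v m a" .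
qed

text \<open>Inserting completeness of the other eigenbasis expands both spectral sums in the
  products of u l with v m, so that their difference has coefficients overlap times difference of
  the values of f. Every comparison of two matrices below rests on this expansion.\<close>

lemma diagonalizes_difference:
  assumes A: "diagonalizes n A lam u" and B: "diagonalizes n B mu v" and ab: "a < n" "b < n"
  shows "(\<Sum>l<n. f (lam l) * u l a * u l b) - (\<Sum>m<n. f (mu m) * v m a * v m b)
     = (\<Sum>l<n. u l a * (\<Sum>m<n. v m b * (overlap n u v l m * (f (lam l) - f (mu m)))))"
proof -
  have u: "orthonormal_rows n u" and v: "orthonormal_rows n v"
    using A B by (auto simp: diagonalizes_def)
  have 1: "(\<Sum>l<n. f (lam l) * u l a * u l b) = (\<Sum>l<n. \<Sum>m<n. u l a * v m b * overlap n u v l m * f (lam l))"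
  proof (intro sum.cong refl)
    fix l assume "l \<in> {..<n}"
    then have "f (lam l) * u l a * u l b = f (lam l) * u l a * (\<Sum>m<n. overlap n u v l m * v m b)"
      using overlap_expand(1)[OF u v, of l b] ab by simp
    then show "f (lam l) * u l a * u l b = (\<Sum>m<n. u l a * v m b * overlap n u v l m * f (lam l))"
      by (simp add: sum_distrib_left ac_simps)
  qed
  have "(\<Sum>m<n. f (mu m) * v m a * v m b) = (\<Sum>m<n. \<Sum>l<n. u l a * v m b * overlap n u v l m * f (mu m))"
  proof (intro sum.cong refl)
    fix m assume "m \<in> {..<n}"
    then have "f (mu m) * v m a * v m b = f (mu m) * (\<Sum>l<n. u l a * overlap n u v l m) * v m b"
      using overlap_expand(2)[OF u v, of m a] ab by simp
    then show "f (mu m) * v m a * v m b = (\<Sum>l<n. u l a * v m b * overlap n u v l m * f (mu m))"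
      by (simp add: sum_distrib_left sum_distrib_right ac_simps)
  qed
  also have "\<dots> = (\<Sum>l<n. \<Sum>m<n. u l a * v m b * overlap n u v l m * f (mu m))"
    by (rule sum.swap)
  finally show ?thesis unfolding 1
    by (simp add: sum_subtractf[symmetric] sum_distrib_left algebra_simps)
qed

text \<open>A acts to the left on its eigenvector and B to the right on its own. For A = B this is
  the orthogonality of eigenvectors with different eigenvalues.\<close>

lemma overlap_eigen:
  assumes A: "diagonalizes n A lam u" and B: "diagonalizes n B mu v" and lm: "l < n" "m < n"
  shows "(\<Sum>i<n. u l i * (\<Sum>j<n. (A i j - B i j) * v m j)) = (lam l - mu m) * overlap n u v l m"
proof -
  have u: "orthonormal_rows n u" and v: "orthonormal_rows n v"
    using A B by (auto simp: diagonalizes_def)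
  have Bv: "(\<Sum>j<n. B i j * v m j) = mu m * v m i" if "i < n" for i
  proof -
    have "(\<Sum>j<n. B i j * v m j) = (\<Sum>j<n. \<Sum>k<n. mu k * v k i * (v k j * v m j))"
      using B that by (intro sum.cong refl) (simp add: diagonalizes_def sum_distrib_right mult.assoc)
    also have "\<dots> = (\<Sum>k<n. mu k * v k i * (\<Sum>j<n. v k j * v m j))"
      by (subst sum.swap) (simp only: sum_distrib_left)
    also have "\<dots> = (\<Sum>k<n. (if k = m then 1 else 0) * (mu k * v k i))"
      using lm by (intro sum.cong refl) (simp add: orthonormal_rowsD[OF v])
    also have "\<dots> = mu m * v m i" using lm by (simp only: sum_delta_lt)
    finally show ?thesis .
  qed
  have uA: "(\<Sum>i<n. u l i * A i j) = lam l * u l j" if "j < n" for j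
  proof -
    have "(\<Sum>i<n. u l i * A i j) = (\<Sum>i<n. \<Sum>k<n. lam k * u k j * (u l i * u k i))"
      using A that by (intro sum.cong refl) (simp add: diagonalizes_def sum_distrib_left ac_simps)
    also have "\<dots> = (\<Sum>k<n. lam k * u k j * (\<Sum>i<n. u l i * u k i))"
      by (subst sum.swap) (simp only: sum_distrib_left)
    also have "\<dots> = (\<Sum>k<n. (if l = k then 1 else 0) * (lam k * u k j))"
      using lm by (intro sum.cong refl) (simp add: orthonormal_rowsD[OF u])
    also have "\<dots> = lam l * u l j" using lm by (simp only: sum_delta_lt)
    finally show ?thesis .
  qed
  have "(\<Sum>i<n. u l i * (\<Sum>j<n. (A i j - B i j) * v m j)) =
     (\<Sum>i<n. \<Sum>j<n. u l i * A i j * v m j) - (\<Sum>i<n. u l i * (\<Sum>j<n. B i j * v m j))"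
    by (simp add: sum_subtractf[symmetric] sum_distrib_left algebra_simps)
  also have "(\<Sum>i<n. \<Sum>j<n. u l i * A i j * v m j) = (\<Sum>j<n. (\<Sum>i<n. u l i * A i j) * v m j)"
    by (subst sum.swap) (simp only: sum_distrib_right)
  also have "\<dots> = lam l * overlap n u v l m"
    unfolding overlap_def sum_distrib_left by (intro sum.cong refl) (simp add: uA)
  also have "(\<Sum>i<n. u l i * (\<Sum>j<n. B i j * v m j)) = (\<Sum>i<n. u l i * (mu m * v m i))"
    by (intro sum.cong refl) (simp add: Bv)
  also have "\<dots> = mu m * overlap n u v l m"
    unfolding overlap_def sum_distrib_left by (intro sum.cong refl) simp
  finally show ?thesis by (simp add: left_diff_distrib)
qed

text \<open>An overlap is nonzero only between equal eigenvalues, and there f takes equal values.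
  Hence \<open>matfun\<close> does not depend on the diagonalization that it chooses, even with
  repeated eigenvalues.\<close>

lemma diagonalizes_unique:
  assumes A: "diagonalizes n A lam u" and B: "diagonalizes n A mu v" and ab: "a < n" "b < n"
  shows "(\<Sum>l<n. f (lam l) * u l a * u l b) = (\<Sum>m<n. f (mu m) * v m a * v m b)"
proof -
  have "overlap n u v l m * (f (lam l) - f (mu m)) = 0" if "l < n" "m < n" for l m
    using overlap_eigen[OF A B that] by auto
  then have "(\<Sum>m<n. v m b * (overlap n u v l m * (f (lam l) - f (mu m)))) = 0" if "l < n" for l
    using that by (intro sum.neutral ballI) (simp del: mult_eq_0_iff)
  then have "(\<Sum>l<n. u l a * (\<Sum>m<n. v m b * (overlap n u v l m * (f (lam l) - f (mu m))))) = 0"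
    by (intro sum.neutral ballI) (simp del: mult_eq_0_iff)
  then show ?thesis using diagonalizes_difference[OF A B ab, of f] by simp
qed

lemma matfun_eq:
  assumes "diagonalizes n A lam u" "a < n" "b < n"
  shows "matfun n f A a b = (\<Sum>l<n. f (lam l) * u l a * u l b)"
proof -
  define p where "p = (SOME (lam, u). diagonalizes n A lam u)"
  have "case p of (lam, u) \<Rightarrow> diagonalizes n A lam u"
    unfolding p_def by (rule someI[of _ "(lam, u)"]) (use assms in simp)
  then have "diagonalizes n A (fst p) (snd p)" by (simp add: case_prod_beta)
  then have "(\<Sum>l<n. f (fst p l) * snd p l a * snd p l b) = (\<Sum>l<n. f (lam l) * u l a * u l b)"
    by (rule diagonalizes_unique[OF _ assms])
  then show ?thesis unfolding matfun_def p_def[symmetric] by (simp add: case_prod_beta)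
qed

lemma orthonormal_rows_norm:
  assumes "orthonormal_rows n u"
  shows "(\<Sum>a<n. (\<Sum>l<n. u l a * d l)\<^sup>2) = (\<Sum>l<n. (d l)\<^sup>2)"
proof -
  have "(\<Sum>a<n. (\<Sum>l<n. u l a * d l)\<^sup>2) = (\<Sum>a<n. \<Sum>l<n. \<Sum>m<n. d l * d m * (u l a * u m a))"
    unfolding power2_eq_square sum_product by (intro sum.cong refl) (simp add: ac_simps)
  also have "\<dots> = (\<Sum>l<n. \<Sum>a<n. \<Sum>m<n. d l * d m * (u l a * u m a))"
    by (rule sum.swap)
  also have "\<dots> = (\<Sum>l<n. \<Sum>m<n. d l * d m * (\<Sum>a<n. u l a * u m a))"
    unfolding sum_distrib_left by (intro sum.cong refl sum.swap)
  also have "\<dots> = (\<Sum>l<n. \<Sum>m<n. (if l = m then 1 else 0) * (d l * d m))"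
    by (intro sum.cong refl) (simp add: orthonormal_rowsD[OF assms])
  also have "\<dots> = (\<Sum>l<n. (d l)\<^sup>2)"
    by (intro sum.cong refl) (simp only: sum_delta_lt lessThan_iff power2_eq_square)
  finally show ?thesis .
qed

lemma frob2_rotate:
  assumes u: "orthonormal_rows n u" and v: "orthonormal_rows n v"
    and C: "\<And>a b. a < n \<Longrightarrow> b < n \<Longrightarrow> C a b = (\<Sum>l<n. u l a * (\<Sum>m<n. v m b * c l m))"
  shows "frob2 n C = (\<Sum>l<n. \<Sum>m<n. (c l m)\<^sup>2)"
proof -
  have "frob2 n C = (\<Sum>b<n. \<Sum>a<n. (\<Sum>l<n. u l a * (\<Sum>m<n. v m b * c l m))\<^sup>2)"
    unfolding frob2_def by (subst sum.swap) (simp add: C)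
  also have "\<dots> = (\<Sum>l<n. \<Sum>b<n. (\<Sum>m<n. v m b * c l m)\<^sup>2)"
    unfolding orthonormal_rows_norm[OF u] by (rule sum.swap)
  also have "\<dots> = (\<Sum>l<n. \<Sum>m<n. (c l m)\<^sup>2)"
    unfolding orthonormal_rows_norm[OF v] ..
  finally show ?thesis .
qed

definition sym_mat :: "nat \<Rightarrow> (nat \<Rightarrow> nat \<Rightarrow> real) \<Rightarrow> bool" where
  "sym_mat n A \<longleftrightarrow> (\<forall>i<n. \<forall>j<n. A i j = A j i)"

lemma sym_mat_diagonalizes:
  assumes "sym_mat n A"
  obtains lam u where "diagonalizes n A lam u"
  using symmetric_diagonalizes[of n A] assms unfolding sym_mat_def by blast

lemma matfun_id:
  assumes "sym_mat n A" "a < n" "b < n"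
  shows "matfun n (\<lambda>x. x) A a b = A a b"
proof -
  obtain lam u where "diagonalizes n A lam u" by (rule sym_mat_diagonalizes[OF assms(1)])
  then show ?thesis using matfun_eq[of n A lam u a b "\<lambda>x. x"] assms(2,3) unfolding diagonalizes_def by simp
qed

text \<open>Frobenius norms do not change under rotation, so both sides are sums of squared
  coefficients in the mixed eigenbasis, and these are compared term by term.\<close>

lemma frob2_matfun_le:
  assumes A: "sym_mat n A" and B: "sym_mat n B" and f: "\<And>x y. \<bar>f x - f y\<bar> \<le> L * \<bar>x - y\<bar>"
  shows "frob2 n (\<lambda>i j. matfun n f A i j - matfun n f B i j) \<le> L\<^sup>2 * frob2 n (\<lambda>i j. A i j - B i j)"
proof -
  obtain lam u where u: "diagonalizes n A lam u" by (rule sym_mat_diagonalizes[OF A])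
  obtain mu v where v: "diagonalizes n B mu v" by (rule sym_mat_diagonalizes[OF B])
  have eq: "frob2 n (\<lambda>i j. matfun n g A i j - matfun n g B i j) =
      (\<Sum>l<n. \<Sum>m<n. (overlap n u v l m * (g (lam l) - g (mu m)))\<^sup>2)" for g
    using u v unfolding diagonalizes_def
    by (intro frob2_rotate[of n u v]) (auto simp: matfun_eq[OF u] matfun_eq[OF v] diagonalizes_difference[OF u v])
  have "frob2 n (\<lambda>i j. A i j - B i j) = frob2 n (\<lambda>i j. matfun n (\<lambda>x. x) A i j - matfun n (\<lambda>x. x) B i j)"
    unfolding frob2_def by (simp add: matfun_id[OF A] matfun_id[OF B])
  note id = this[unfolded eq]
  show ?thesis unfolding eq id sum_distrib_left
  proof (intro sum_mono)
    fix l m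
    have "(f (lam l) - f (mu m))\<^sup>2 \<le> (L * \<bar>lam l - mu m\<bar>)\<^sup>2"
      using f[of "lam l" "mu m"] by (intro abs_le_square_iff[THEN iffD1]) linarith
    then have "(overlap n u v l m)\<^sup>2 * (f (lam l) - f (mu m))\<^sup>2 \<le> (overlap n u v l m)\<^sup>2 * (L\<^sup>2 * (lam l - mu m)\<^sup>2)"
      by (intro mult_left_mono) (auto simp: power_mult_distrib)
    then show "(overlap n u v l m * (f (lam l) - f (mu m)))\<^sup>2 \<le> L\<^sup>2 * (overlap n u v l m * (lam l - mu m))\<^sup>2"
      by (simp add: power_mult_distrib ac_simps)
  qed
qed

text \<open>Matrix form of the identity G(A) - G(B) = - G(A) (A - B) G(B). It has two products
  because the real and the imaginary part of a product of two complex numbers are sums of two terms.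
  The identity is exact, which later makes the resolvent differentiable in each entry.\<close>

lemma matfun_resolvent_difference:
  assumes A: "sym_mat n A" and B: "sym_mat n B" and ab: "a < n" "b < n"
    and f: "\<And>x y. f x - f y = (x - y) * (g x * h y - g' x * h' y)"
  shows "matfun n f A a b - matfun n f B a b =
     (\<Sum>i<n. \<Sum>j<n. (A i j - B i j) * (matfun n g A a i * matfun n h B j b - matfun n g' A a i * matfun n h' B j b))"
proof -
  obtain lam u where u: "diagonalizes n A lam u" by (rule sym_mat_diagonalizes[OF A])
  obtain mu v where v: "diagonalizes n B mu v" by (rule sym_mat_diagonalizes[OF B])
  have prod: "(\<Sum>i<n. \<Sum>j<n. (A i j - B i j) * (matfun n g A a i * matfun n h B j b)) =
    (\<Sum>l<n. \<Sum>m<n. u l a * v m b * overlap n u v l m * ((lam l - mu m) * (g (lam l) * h (mu m))))" for g h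
  proof -
    have "(\<Sum>i<n. \<Sum>j<n. (A i j - B i j) * (matfun n g A a i * matfun n h B j b)) =
      (\<Sum>i<n. \<Sum>j<n. \<Sum>l<n. \<Sum>m<n. g (lam l) * u l a * (h (mu m) * v m b) * (u l i * ((A i j - B i j) * v m j)))"
      using ab by (intro sum.cong refl)
        (simp add: matfun_eq[OF u] matfun_eq[OF v] sum_product, simp add: sum_distrib_left ac_simps)
    also have "\<dots> = (\<Sum>i<n. \<Sum>l<n. \<Sum>j<n. \<Sum>m<n. g (lam l) * u l a * (h (mu m) * v m b) * (u l i * ((A i j - B i j) * v m j)))"
      by (intro sum.cong refl sum.swap)
    also have "\<dots> = (\<Sum>l<n. \<Sum>i<n. \<Sum>j<n. \<Sum>m<n. g (lam l) * u l a * (h (mu m) * v m b) * (u l i * ((A i j - B i j) * v m j)))"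
      by (rule sum.swap)
    also have "\<dots> = (\<Sum>l<n. \<Sum>i<n. \<Sum>m<n. \<Sum>j<n. g (lam l) * u l a * (h (mu m) * v m b) * (u l i * ((A i j - B i j) * v m j)))"
      by (intro sum.cong refl sum.swap)
    also have "\<dots> = (\<Sum>l<n. \<Sum>m<n. \<Sum>i<n. \<Sum>j<n. g (lam l) * u l a * (h (mu m) * v m b) * (u l i * ((A i j - B i j) * v m j)))"
      by (intro sum.cong refl sum.swap)
    also have "\<dots> = (\<Sum>l<n. \<Sum>m<n. g (lam l) * u l a * (h (mu m) * v m b) * (\<Sum>i<n. u l i * (\<Sum>j<n. (A i j - B i j) * v m j)))"
      by (simp only: sum_distrib_left)
    also have "\<dots> = (\<Sum>l<n. \<Sum>m<n. u l a * v m b * overlap n u v l m * ((lam l - mu m) * (g (lam l) * h (mu m))))"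
      by (intro sum.cong refl) (simp add: overlap_eigen[OF u v])
    finally show ?thesis .
  qed
  have "matfun n f A a b - matfun n f B a b = (\<Sum>l<n. \<Sum>m<n. u l a * v m b * overlap n u v l m * (f (lam l) - f (mu m)))"
    unfolding matfun_eq[OF u ab] matfun_eq[OF v ab] diagonalizes_difference[OF u v ab]
    by (simp add: sum_distrib_left ac_simps)
  also have "\<dots> = (\<Sum>l<n. \<Sum>m<n. u l a * v m b * overlap n u v l m * ((lam l - mu m) * (g (lam l) * h (mu m))))
     - (\<Sum>l<n. \<Sum>m<n. u l a * v m b * overlap n u v l m * ((lam l - mu m) * (g' (lam l) * h' (mu m))))"
    unfolding f by (simp add: sum_subtractf[symmetric] algebra_simps)
  also have "\<dots> = (\<Sum>i<n. \<Sum>j<n. (A i j - B i j) * (matfun n g A a i * matfun n h B j b - matfun n g' A a i * matfun n h' B j b))"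
    unfolding prod[symmetric] by (simp add: sum_subtractf[symmetric] algebra_simps)
  finally show ?thesis .
qed

lemma matfun_mult:
  assumes A: "sym_mat n A" and ab: "a < n" "b < n"
  shows "(\<Sum>c<n. matfun n f A a c * matfun n g A c b) = matfun n (\<lambda>x. f x * g x) A a b"
proof -
  obtain lam u where u: "diagonalizes n A lam u" by (rule sym_mat_diagonalizes[OF A])
  then have o: "orthonormal_rows n u" by (simp add: diagonalizes_def)
  have "(\<Sum>c<n. matfun n f A a c * matfun n g A c b) =
     (\<Sum>c<n. \<Sum>l<n. \<Sum>m<n. f (lam l) * u l a * (g (lam m) * u m b) * (u l c * u m c))"
    using ab by (intro sum.cong refl) (simp add: matfun_eq[OF u] sum_product ac_simps)
  also have "\<dots> = (\<Sum>l<n. \<Sum>c<n. \<Sum>m<n. f (lam l) * u l a * (g (lam m) * u m b) * (u l c * u m c))"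
    by (rule sum.swap)
  also have "\<dots> = (\<Sum>l<n. \<Sum>m<n. f (lam l) * u l a * (g (lam m) * u m b) * (\<Sum>c<n. u l c * u m c))"
    unfolding sum_distrib_left by (intro sum.cong refl sum.swap)
  also have "\<dots> = (\<Sum>l<n. \<Sum>m<n. (if l = m then 1 else 0) * (f (lam l) * u l a * (g (lam m) * u m b)))"
    by (intro sum.cong refl) (simp add: orthonormal_rowsD[OF o])
  also have "\<dots> = (\<Sum>l<n. f (lam l) * u l a * (g (lam l) * u l b))"
    by (intro sum.cong refl) (simp only: sum_delta_lt lessThan_iff)
  finally show ?thesis using ab by (simp add: matfun_eq[OF u] ac_simps)
qed

lemma matfun_linear:
  assumes A: "sym_mat n A" and ab: "a < n" "b < n"
  shows matfun_add: "matfun n (\<lambda>x. f x + g x) A a b = matfun n f A a b + matfun n g A a b"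
    and matfun_diff: "matfun n (\<lambda>x. f x - g x) A a b = matfun n f A a b - matfun n g A a b"
    and matfun_cmult: "matfun n (\<lambda>x. c * f x) A a b = c * matfun n f A a b"
    and matfun_1: "matfun n (\<lambda>x. 1) A a b = (if a = b then 1 else 0)"
    and matfun_commute: "matfun n f A a b = matfun n f A b a"
proof -
  obtain lam u where u: "diagonalizes n A lam u" by (rule sym_mat_diagonalizes[OF A])
  then have o: "orthonormal_rows n u" by (simp add: diagonalizes_def)
  note eq = matfun_eq[OF u ab] matfun_eq[OF u ab(2) ab(1)]
  show "matfun n (\<lambda>x. f x + g x) A a b = matfun n f A a b + matfun n g A a b"
    unfolding eq by (simp add: sum.distrib algebra_simps)
  show "matfun n (\<lambda>x. f x - g x) A a b = matfun n f A a b - matfun n g A a b"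
    unfolding eq by (simp add: sum_subtractf algebra_simps)
  show "matfun n (\<lambda>x. c * f x) A a b = c * matfun n f A a b"
    unfolding eq by (simp add: sum_distrib_left ac_simps)
  show "matfun n (\<lambda>x. 1) A a b = (if a = b then 1 else 0)"
    unfolding eq using orthonormal_rows_complete[OF o ab] by simp
  show "matfun n f A a b = matfun n f A b a" unfolding eq by (simp only: ac_simps)
qed

lemma matfun_diag_mono:
  assumes A: "sym_mat n A" and a: "a < n" and fg: "\<And>x. f x \<le> g x"
  shows "matfun n f A a a \<le> matfun n g A a a"
proof -
  obtain lam u where u: "diagonalizes n A lam u" by (rule sym_mat_diagonalizes[OF A])
  show ?thesis unfolding matfun_eq[OF u a a] mult.assoc
    by (intro sum_mono mult_right_mono fg) simp
qed

text \<open>The squared norm of row a of f(A) is the diagonal entry of f(A)^2.\<close>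

lemma matfun_diag_square_le:
  assumes A: "sym_mat n A" and ab: "a < n" "b < n"
  shows "(matfun n f A a b)\<^sup>2 \<le> matfun n (\<lambda>x. (f x)\<^sup>2) A a a"
proof -
  have "(matfun n f A a b)\<^sup>2 \<le> (\<Sum>c<n. (matfun n f A a c)\<^sup>2)"
    using ab by (intro member_le_sum) auto
  also have "\<dots> = (\<Sum>c<n. matfun n f A a c * matfun n f A c a)"
    using ab by (intro sum.cong refl) (simp add: power2_eq_square matfun_commute[OF A, of _ a])
  also have "\<dots> = matfun n (\<lambda>x. (f x)\<^sup>2) A a a"
    unfolding matfun_mult[OF A ab(1) ab(1)] by (simp add: power2_eq_square)
  finally show ?thesis .
qed

lemma matfun_bound:
  assumes A: "sym_mat n A" and ab: "a < n" "b < n" and f: "\<And>x. \<bar>f x\<bar> \<le> C"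
  shows "\<bar>matfun n f A a b\<bar> \<le> C"
proof -
  have C: "0 \<le> C" using f[of 0] by linarith
  have "(matfun n f A a b)\<^sup>2 \<le> matfun n (\<lambda>x. (f x)\<^sup>2) A a a"
    by (rule matfun_diag_square_le[OF A ab])
  also have "\<dots> \<le> matfun n (\<lambda>x. C\<^sup>2 * 1) A a a"
    using f C by (intro matfun_diag_mono[OF A ab(1)]) (simp add: abs_le_square_iff[symmetric])
  also have "\<dots> = C\<^sup>2" using matfun_cmult[OF A ab(1) ab(1), of "C\<^sup>2" "\<lambda>_. 1"] matfun_1[OF A ab(1) ab(1)] by simp
  finally show ?thesis using C by (simp add: abs_le_square_iff[symmetric])
qed

definition mattr :: "nat \<Rightarrow> (real \<Rightarrow> real) \<Rightarrow> (nat \<Rightarrow> nat \<Rightarrow> real) \<Rightarrow> real" where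
  "mattr n f A = (\<Sum>a<n. matfun n f A a a)"

lemma mattr_eq:
  assumes u: "diagonalizes n A lam u"
  shows "mattr n f A = (\<Sum>l<n. f (lam l))"
proof -
  have "mattr n f A = (\<Sum>l<n. f (lam l) * (\<Sum>a<n. u l a * u l a))"
    unfolding mattr_def sum_distrib_left by (subst sum.swap) (simp add: matfun_eq[OF u] mult.assoc)
  also have "\<dots> = (\<Sum>l<n. f (lam l))"
    using u by (intro sum.cong refl) (simp add: orthonormal_rowsD diagonalizes_def)
  finally show ?thesis .
qed

lemma matfun_lipschitz:
  assumes A: "sym_mat n A" and B: "sym_mat n B" and f: "\<And>x y. \<bar>f x - f y\<bar> \<le> L * \<bar>x - y\<bar>" and L: "0 \<le> L"
    and ab: "a < n" "b < n"
  shows "\<bar>matfun n f A a b - matfun n f B a b\<bar> \<le> L * sqrt (frob2 n (\<lambda>i j. A i j - B i j))"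
proof -
  have "(matfun n f A a b - matfun n f B a b)\<^sup>2 \<le> (\<Sum>j<n. (matfun n f A a j - matfun n f B a j)\<^sup>2)"
    using ab by (intro member_le_sum[of b "{..<n}" "\<lambda>j. (matfun n f A a j - matfun n f B a j)\<^sup>2"]) auto
  also have "\<dots> \<le> frob2 n (\<lambda>i j. matfun n f A i j - matfun n f B i j)"
    unfolding frob2_def
    using ab by (intro member_le_sum[of a "{..<n}" "\<lambda>i. \<Sum>j<n. (matfun n f A i j - matfun n f B i j)\<^sup>2"]) (auto intro: sum_nonneg)
  also have "\<dots> \<le> L\<^sup>2 * frob2 n (\<lambda>i j. A i j - B i j)" by (rule frob2_matfun_le[OF A B f])
  finally have "sqrt ((matfun n f A a b - matfun n f B a b)\<^sup>2) \<le> sqrt (L\<^sup>2 * frob2 n (\<lambda>i j. A i j - B i j))"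
    by (rule real_sqrt_le_mono)
  then show ?thesis using L by (simp add: real_sqrt_mult)
qed

text \<open>Cauchy--Schwarz over the n diagonal entries costs a factor sqrt n, which the entry
  variances of order 1/n will cancel: traces fluctuate by O(L) for every n.\<close>

lemma mattr_lipschitz:
  assumes A: "sym_mat n A" and B: "sym_mat n B" and f: "\<And>x y. \<bar>f x - f y\<bar> \<le> L * \<bar>x - y\<bar>" and L: "0 \<le> L"
  shows "\<bar>mattr n f A - mattr n f B\<bar> \<le> L * sqrt n * sqrt (frob2 n (\<lambda>i j. A i j - B i j))"
proof -
  have "(mattr n f A - mattr n f B)\<^sup>2 = (\<Sum>a<n. 1 * (matfun n f A a a - matfun n f B a a))\<^sup>2"
    by (simp add: mattr_def sum_subtractf)
  also have "\<dots> \<le> (\<Sum>a<n. 1\<^sup>2) * (\<Sum>a<n. (matfun n f A a a - matfun n f B a a)\<^sup>2)"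
    by (rule Cauchy_Schwarz_ineq_sum)
  also have "\<dots> = n * (\<Sum>a<n. (matfun n f A a a - matfun n f B a a)\<^sup>2)" by simp
  also have "(\<Sum>a<n. (matfun n f A a a - matfun n f B a a)\<^sup>2) \<le> frob2 n (\<lambda>i j. matfun n f A i j - matfun n f B i j)"
    unfolding frob2_def
  proof (rule sum_mono)
    fix a assume "a \<in> {..<n}"
    then show "(matfun n f A a a - matfun n f B a a)\<^sup>2 \<le> (\<Sum>j<n. (matfun n f A a j - matfun n f B a j)\<^sup>2)"
      by (intro member_le_sum[of a "{..<n}" "\<lambda>j. (matfun n f A a j - matfun n f B a j)\<^sup>2"]) auto
  qed
  also have "\<dots> \<le> L\<^sup>2 * frob2 n (\<lambda>i j. A i j - B i j)" by (rule frob2_matfun_le[OF A B f])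
  finally have "(mattr n f A - mattr n f B)\<^sup>2 \<le> real n * (L\<^sup>2 * frob2 n (\<lambda>i j. A i j - B i j))"
    by (simp add: mult_left_mono)
  then have "sqrt ((mattr n f A - mattr n f B)\<^sup>2) \<le> sqrt (real n * (L\<^sup>2 * frob2 n (\<lambda>i j. A i j - B i j)))"
    by (rule real_sqrt_le_mono)
  then show ?thesis using L by (simp add: real_sqrt_mult ac_simps)
qed

section \<open>The Gaussian ensemble\<close>

definition goe_var :: "nat \<Rightarrow> nat \<times> nat \<Rightarrow> real" where
  "goe_var n p = (if fst p = snd p then 2 / real n else 1 / real n)"

abbreviation goe_dist :: "nat \<Rightarrow> (nat \<times> nat \<Rightarrow> real) \<Rightarrow> (nat \<times> nat \<Rightarrow> real) \<Rightarrow> real" where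
  "goe_dist n \<equiv> gauss_dist (goe_var n) (goe_index n)"

lemma GOE_eq: "GOE n = gaussians (goe_var n) (goe_index n)"
  unfolding GOE_def goe_var_def ..

lemma finite_goe_index [simp]: "finite (goe_index n)"
  by (rule finite_subset[of _ "{..<n} \<times> {..<n}"]) (auto simp: goe_index_def)

lemma goe_var_pos: "0 < n \<Longrightarrow> 0 < goe_var n p"
  by (simp add: goe_var_def)

lemma prob_space_GOE: "0 < n \<Longrightarrow> prob_space (GOE n)"
  unfolding GOE_eq by (intro prob_space_PiM_gaussian goe_var_pos)

lemma sym_mat_goe [simp]: "sym_mat n (goe_mat w)"
  by (auto simp: sym_mat_def goe_mat_def)

text \<open>An off-diagonal coordinate occurs twice in the matrix but has half the variance of a
  diagonal one. This makes the squared Frobenius norm proportional to the squared rescaled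
  distance.\<close>

lemma frob2_goe:
  assumes n: "0 < n"
  shows "frob2 n (\<lambda>i j. goe_mat x i j - goe_mat y i j) = 2 / real n * (\<Sum>p\<in>goe_index n. (x p - y p)\<^sup>2 / goe_var n p)"
proof -
  define d where "d = (\<lambda>p. (x p - y p)\<^sup>2)"
  define U where "U = {(i, j). i < j \<and> j < n}"
  define V where "V = {(i, j). j < i \<and> i < n}"
  have fin: "finite U" "finite V"
    by (rule finite_subset[of _ "{..<n} \<times> {..<n}"]; auto simp: U_def V_def)+
  have "frob2 n (\<lambda>i j. goe_mat x i j - goe_mat y i j) = (\<Sum>p\<in>{..<n} \<times> {..<n}. (goe_mat x (fst p) (snd p) - goe_mat y (fst p) (snd p))\<^sup>2)"
    unfolding frob2_def sum.cartesian_product by (simp add: case_prod_beta)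
  also have "{..<n} \<times> {..<n} = goe_index n \<union> V"
    by (auto simp: goe_index_def V_def)
  also have "(\<Sum>p\<in>goe_index n \<union> V. (goe_mat x (fst p) (snd p) - goe_mat y (fst p) (snd p))\<^sup>2) =
      (\<Sum>p\<in>goe_index n. (goe_mat x (fst p) (snd p) - goe_mat y (fst p) (snd p))\<^sup>2) +
      (\<Sum>p\<in>V. (goe_mat x (fst p) (snd p) - goe_mat y (fst p) (snd p))\<^sup>2)"
    by (intro sum.union_disjoint finite_goe_index fin) (auto simp: goe_index_def V_def)
  also have "(\<Sum>p\<in>goe_index n. (goe_mat x (fst p) (snd p) - goe_mat y (fst p) (snd p))\<^sup>2) = (\<Sum>p\<in>goe_index n. d p)"
    by (intro sum.cong) (auto simp: goe_index_def goe_mat_def d_def)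
  also have "(\<Sum>p\<in>V. (goe_mat x (fst p) (snd p) - goe_mat y (fst p) (snd p))\<^sup>2) = (\<Sum>p\<in>U. d p)"
    by (rule sum.reindex_bij_witness[of _ prod.swap prod.swap]) (auto simp: U_def V_def goe_mat_def d_def)
  also have "(\<Sum>p\<in>U. d p) = (\<Sum>p\<in>goe_index n. if fst p = snd p then 0 else d p)"
    by (rule sum.mono_neutral_cong_left[OF finite_goe_index]) (auto simp: U_def goe_index_def)
  also have "(\<Sum>p\<in>goe_index n. d p) + \<dots> = (\<Sum>p\<in>goe_index n. 2 / real n * (d p / goe_var n p))"
    unfolding sum.distrib[symmetric] using n by (intro sum.cong) (auto simp: goe_var_def)
  finally show ?thesis unfolding d_def sum_distrib_left .
qed

section \<open>Measurability and concentration of spectral functions of the ensemble\<close>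

text \<open>Lets continuity in the product topology imply measurability for the product measure.
  Coordinates outside I are constantly \<open>undefined\<close> on the space, and a countable index
  type identifies the product sigma-algebra with the Borel one.\<close>

lemma measurable_PiM_gaussian_borel:
  "(\<lambda>x. x) \<in> measurable (gaussians s I) (borel :: ('i::countable \<Rightarrow> real) measure)"
proof -
  have "(\<lambda>x. x) \<in> measurable (gaussians s I) (\<Pi>\<^sub>M i\<in>(UNIV :: 'i set). (borel :: real measure))"
  proof (rule measurable_PiM_single')
    fix i :: 'i
    show "(\<lambda>x. x i) \<in> borel_measurable (gaussians s I)"
    proof (cases "i \<in> I")
      case True
      then have "(\<lambda>x. x i) \<in> measurable (gaussians s I) (gaussian (s i))" by measurable
      then show ?thesis by (simp cong: measurable_cong_sets)
    next
      case False
      then have "(\<lambda>x. x i) \<in> borel_measurable (gaussians s I) \<longleftrightarrow>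
         (\<lambda>x. undefined :: real) \<in> borel_measurable (gaussians s I)"
        by (intro measurable_cong) (auto simp: space_PiM PiE_def extensional_def)
      then show ?thesis by simp
    qed
  qed (auto simp: space_PiM)
  then show ?thesis
    by (subst measurable_cong_sets[OF refl sets_PiM_equal_borel[symmetric]])
qed

text \<open>The distance involves finitely many coordinates, so it is continuous in the product
  topology and tends to 0 at its base point.\<close>

lemma continuous_weighted_lipschitz:
  fixes F :: "('i \<Rightarrow> real) \<Rightarrow> real"
  assumes "finite I" and lip: "\<And>x y. \<bar>F x - F y\<bar> \<le> L * gauss_dist s I x y"
  shows "continuous_on UNIV F"
proof -
  have "(F \<longlongrightarrow> F y) (at y)" for y
  proof -
    have co: "((\<lambda>x. x i) \<longlongrightarrow> y i) (at y)" for i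
      using continuous_on_product_coordinates[where i=i] unfolding continuous_on_def by auto
    have "((\<lambda>x. L * gauss_dist s I x y) \<longlongrightarrow> L * sqrt (\<Sum>i\<in>I. (y i - y i)\<^sup>2 * inverse (s i))) (at y)"
      unfolding divide_inverse by (intro tendsto_intros co)
    then have lim: "((\<lambda>x. L * gauss_dist s I x y) \<longlongrightarrow> 0) (at y)" by simp
    have "((\<lambda>x. F x - F y) \<longlongrightarrow> 0) (at y)"
      by (rule Lim_null_comparison[OF _ lim]) (use lip in auto)
    then show ?thesis by (simp add: LIM_zero_iff)
  qed
  then show ?thesis by (simp add: continuous_on_def)
qed

text \<open>L > 0 is built in because the concentration bounds divide by L.\<close>

definition lip :: "real \<Rightarrow> (real \<Rightarrow> real) \<Rightarrow> bool" where
  "lip L f \<longleftrightarrow> 0 < L \<and> (\<forall>x y. \<bar>f x - f y\<bar> \<le> L * \<bar>x - y\<bar>)"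

lemma matfun_goe_lipschitz:
  assumes n: "0 < n" and ab: "a < n" "b < n" and f: "lip L f"
  shows "\<bar>matfun n f (goe_mat x) a b - matfun n f (goe_mat y) a b\<bar> \<le>
    L * sqrt (2 / n) * goe_dist n x y"
proof -
  define S where "S = (\<Sum>p\<in>goe_index n. (x p - y p)\<^sup>2 / goe_var n p)"
  have "\<bar>matfun n f (goe_mat x) a b - matfun n f (goe_mat y) a b\<bar> \<le> L * sqrt (2 / n * S)"
    using matfun_lipschitz[OF sym_mat_goe sym_mat_goe, of f L a n b x y] f ab
    unfolding lip_def frob2_goe[OF n] S_def by simp
  also have "\<dots> = L * sqrt (2 / n) * sqrt S" by (simp only: real_sqrt_mult mult.assoc)
  finally show ?thesis unfolding S_def .
qed

lemma mattr_goe_lipschitz: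
  assumes n: "0 < n" and f: "lip L f"
  shows "\<bar>mattr n f (goe_mat x) - mattr n f (goe_mat y)\<bar> \<le>
    L * sqrt 2 * goe_dist n x y"
proof -
  define S where "S = (\<Sum>p\<in>goe_index n. (x p - y p)\<^sup>2 / goe_var n p)"
  have "\<bar>mattr n f (goe_mat x) - mattr n f (goe_mat y)\<bar> \<le> L * sqrt n * sqrt (2 / n * S)"
    using mattr_lipschitz[OF sym_mat_goe sym_mat_goe, of f L n x y] f
    unfolding lip_def frob2_goe[OF n] S_def by simp
  also have "L * sqrt n * sqrt (2 / n * S) = L * (sqrt n * sqrt (2 / n * S))" by simp
  also have "sqrt n * sqrt (2 / n * S) = sqrt (2 * S)"
    using n by (subst real_sqrt_mult[symmetric]) simp
  finally show ?thesis unfolding S_def by (simp add: real_sqrt_mult)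
qed

lemma borel_measurable_goe_lipschitz:
  assumes "\<And>x y. \<bar>F x - F y\<bar> \<le> L * goe_dist n x y"
  shows "F \<in> borel_measurable (GOE n)"
proof -
  have "F \<in> borel_measurable borel"
    by (intro borel_measurable_continuous_onI continuous_weighted_lipschitz[OF _ assms]) simp
  then show ?thesis
    using measurable_compose[OF measurable_PiM_gaussian_borel] unfolding GOE_eq by blast
qed

lemma borel_measurable_matfun_goe:
  assumes "0 < n" "a < n" "b < n" "lip L f"
  shows "(\<lambda>w. matfun n f (goe_mat w) a b) \<in> borel_measurable (GOE n)"
  by (rule borel_measurable_goe_lipschitz[OF matfun_goe_lipschitz[OF assms]])

lemma borel_measurable_mattr_goe:
  assumes "0 < n" "lip L f"
  shows "(\<lambda>w. mattr n f (goe_mat w)) \<in> borel_measurable (GOE n)"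
  by (rule borel_measurable_goe_lipschitz[OF mattr_goe_lipschitz[OF assms]])

lemma goe_lipschitz:
  assumes n: "0 < n" and L: "0 < L"
    and lip: "\<And>x y. \<bar>F x - F y\<bar> \<le> L * goe_dist n x y"
  shows integrable_goe_lipschitz: "integrable (GOE n) F"
    and integrable_square_goe_lipschitz: "integrable (GOE n) (\<lambda>x. (F x)\<^sup>2)"
    and variance_goe_lipschitz: "(\<integral>x. (F x - (\<integral>x. F x \<partial>GOE n))\<^sup>2 \<partial>GOE n) \<le> 4 * L\<^sup>2"
    and tail_goe_lipschitz:
      "0 < r \<Longrightarrow> measure (GOE n) {x \<in> space (GOE n). (\<integral>x. F x \<partial>GOE n) + r \<le> F x} \<le> exp (- (r\<^sup>2 / (4 * L\<^sup>2)))"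
  using PiM_gaussian_lipschitz[OF finite_goe_index goe_var_pos[OF n] L
      borel_measurable_goe_lipschitz[OF lip, unfolded GOE_eq] lip]
  unfolding GOE_eq by blast+

section \<open>Symmetry of the ensemble under a change of sign\<close>

lemma distr_gaussian_uminus: "distr (gaussian s) borel uminus = gaussian s"
proof -
  have "gaussian s = density (distr lborel borel uminus) (normal_density 0 (sqrt s))"
    unfolding gaussian_def by (simp add: lborel_distr_uminus)
  also have "\<dots> = distr (density lborel (\<lambda>x. ennreal (normal_density 0 (sqrt s) (- x)))) borel uminus"
    by (intro density_distr) auto
  also have "(\<lambda>x. ennreal (normal_density 0 (sqrt s) (- x))) = (\<lambda>x. ennreal (normal_density 0 (sqrt s) x))"
    by (simp add: normal_density_def)
  finally show ?thesis unfolding gaussian_def ..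
qed

text \<open>\<open>compose\<close> negates on the index set only, which keeps the points
  extensional.\<close>

lemma distr_GOE_uminus:
  assumes n: "0 < n"
  shows "distr (GOE n) (GOE n) (compose (goe_index n) uminus) = GOE n"
proof -
  have "distr (GOE n) (GOE n) (compose (goe_index n) uminus) =
     PiM (goe_index n) (\<lambda>p. distr (gaussian (goe_var n p)) (gaussian (goe_var n p)) uminus)"
    unfolding GOE_eq
    by (intro distr_PiM_finite_prob_space' finite_goe_index prob_space_gaussian goe_var_pos[OF n])
       (auto simp: measurable_def[symmetric] cong: measurable_cong_sets)
  also have "(\<lambda>p. distr (gaussian (goe_var n p)) (gaussian (goe_var n p)) uminus) = (\<lambda>p. gaussian (goe_var n p))"
  proof
    fix p
    have "distr (gaussian (goe_var n p)) (gaussian (goe_var n p)) uminus = distr (gaussian (goe_var n p)) borel uminus"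
      by (rule distr_cong) auto
    then show "distr (gaussian (goe_var n p)) (gaussian (goe_var n p)) uminus = gaussian (goe_var n p)"
      by (simp only: distr_gaussian_uminus)
  qed
  finally show ?thesis unfolding GOE_eq .
qed

lemma matfun_uminus:
  assumes A: "sym_mat n A" and B: "\<And>i j. i < n \<Longrightarrow> j < n \<Longrightarrow> B i j = - A i j" and ab: "a < n" "b < n"
  shows "matfun n f B a b = matfun n (\<lambda>x. f (- x)) A a b"
proof -
  obtain lam u where u: "diagonalizes n A lam u" by (rule sym_mat_diagonalizes[OF A])
  then have "diagonalizes n B (\<lambda>l. - lam l) u"
    unfolding diagonalizes_def using B by (simp add: sum_negf)
  from matfun_eq[OF this ab] show ?thesis unfolding matfun_eq[OF u ab] .
qed

text \<open>Applied to odd functions, for which it makes the mean of the trace vanish.\<close>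

lemma integral_mattr_goe_uminus:
  assumes n: "0 < n" and f: "lip L f"
  shows "(\<integral>w. mattr n (\<lambda>x. f (- x)) (goe_mat w) \<partial>GOE n) = (\<integral>w. mattr n f (goe_mat w) \<partial>GOE n)"
proof -
  have [measurable]: "compose (goe_index n) uminus \<in> measurable (GOE n) (GOE n)"
    unfolding GOE_eq compose_def by (rule measurable_restrict) measurable
  have "(\<integral>w. mattr n f (goe_mat w) \<partial>GOE n) = (\<integral>w. mattr n f (goe_mat w) \<partial>distr (GOE n) (GOE n) (compose (goe_index n) uminus))"
    by (simp only: distr_GOE_uminus[OF n])
  also have "\<dots> = (\<integral>w. mattr n f (goe_mat (compose (goe_index n) uminus w)) \<partial>GOE n)"
    by (rule integral_distr) (use borel_measurable_mattr_goe[OF n f] in measurable)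
  also have "\<dots> = (\<integral>w. mattr n (\<lambda>x. f (- x)) (goe_mat w) \<partial>GOE n)"
    unfolding mattr_def
    by (intro Bochner_Integration.integral_cong refl sum.cong matfun_uminus)
       (auto simp: goe_mat_def compose_def goe_index_def)
  finally show ?thesis ..
qed

section \<open>Integration by parts\<close>

text \<open>Stein's identity: with p the density, f p has the derivative (f' - x f/s) p and vanishes
  at both ends of the line.\<close>

lemma gaussian_integration_by_parts:
  fixes f f' :: "real \<Rightarrow> real"
  assumes s: "0 < s" and df: "\<And>x. (f has_real_derivative f' x) (at x)" and cf': "\<And>x. isCont f' x"
    and bf: "\<And>x. \<bar>f x\<bar> \<le> C" and bf': "\<And>x. \<bar>f' x\<bar> \<le> C'"
  shows "(\<integral>x. x * f x \<partial>gaussian s) = s * (\<integral>x. f' x \<partial>gaussian s)"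
proof -
  define p where "p = normal_density 0 (sqrt s)"
  have s': "0 < sqrt s" using s by simp
  have p_eq: "p x = 1 / sqrt (2 * pi * s) * exp (- x\<^sup>2 / (2 * s))" for x
    unfolding p_def normal_density_def using s by simp
  have p0: "0 \<le> p x" for x by (simp add: p_def)
  have pm[measurable]: "p \<in> borel_measurable borel" by (simp add: p_def)
  have dp: "(p has_real_derivative - x / s * p x) (at x)" for x
    unfolding p_eq using s by (auto intro!: derivative_eq_intros simp: field_simps)
  have cf: "isCont f x" for x using df DERIV_isCont by blast
  have [measurable]: "f \<in> borel_measurable borel" "f' \<in> borel_measurable borel"
    using cf cf' by (auto intro!: borel_measurable_continuous_onI simp: continuous_on_eq_continuous_at)
  have ip: "integrable lborel p" unfolding p_def by (rule integrable_normal_density[OF s'])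
  have ixp: "integrable lborel (\<lambda>x. x * p x)"
    using integrable_normal_moment[OF s', of 0 1] by (simp add: p_def mult.commute)
  have i1: "integrable lborel (\<lambda>x. f' x * p x)"
    by (rule Bochner_Integration.integrable_bound[OF integrable_mult_right[OF ip, of C']])
       (use bf' p0 in \<open>auto simp: abs_mult intro!: mult_right_mono order_trans[OF bf' abs_ge_self]\<close>)
  have i2: "integrable lborel (\<lambda>x. x * f x * p x)"
  proof (rule Bochner_Integration.integrable_bound[OF integrable_mult_right[OF ixp, of C]])
    show "AE x in lborel. norm (x * f x * p x) \<le> norm (C * (x * p x))"
    proof (rule AE_I2)
      fix x
      have "\<bar>f x\<bar> \<le> \<bar>C\<bar>" using bf[of x] by linarith
      then show "norm (x * f x * p x) \<le> norm (C * (x * p x))"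
        using mult_right_mono[of "\<bar>f x\<bar>" "\<bar>C\<bar>" "\<bar>x * p x\<bar>"] by (simp add: abs_mult ac_simps)
    qed
  qed measurable
  \<comment> \<open>Stated for any filter along which x^2 tends to infinity, so that it covers both
    ends.\<close>
  have lim0: "((\<lambda>x. f x * p x) \<longlongrightarrow> 0) F" if "filterlim (\<lambda>x. x\<^sup>2) at_top F" for F
  proof -
    have "((\<lambda>x. exp (- x\<^sup>2 / (2 * s))) \<longlongrightarrow> 0) F"
    proof -
      have "filterlim (\<lambda>x. 1 / (2 * s) * x\<^sup>2) at_top F"
        using that s by (intro filterlim_tendsto_pos_mult_at_top[OF tendsto_const]) auto
      then have "filterlim (\<lambda>x. - (1 / (2 * s) * x\<^sup>2)) at_bot F"
        by (simp only: filterlim_uminus_at_top)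
      from filterlim_compose[OF exp_at_bot this] show ?thesis by simp
    qed
    then have "((\<lambda>x. C * (1 / sqrt (2 * pi * s) * exp (- x\<^sup>2 / (2 * s)))) \<longlongrightarrow> C * (1 / sqrt (2 * pi * s) * 0)) F"
      by (intro tendsto_intros)
    then have l: "((\<lambda>x. C * p x) \<longlongrightarrow> 0) F" unfolding p_eq by simp
    show ?thesis
      by (rule Lim_null_comparison[OF _ l]) (use bf p0 in \<open>auto simp: abs_mult intro!: eventuallyI mult_right_mono\<close>)
  qed
  have "interval_lebesgue_integral lborel (-\<infinity>) \<infinity> (\<lambda>x. f' x * p x - x * f x * p x / s) = 0 - 0"
  proof (rule interval_integral_FTC_integrable[where F="\<lambda>x. f x * p x"])
    fix x :: real
    show "((\<lambda>x. f x * p x) has_vector_derivative f' x * p x - x * f x * p x / s) (at x)"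
      unfolding has_real_derivative_iff_has_vector_derivative[symmetric]
      by (rule DERIV_cong[OF DERIV_mult[OF df dp]]) (simp add: field_simps)
    have "isCont p x" using dp DERIV_isCont by blast
    then show "isCont (\<lambda>x. f' x * p x - x * f x * p x / s) x"
      using cf cf' s by (intro continuous_intros) auto
  next
    show "set_integrable lborel (einterval (-\<infinity>) \<infinity>) (\<lambda>x. f' x * p x - x * f x * p x / s)"
      unfolding einterval_def set_integrable_def using i1 i2 by simp
    have "filterlim (\<lambda>x::real. x\<^sup>2) at_top at_bot" "filterlim (\<lambda>x::real. x\<^sup>2) at_top at_top"
      by (intro filterlim_pow_at_bot_even filterlim_ident, simp_all add: filterlim_pow_at_top filterlim_ident)
    then show "(((\<lambda>x. f x * p x) \<circ> real_of_ereal) \<longlongrightarrow> 0) (at_right (-\<infinity>))" "(((\<lambda>x. f x * p x) \<circ> real_of_ereal) \<longlongrightarrow> 0) (at_left \<infinity>)"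
      by (auto simp: ereal_tendsto_simps intro!: lim0)
  qed auto
  then have "(\<integral>x. f' x * p x \<partial>lborel) - (\<integral>x. x * f x * p x \<partial>lborel) / s = 0"
    using i1 i2 by (simp add: interval_lebesgue_integral_def einterval_def set_lebesgue_integral_def)
  moreover have "(\<integral>x. g x \<partial>gaussian s) = (\<integral>x. g x * p x \<partial>lborel)" if [measurable]: "g \<in> borel_measurable borel" for g :: "real \<Rightarrow> real"
    unfolding gaussian_def p_def by (subst integral_density) (auto simp: mult.commute)
  ultimately show ?thesis using s by (simp add: field_simps)
qed

lemma integrable_gaussian_moment:
  assumes "0 < s"
  shows "integrable (gaussian s) (\<lambda>x. x ^ k)"
  unfolding gaussian_def
  by (subst integrable_density) (use integrable_normal_moment[of "sqrt s" 0 k] assms in \<open>auto simp: mult.commute\<close>)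

lemma gaussian_second_moment:
  assumes "0 < s"
  shows "(\<integral>x. x\<^sup>2 \<partial>gaussian s) = s"
  unfolding gaussian_def
  using integral_normal_moment_even[of "sqrt s" 0 1] assms
  by (subst integral_density) (auto simp: fact_numeral)

lemma GOE_coordinate:
  assumes n: "0 < n" and p: "p \<in> goe_index n" and g[measurable]: "(g :: real \<Rightarrow> real) \<in> borel_measurable borel"
  shows "(\<integral>w. g (w p) \<partial>GOE n) = (\<integral>x. g x \<partial>gaussian (goe_var n p))"
    and "integrable (GOE n) (\<lambda>w. g (w p)) \<longleftrightarrow> integrable (gaussian (goe_var n p)) g"
    and "(\<lambda>w. g (w p)) \<in> borel_measurable (GOE n)"
proof -
  have d: "distr (GOE n) (gaussian (goe_var n p)) (\<lambda>w. w p) = gaussian (goe_var n p)"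
    unfolding GOE_eq by (rule distr_PiM_component) (use p prob_space_gaussian goe_var_pos[OF n] in auto)
  have m: "(\<lambda>w. w p) \<in> measurable (GOE n) (gaussian (goe_var n p))"
    unfolding GOE_eq using p by measurable
  have g': "g \<in> borel_measurable (gaussian (goe_var n p))" using g by (simp cong: measurable_cong_sets)
  show "(\<integral>w. g (w p) \<partial>GOE n) = (\<integral>x. g x \<partial>gaussian (goe_var n p))"
    using integral_distr[OF m g'] unfolding d by simp
  show "integrable (GOE n) (\<lambda>w. g (w p)) \<longleftrightarrow> integrable (gaussian (goe_var n p)) g"
    using integrable_distr_eq[OF m g'] unfolding d by simp
  show "(\<lambda>w. g (w p)) \<in> borel_measurable (GOE n)"
    using measurable_compose[OF m g'] .
qed

text \<open>Fubini isolates coordinate p, and Stein's identity applies for each value of the others.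
  The derivative is taken along the lines \<open>fun_upd w p\<close> because points of the smaller
  product completed in this way are what the Fubini formula produces.\<close>

lemma GOE_integration_by_parts:
  assumes n: "0 < n" and p: "p \<in> goe_index n"
    and h[measurable]: "h \<in> borel_measurable (GOE n)" and D[measurable]: "D \<in> borel_measurable (GOE n)"
    and dh: "\<And>w t. ((\<lambda>t. h (fun_upd w p t)) has_real_derivative D (fun_upd w p t)) (at t)"
    and cD: "\<And>w t. isCont (\<lambda>t. D (fun_upd w p t)) t"
    and bh: "\<And>w. \<bar>h w\<bar> \<le> C" and bD: "\<And>w. \<bar>D w\<bar> \<le> C'"
  shows "(\<integral>w. w p * h w \<partial>GOE n) = goe_var n p * (\<integral>w. D w \<partial>GOE n)"
    and "integrable (GOE n) (\<lambda>w. w p * h w)" and "integrable (GOE n) D"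
proof -
  interpret prob_space "GOE n" by (rule prob_space_GOE[OF n])
  interpret S: product_sigma_finite "\<lambda>p. gaussian (goe_var n p)"
    by (simp add: product_sigma_finite_def prob_space_imp_sigma_finite prob_space_gaussian goe_var_pos[OF n])
  have id: "(\<lambda>x::real. x) \<in> borel_measurable borel" by simp
  have [measurable]: "(\<lambda>w. w p) \<in> borel_measurable (GOE n)"
    by (rule GOE_coordinate(3)[OF n p id])
  have "integrable (gaussian (goe_var n p)) (\<lambda>x. x ^ 1)"
    by (rule integrable_gaussian_moment) (rule goe_var_pos[OF n])
  then have "integrable (GOE n) (\<lambda>w. w p)"
    unfolding GOE_coordinate(2)[OF n p id] by (simp only: power_one_right)
  then have i0: "integrable (GOE n) (\<lambda>w. C * w p)" by simp
  show i1: "integrable (GOE n) (\<lambda>w. w p * h w)"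
  proof (rule Bochner_Integration.integrable_bound[OF i0])
    show "AE w in GOE n. norm (w p * h w) \<le> norm (C * w p)"
    proof (rule AE_I2)
      fix w
      have "\<bar>h w\<bar> \<le> \<bar>C\<bar>" using bh[of w] by linarith
      then show "norm (w p * h w) \<le> norm (C * w p)"
        using mult_right_mono[of "\<bar>h w\<bar>" "\<bar>C\<bar>" "\<bar>w p\<bar>"] by (simp add: abs_mult mult.commute)
    qed
  qed measurable
  show i2: "integrable (GOE n) D"
    by (rule integrable_const_bound[of _ C']) (use bD in auto)
  define J where "J = goe_index n - {p}"
  have J: "finite J" "p \<notin> J" "insert p J = goe_index n" using p by (auto simp: J_def)
  note ins = S.product_integral_insert[OF J(1,2), unfolded J(3) GOE_eq[symmetric]]
  have "(\<integral>w. w p * h w \<partial>GOE n) = (\<integral>x. (\<integral>y. y * h (fun_upd x p y) \<partial>gaussian (goe_var n p)) \<partial>gaussians (goe_var n) J)"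
    using ins[OF i1] by simp
  also have "\<dots> = (\<integral>x. goe_var n p * (\<integral>y. D (fun_upd x p y) \<partial>gaussian (goe_var n p)) \<partial>gaussians (goe_var n) J)"
  proof (intro Bochner_Integration.integral_cong refl)
    fix x
    show "(\<integral>y. y * h (fun_upd x p y) \<partial>gaussian (goe_var n p)) = goe_var n p * (\<integral>y. D (fun_upd x p y) \<partial>gaussian (goe_var n p))"
      by (rule gaussian_integration_by_parts[OF goe_var_pos[OF n]]) (rule dh cD bh bD)+
  qed
  also have "\<dots> = goe_var n p * (\<integral>w. D w \<partial>GOE n)"
    using ins[OF i2] by simp
  finally show "(\<integral>w. w p * h w \<partial>GOE n) = goe_var n p * (\<integral>w. D w \<partial>GOE n)" .
qed

text \<open>Real and imaginary part of \<open>1 / (x - \<i> e)\<close>.\<close>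

definition res_re :: "real \<Rightarrow> real \<Rightarrow> real" where "res_re e x = x / (x\<^sup>2 + e\<^sup>2)"
definition res_im :: "real \<Rightarrow> real \<Rightarrow> real" where "res_im e x = e / (x\<^sup>2 + e\<^sup>2)"

lemma res_pos: "0 < e \<Longrightarrow> 0 < x\<^sup>2 + e\<^sup>2" for e x :: real
  by (simp add: add_nonneg_pos)

text \<open>Real part of 1/(x - \<i> e) - 1/(y - \<i> e) = - (x - y) / ((x - \<i> e) (y - \<i> e));
  \<open>res_im_diff\<close> is the imaginary part. Both have the shape that
  \<open>matfun_resolvent_difference\<close> expects.\<close>

lemma res_re_diff:
  assumes "0 < e"
  shows "res_re e x - res_re e y = (x - y) * (res_im e x * res_im e y - res_re e x * res_re e y)"
proof -
  define X Y where "X = x\<^sup>2 + e\<^sup>2" and "Y = y\<^sup>2 + e\<^sup>2"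
  have p: "X \<noteq> 0" "Y \<noteq> 0" using res_pos[OF assms] unfolding X_def Y_def by (metis less_irrefl)+
  have "res_re e x - res_re e y = (x * Y - y * X) / (X * Y)"
    unfolding res_re_def X_def[symmetric] Y_def[symmetric] using p by (simp add: field_simps)
  also have "x * Y - y * X = (x - y) * (e * e - x * y)"
    unfolding X_def Y_def by (simp add: power2_eq_square algebra_simps)
  finally show ?thesis
    unfolding res_re_def res_im_def X_def[symmetric] Y_def[symmetric] by (simp add: diff_divide_distrib right_diff_distrib)
qed

lemma res_im_diff:
  assumes "0 < e"
  shows "res_im e x - res_im e y = (x - y) * (- res_im e x * res_re e y - res_re e x * res_im e y)"
proof -
  define X Y where "X = x\<^sup>2 + e\<^sup>2" and "Y = y\<^sup>2 + e\<^sup>2"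
  have p: "X \<noteq> 0" "Y \<noteq> 0" using res_pos[OF assms] unfolding X_def Y_def by (metis less_irrefl)+
  have "res_im e x - res_im e y = (e * Y - e * X) / (X * Y)"
    unfolding res_im_def X_def[symmetric] Y_def[symmetric] using p by (simp add: field_simps)
  also have "e * Y - e * X = (x - y) * (- (e * y) - x * e)"
    unfolding X_def Y_def by (simp add: power2_eq_square algebra_simps)
  finally show ?thesis
    unfolding res_re_def res_im_def X_def[symmetric] Y_def[symmetric]
    by (simp add: diff_divide_distrib right_diff_distrib add_divide_distrib)
qed

text \<open>With G = 1/(x - \<i> e), \<open>res_sq\<close> is the Ward identity |G|^2 = Im G / e and
  \<open>res_id\<close> the real part of (x - \<i> e) G = 1.\<close>

lemma res_bounds:
  assumes e: "0 < e"
  shows res_re_bound: "\<bar>res_re e x\<bar> \<le> 1 / e" and res_im_bound: "\<bar>res_im e x\<bar> \<le> 1 / e"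
    and res_im_nonneg: "0 \<le> res_im e x" and res_sq: "(res_re e x)\<^sup>2 + (res_im e x)\<^sup>2 = res_im e x / e"
    and res_id: "x * res_re e x = 1 - e * res_im e x"
proof -
  have p: "0 < x\<^sup>2 + e\<^sup>2" by (rule res_pos[OF e])
  show nn: "0 \<le> res_im e x" unfolding res_im_def using e p by simp
  have "res_im e x \<le> e / e\<^sup>2" unfolding res_im_def using e by (intro divide_left_mono) (auto intro: mult_pos_pos p)
  then have le: "res_im e x \<le> 1 / e" using e by (simp add: power2_eq_square)
  then show "\<bar>res_im e x\<bar> \<le> 1 / e" using nn by simp
  have "(res_re e x)\<^sup>2 + (res_im e x)\<^sup>2 = (x\<^sup>2 + e\<^sup>2) / (x\<^sup>2 + e\<^sup>2)\<^sup>2"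
    by (simp add: res_re_def res_im_def power_divide add_divide_distrib)
  then show sq: "(res_re e x)\<^sup>2 + (res_im e x)\<^sup>2 = res_im e x / e"
    using e p by (simp add: res_im_def power2_eq_square)
  have "(res_re e x)\<^sup>2 \<le> res_im e x / e" using sq by (smt (verit) zero_le_power2)
  also have "\<dots> \<le> (1 / e) / e" using le e by (intro divide_right_mono) auto
  also have "(1 / e) / e = (1 / e)\<^sup>2" by (simp add: power2_eq_square)
  finally have "\<bar>res_re e x\<bar> \<le> \<bar>1 / e\<bar>" by (simp only: abs_le_square_iff)
  then show "\<bar>res_re e x\<bar> \<le> 1 / e" using e by simp
  have "x * res_re e x + e * res_im e x = (x\<^sup>2 + e\<^sup>2) / (x\<^sup>2 + e\<^sup>2)"
    by (simp only: res_re_def res_im_def times_divide_eq_right power2_eq_square add_divide_distrib)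
  also have "\<dots> = 1" by (rule divide_self) (use p in linarith)
  finally show "x * res_re e x = 1 - e * res_im e x" by simp
qed

lemma lip_res:
  assumes e: "0 < e"
  shows lip_res_re: "lip (2 / e\<^sup>2) (res_re e)" and lip_res_im: "lip (2 / e\<^sup>2) (res_im e)"
proof -
  have b: "\<bar>u * v\<bar> \<le> 1 / e\<^sup>2" if "\<bar>u\<bar> \<le> 1 / e" "\<bar>v\<bar> \<le> 1 / e" for u v :: real
    using mult_mono[OF that] e by (simp add: abs_mult power2_eq_square)
  have tri: "\<bar>u - v\<bar> \<le> 2 / e\<^sup>2" if "\<bar>u\<bar> \<le> 1 / e\<^sup>2" "\<bar>v\<bar> \<le> 1 / e\<^sup>2" for u v :: real
    using that by linarith
  have pos: "0 < 2 / e\<^sup>2" using e by simp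
  note bounds = res_im_bound[OF e] res_re_bound[OF e] abs_minus_cancel
  have "\<bar>res_re e x - res_re e y\<bar> \<le> \<bar>x - y\<bar> * (2 / e\<^sup>2)" for x y
  proof -
    have "\<bar>res_im e x * res_im e y - res_re e x * res_re e y\<bar> \<le> 2 / e\<^sup>2"
      by (intro tri b) (simp_all only: bounds)
    then show ?thesis unfolding res_re_diff[OF e] abs_mult by (rule mult_left_mono) simp
  qed
  then show "lip (2 / e\<^sup>2) (res_re e)"
    using pos unfolding lip_def by (simp only: mult.commute[of "2 / e\<^sup>2"]) blast
  have "\<bar>res_im e x - res_im e y\<bar> \<le> \<bar>x - y\<bar> * (2 / e\<^sup>2)" for x y
  proof -
    have "\<bar>- res_im e x * res_re e y - res_re e x * res_im e y\<bar> \<le> 2 / e\<^sup>2"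
      by (intro tri b) (simp_all only: bounds)
    then show ?thesis unfolding res_im_diff[OF e] abs_mult by (rule mult_left_mono) simp
  qed
  then show "lip (2 / e\<^sup>2) (res_im e)"
    using pos unfolding lip_def by (simp only: mult.commute[of "2 / e\<^sup>2"]) blast
qed

section \<open>The resolvent equation\<close>

lemma isCont_matfun_goe_coordinate:
  assumes "0 < n" "a < n" "b < n" "lip L f"
  shows "isCont (\<lambda>t. matfun n f (goe_mat (fun_upd w p t)) a b) t"
proof -
  have c1: "continuous_on UNIV (\<lambda>w. matfun n f (goe_mat w) a b)"
    by (rule continuous_weighted_lipschitz[OF finite_goe_index matfun_goe_lipschitz[OF assms]])
  have c2: "continuous_on UNIV (\<lambda>t. fun_upd w p t)"
  proof (rule continuous_on_coordinatewise_then_product)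
    fix i show "continuous_on UNIV (\<lambda>t. (fun_upd w p t) i)"
      by (cases "i = p") auto
  qed
  have "continuous_on UNIV (\<lambda>t. matfun n f (goe_mat (fun_upd w p t)) a b)"
    by (rule continuous_on_compose2[OF c1 c2]) simp
  then show ?thesis by (simp add: continuous_on_eq_continuous_at)
qed

lemma goe_mat_update:
  "goe_mat (fun_upd w p z) i j - goe_mat (fun_upd w p t) i j = (z - t) * (if (min i j, max i j) = p then 1 else 0)"
  by (auto simp: goe_mat_def min_def max_def)

text \<open>A coordinate of the ensemble moves one diagonal entry or a symmetric pair of entries, so
  a partial derivative has one or two terms.\<close>

lemma sum_goe_pair:
  assumes kj: "k < n" "j < (n::nat)"
  shows "(\<Sum>i<n. \<Sum>l<n. (if (min i l, max i l) = (min k j, max k j) then 1 else 0) * T i l)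
     = (if k = j then T k k else T k j + T j k :: real)"
proof -
  have E: "(if (min i l, max i l) = (min k j, max k j) then 1 else 0 :: real) =
     (if k = i then 1 else 0) * (if j = l then 1 else 0) + (if k = j then 0 else (if j = i then 1 else 0) * (if k = l then 1 else 0))" for i l
    by (auto simp: min_def max_def split: if_splits)
  have 1: "(\<Sum>i<n. \<Sum>l<n. ((if k = i then 1 else 0) * (if j = l then 1 else 0)) * T i l) = T k j" if "k < n" "j < n" for k j
  proof -
    have "(\<Sum>i<n. \<Sum>l<n. ((if k = i then 1 else 0) * (if j = l then 1 else 0)) * T i l)
      = (\<Sum>i<n. (if k = i then 1 else 0) * (\<Sum>l<n. (if j = l then 1 else 0) * T i l))"
      by (simp only: sum_distrib_left mult.assoc)
    also have "\<dots> = T k j" using that by (simp only: sum_delta_lt)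
    finally show ?thesis .
  qed
  show ?thesis
  proof (cases "k = j")
    case True
    show ?thesis unfolding E if_P[OF True] add_0_right 1[OF kj] using True by simp
  next
    case False
    show ?thesis unfolding E if_not_P[OF False] distrib_right sum.distrib 1[OF kj] 1[OF kj(2) kj(1)] ..
  qed
qed

lemma integrable_GOE_bounded:
  assumes n: "0 < n" and "F \<in> borel_measurable (GOE n)" "\<And>w. \<bar>F w\<bar> \<le> (C::real)"
  shows "integrable (GOE n) F"
proof -
  interpret prob_space "GOE n" by (rule prob_space_GOE[OF n])
  show ?thesis by (rule integrable_const_bound[of _ C]) (use assms in auto)
qed

text \<open>Integration by parts against the derivative of the resolvent. On the diagonal the
  doubled variance makes up for the missing second term of the derivative, so one formula covers k =
  j and k different from j.\<close>

lemma integral_goe_entry_resolvent: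
  assumes n: "0 < n" and e: "0 < e" and kj: "k < n" "j < n"
  defines "A \<equiv> \<lambda>w. matfun n (res_re e) (goe_mat w)" and "B \<equiv> \<lambda>w. matfun n (res_im e) (goe_mat w)"
  shows "(\<integral>w. goe_mat w k j * A w k j \<partial>GOE n) =
      (\<integral>w. 1 / n * (B w k k * B w j j - A w k k * A w j j + ((B w k j)\<^sup>2 - (A w k j)\<^sup>2)) \<partial>GOE n)"
    and "integrable (GOE n) (\<lambda>w. goe_mat w k j * A w k j)"
proof -
  define p where "p = (min k j, max k j)"
  have p: "p \<in> goe_index n" using kj by (auto simp: p_def goe_index_def)
  have Yp: "goe_mat w k j = w p" for w by (auto simp: goe_mat_def p_def min_def max_def)
  define T where "T = (\<lambda>w i l. B w k i * B w l j - A w k i * A w l j)"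
  define E where "E = (\<lambda>i l :: nat. if (min i l, max i l) = p then 1 else 0 :: real)"
  define D where "D = (\<lambda>w. \<Sum>i<n. \<Sum>l<n. E i l * T w i l)"
  have mA: "(\<lambda>w. A w i l) \<in> borel_measurable (GOE n)" and mB: "(\<lambda>w. B w i l) \<in> borel_measurable (GOE n)"
    if "i < n" "l < n" for i l
    unfolding A_def B_def using that
    by (auto intro!: borel_measurable_matfun_goe n lip_res_re[OF e] lip_res_im[OF e])
  note cA = isCont_matfun_goe_coordinate[OF n _ _ lip_res_re[OF e]]
  note cB = isCont_matfun_goe_coordinate[OF n _ _ lip_res_im[OF e]]
  have bA: "\<bar>A w i l\<bar> \<le> 1 / e" and bB: "\<bar>B w i l\<bar> \<le> 1 / e" if "i < n" "l < n" for w i l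
    unfolding A_def B_def using that by (auto intro!: matfun_bound sym_mat_goe res_re_bound res_im_bound e)
  have D_eq: "D w = (if k = j then T w k k else T w k j + T w j k)" for w
    unfolding D_def E_def p_def by (rule sum_goe_pair[OF kj])
  have bb: "\<bar>u * v\<bar> \<le> (1 / e)\<^sup>2" if "\<bar>u\<bar> \<le> 1 / e" "\<bar>v\<bar> \<le> 1 / e" for u v :: real
    using mult_mono[OF that] e by (simp add: abs_mult power2_eq_square)
  have bT: "\<bar>T w i l\<bar> \<le> 2 * (1 / e)\<^sup>2" if "i < n" "l < n" for w i l
    using bb[OF bB[of k i w] bB[of l j w]] bb[OF bA[of k i w] bA[of l j w]] kj that unfolding T_def by linarith
  have bD: "\<bar>D w\<bar> \<le> 4 * (1 / e)\<^sup>2" for w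
    unfolding D_eq using bT[of k j w] bT[of j k w] kj by auto
  have mT: "(\<lambda>w. T w i l) \<in> borel_measurable (GOE n)" if "i < n" "l < n" for i l
    unfolding T_def using that kj by (intro borel_measurable_diff borel_measurable_times mA mB) auto
  have mD: "D \<in> borel_measurable (GOE n)"
    unfolding D_eq by (cases "k = j") (use kj in \<open>auto intro!: borel_measurable_add mT\<close>)
  have dh: "((\<lambda>t. A (fun_upd w p t) k j) has_real_derivative D (fun_upd w p t)) (at t)" for w t
    \<comment> \<open>Caratheodory's criterion: the exact resolvent identity exhibits the difference
      quotient g, and continuity of the resolvent entries makes g continuous at t.\<close>
    unfolding CARAT_DERIV
  proof (intro exI conjI allI)
    define g where "g = (\<lambda>z. \<Sum>i<n. \<Sum>l<n. E i l * (B (fun_upd w p z) k i * B (fun_upd w p t) l j - A (fun_upd w p z) k i * A (fun_upd w p t) l j))"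
    fix z
    show "A (fun_upd w p z) k j - A (fun_upd w p t) k j = g z * (z - t)"
      unfolding A_def matfun_resolvent_difference[OF sym_mat_goe sym_mat_goe kj res_re_diff[OF e]] goe_mat_update
      unfolding g_def E_def A_def B_def
      by (simp only: mult.commute[of _ "z - t"] sum_distrib_left mult.assoc)
    show "isCont g t"
      unfolding g_def A_def B_def using kj
      by (intro continuous_intros cA cB) auto
    show "g t = D (fun_upd w p t)" unfolding g_def D_def T_def ..
  qed
  have cD: "isCont (\<lambda>t. D (fun_upd w p t)) t" for w t
    unfolding D_def T_def A_def B_def using kj by (intro continuous_intros cA cB) auto
  note ibp = GOE_integration_by_parts[where h="\<lambda>w. A w k j", OF n p mA[OF kj] mD dh cD bA[OF kj] bD]
  show "integrable (GOE n) (\<lambda>w. goe_mat w k j * A w k j)" unfolding Yp by (rule ibp(2))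
  have com: "A w k j = A w j k" "B w k j = B w j k" for w
    unfolding A_def B_def using kj by (auto intro: matfun_commute sym_mat_goe)
  have "(\<integral>w. goe_mat w k j * A w k j \<partial>GOE n) = (\<integral>w. goe_var n p * D w \<partial>GOE n)"
    unfolding Yp using ibp(1) by simp
  also have "\<dots> = (\<integral>w. 1 / n * (B w k k * B w j j - A w k k * A w j j + ((B w k j)\<^sup>2 - (A w k j)\<^sup>2)) \<partial>GOE n)"
    by (intro Bochner_Integration.integral_cong refl)
       (auto simp: D_eq T_def goe_var_def p_def com power2_eq_square min_def max_def field_simps)
  finally show "(\<integral>w. goe_mat w k j * A w k j \<partial>GOE n) =
      (\<integral>w. 1 / n * (B w k k * B w j j - A w k k * A w j j + ((B w k j)\<^sup>2 - (A w k j)\<^sup>2)) \<partial>GOE n)" .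
qed

text \<open>The diagonal of the identity \<open>(Y - z) G = 1\<close> at \<open>z = \<i> e\<close>, with the Gaussian expectation of \<open>Y G\<close> computed by parts.\<close>

lemma resolvent_equation:
  assumes n: "0 < n" and e: "0 < e" and k: "k < n"
  defines "A \<equiv> \<lambda>w. matfun n (res_re e) (goe_mat w)" and "B \<equiv> \<lambda>w. matfun n (res_im e) (goe_mat w)"
    and "\<alpha> \<equiv> \<lambda>w. mattr n (res_re e) (goe_mat w) / n" and "\<beta> \<equiv> \<lambda>w. mattr n (res_im e) (goe_mat w) / n"
  shows "\<bar>(1 - e * (\<integral>w. B w k k \<partial>GOE n)) - (\<integral>w. B w k k * \<beta> w - A w k k * \<alpha> w \<partial>GOE n)\<bar> \<le> 1 / (n * e\<^sup>2)"
proof -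
  interpret prob_space "GOE n" by (rule prob_space_GOE[OF n])
  have mA: "(\<lambda>w. A w i l) \<in> borel_measurable (GOE n)" and mB: "(\<lambda>w. B w i l) \<in> borel_measurable (GOE n)"
    if "i < n" "l < n" for i l
    unfolding A_def B_def using that
    by (auto intro!: borel_measurable_matfun_goe n lip_res_re[OF e] lip_res_im[OF e])
  have bA: "\<bar>A w i l\<bar> \<le> 1 / e" and bB: "\<bar>B w i l\<bar> \<le> 1 / e" if "i < n" "l < n" for w i l
    unfolding A_def B_def using that by (auto intro!: matfun_bound sym_mat_goe res_re_bound res_im_bound e)
  have bb: "\<bar>u * v\<bar> \<le> (1 / e)\<^sup>2" if "\<bar>u\<bar> \<le> 1 / e" "\<bar>v\<bar> \<le> 1 / e" for u v :: real
    using mult_mono[OF that] e by (simp add: abs_mult power2_eq_square)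
  have iA: "integrable (GOE n) (\<lambda>w. A w i l * A w i' l')" and iB: "integrable (GOE n) (\<lambda>w. B w i l * B w i' l')"
    if "i < n" "l < n" "i' < n" "l' < n" for i l i' l'
    using integrable_GOE_bounded[OF n borel_measurable_times[OF mA mA] bb[OF bA bA]]
      integrable_GOE_bounded[OF n borel_measurable_times[OF mB mB] bb[OF bB bB]] that by auto
  have iB1: "integrable (GOE n) (\<lambda>w. B w k k)"
    by (rule integrable_GOE_bounded[OF n mB[OF k k] bB[OF k k]])
  \<comment> \<open>The part of the integration by parts formula without a trace. Its row sums are
    diagonal entries of squared matrix functions, hence at most 1/e^2, which leaves O(1/(n
    e^2)).\<close>
  define R where "R = (\<lambda>w. \<Sum>j<n. 1 / n * ((B w k j)\<^sup>2 - (A w k j)\<^sup>2))"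
  have iR: "integrable (GOE n) R"
    unfolding R_def power2_eq_square
    using k by (intro Bochner_Integration.integrable_sum integrable_mult_right Bochner_Integration.integrable_diff iA iB) auto
  have sq: "(\<Sum>j<n. (matfun n f (goe_mat w) k j)\<^sup>2) \<le> 1 / e\<^sup>2" if "\<And>x. \<bar>f x\<bar> \<le> 1 / e" for f w
  proof -
    have "(\<Sum>j<n. (matfun n f (goe_mat w) k j)\<^sup>2) = (\<Sum>j<n. matfun n f (goe_mat w) k j * matfun n f (goe_mat w) j k)"
    proof (intro sum.cong refl)
      fix j assume "j \<in> {..<n}"
      then show "(matfun n f (goe_mat w) k j)\<^sup>2 = matfun n f (goe_mat w) k j * matfun n f (goe_mat w) j k"
        using matfun_commute[OF sym_mat_goe k, of j f w] by (simp add: power2_eq_square)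
    qed
    also have "\<dots> = matfun n (\<lambda>x. f x * f x) (goe_mat w) k k" by (rule matfun_mult[OF sym_mat_goe k k])
    also have "\<dots> \<le> (1 / e)\<^sup>2"
      by (rule order_trans[OF abs_ge_self matfun_bound[OF sym_mat_goe k k bb]]) (use that in auto)
    finally show ?thesis by (simp add: power_divide)
  qed
  have R_bound: "\<bar>R w\<bar> \<le> 1 / (n * e\<^sup>2)" for w
  proof -
    have "R w = 1 / n * ((\<Sum>j<n. (B w k j)\<^sup>2) - (\<Sum>j<n. (A w k j)\<^sup>2))"
      unfolding R_def by (simp add: sum_subtractf flip: sum_divide_distrib)
    also have "\<bar>\<dots>\<bar> = 1 / n * \<bar>(\<Sum>j<n. (B w k j)\<^sup>2) - (\<Sum>j<n. (A w k j)\<^sup>2)\<bar>"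
      by (simp add: abs_mult)
    also have "\<dots> \<le> 1 / n * (1 / e\<^sup>2)"
    proof (rule mult_left_mono)
      have "0 \<le> (\<Sum>j<n. (B w k j)\<^sup>2)" "0 \<le> (\<Sum>j<n. (A w k j)\<^sup>2)" by (auto intro: sum_nonneg)
      moreover have "(\<Sum>j<n. (B w k j)\<^sup>2) \<le> 1 / e\<^sup>2" "(\<Sum>j<n. (A w k j)\<^sup>2) \<le> 1 / e\<^sup>2"
        unfolding A_def B_def by (rule sq res_re_bound[OF e] res_im_bound[OF e])+
      ultimately show "\<bar>(\<Sum>j<n. (B w k j)\<^sup>2) - (\<Sum>j<n. (A w k j)\<^sup>2)\<bar> \<le> 1 / e\<^sup>2" by linarith
    qed simp
    finally show ?thesis by simp
  qed
  \<comment> \<open>The diagonal entry of Y A = 1 - e B, with A and B the real and imaginary parts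
    of the resolvent.\<close>
  have id: "1 - e * B w k k = (\<Sum>j<n. goe_mat w k j * A w k j)" for w
  proof -
    have "(\<Sum>j<n. goe_mat w k j * A w k j) = (\<Sum>j<n. matfun n (\<lambda>x. x) (goe_mat w) k j * A w j k)"
    proof (intro sum.cong refl)
      fix j assume "j \<in> {..<n}"
      then show "goe_mat w k j * A w k j = matfun n (\<lambda>x. x) (goe_mat w) k j * A w j k"
        using matfun_commute[OF sym_mat_goe k, of j "res_re e" w] matfun_id[OF sym_mat_goe k, of j w]
        by (simp add: A_def)
    qed
    also have "\<dots> = matfun n (\<lambda>x. 1 - e * res_im e x) (goe_mat w) k k"
      unfolding A_def matfun_mult[OF sym_mat_goe k k] by (simp only: res_id[OF e])
    also have "\<dots> = 1 - e * B w k k"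
      unfolding B_def by (simp add: matfun_diff[OF sym_mat_goe k k] matfun_cmult[OF sym_mat_goe k k] matfun_1[OF sym_mat_goe k k])
    finally show ?thesis ..
  qed
  have "1 - e * (\<integral>w. B w k k \<partial>GOE n) = (\<integral>w. 1 - e * B w k k \<partial>GOE n)"
    using iB1 by (simp add: prob_space)
  also have "\<dots> = (\<Sum>j<n. \<integral>w. goe_mat w k j * A w k j \<partial>GOE n)"
    unfolding id by (intro Bochner_Integration.integral_sum) (use integral_goe_entry_resolvent(2)[OF n e k] in \<open>auto simp: A_def\<close>)
  also have "\<dots> = (\<Sum>j<n. \<integral>w. 1 / n * (B w k k * B w j j - A w k k * A w j j + ((B w k j)\<^sup>2 - (A w k j)\<^sup>2)) \<partial>GOE n)"
    unfolding A_def B_def by (intro sum.cong refl integral_goe_entry_resolvent(1)[OF n e k]) simp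
  also have "\<dots> = (\<integral>w. (\<Sum>j<n. 1 / n * (B w k k * B w j j - A w k k * A w j j + ((B w k j)\<^sup>2 - (A w k j)\<^sup>2))) \<partial>GOE n)"
    unfolding power2_eq_square using k
    by (intro Bochner_Integration.integral_sum[symmetric] integrable_mult_right Bochner_Integration.integrable_add Bochner_Integration.integrable_diff iA iB) auto
  also have "\<dots> = (\<integral>w. (B w k k * \<beta> w - A w k k * \<alpha> w) + R w \<partial>GOE n)"
    unfolding \<alpha>_def \<beta>_def R_def A_def[symmetric] B_def[symmetric] mattr_def
    by (intro Bochner_Integration.integral_cong refl)
       (simp add: A_def B_def sum.distrib sum_subtractf sum_distrib_left sum_divide_distrib add_divide_distrib diff_divide_distrib)
  also have "\<dots> = (\<integral>w. B w k k * \<beta> w - A w k k * \<alpha> w \<partial>GOE n) + (\<integral>w. R w \<partial>GOE n)"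
  proof (rule Bochner_Integration.integral_add[OF _ iR])
    show "integrable (GOE n) (\<lambda>w. B w k k * \<beta> w - A w k k * \<alpha> w)"
      unfolding \<alpha>_def \<beta>_def mattr_def sum_divide_distrib sum_distrib_left times_divide_eq_right
      using k iA iB by (intro Bochner_Integration.integrable_diff Bochner_Integration.integrable_sum integrable_divide) (auto simp: A_def B_def)
  qed
  finally have "(1 - e * (\<integral>w. B w k k \<partial>GOE n)) - (\<integral>w. B w k k * \<beta> w - A w k k * \<alpha> w \<partial>GOE n) = (\<integral>w. R w \<partial>GOE n)"
    by simp
  also have "\<bar>\<dots>\<bar> \<le> (\<integral>w. \<bar>R w\<bar> \<partial>GOE n)" by (rule integral_abs_bound)
  also have "\<dots> \<le> (\<integral>w. 1 / (n * e\<^sup>2) \<partial>GOE n)"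
    using iR R_bound by (intro integral_mono) auto
  finally show ?thesis by (simp add: prob_space)
qed

section \<open>Concentration of resolvent traces and the self-consistent equation\<close>

lemma mean_abs_deviation_goe_lipschitz:
  assumes n: "0 < n" and L: "0 < L"
    and lip: "\<And>x y. \<bar>F x - F y\<bar> \<le> L * goe_dist n x y"
  shows "(\<integral>w. \<bar>F w - (\<integral>w. F w \<partial>GOE n)\<bar> \<partial>GOE n) \<le> 3 * L"
proof -
  interpret prob_space "GOE n" by (rule prob_space_GOE[OF n])
  define m where "m = (\<integral>w. F w \<partial>GOE n)"
  have iF: "integrable (GOE n) F" and iF2: "integrable (GOE n) (\<lambda>w. (F w)\<^sup>2)"
    by (rule goe_lipschitz[OF n L lip])+
  have i2: "integrable (GOE n) (\<lambda>w. (F w - m)\<^sup>2)"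
    unfolding power2_diff using iF iF2 by auto
  have "(\<integral>w. \<bar>F w - m\<bar> \<partial>GOE n) \<le> (\<integral>w. (F w - m)\<^sup>2 / (4 * L) + L \<partial>GOE n)"
  proof (rule integral_mono)
    fix w
    \<comment> \<open>The weights in |d| <= d^2/(4 L) + L fit the variance bound 4 L^2, so each term
      contributes L.\<close>
    have "0 \<le> (\<bar>F w - m\<bar> - 2 * L)\<^sup>2" by simp
    then have "\<bar>F w - m\<bar> * (4 * L) \<le> (F w - m)\<^sup>2 + L * (4 * L)"
      by (simp add: power2_diff power2_eq_square algebra_simps)
    then have "\<bar>F w - m\<bar> \<le> ((F w - m)\<^sup>2 + L * (4 * L)) / (4 * L)"
      using L by (subst pos_le_divide_eq) auto
    also have "\<dots> = (F w - m)\<^sup>2 / (4 * L) + L" using L by (simp add: add_divide_distrib)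
    finally show "\<bar>F w - m\<bar> \<le> (F w - m)\<^sup>2 / (4 * L) + L" .
  qed (use iF i2 in auto)
  also have "\<dots> = (\<integral>w. (F w - m)\<^sup>2 \<partial>GOE n) / (4 * L) + L"
    using i2 by (simp add: prob_space)
  also have "(\<integral>w. (F w - m)\<^sup>2 \<partial>GOE n) \<le> 4 * L\<^sup>2"
    unfolding m_def by (rule variance_goe_lipschitz[OF n L lip])
  then have "(\<integral>w. (F w - m)\<^sup>2 \<partial>GOE n) / (4 * L) + L \<le> 4 * L\<^sup>2 / (4 * L) + L"
    using L by (intro add_right_mono divide_right_mono) auto
  also have "\<dots> \<le> 3 * L" using L by (simp add: power2_eq_square)
  finally show ?thesis unfolding m_def .
qed

definition mean_im :: "nat \<Rightarrow> real \<Rightarrow> real" where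
  "mean_im n e = (\<integral>w. mattr n (res_im e) (goe_mat w) / n \<partial>GOE n)"

text \<open>The kernels have Lipschitz constant 2/e^2, the trace contributes sqrt 2, and 2 sqrt 2 <=
  3; then 36 = 4 * 3^2 bounds the variance and 9 = 3 * 3 the mean deviation.\<close>

lemma mattr_res_average:
  assumes n: "0 < n" and e: "0 < e" and f: "f = res_re e \<or> f = res_im e"
  defines "F \<equiv> \<lambda>w. mattr n f (goe_mat w) / n"
  shows "\<bar>F x - F y\<bar> \<le> 3 / (n * e\<^sup>2) * goe_dist n x y"
    and "integrable (GOE n) F" and "integrable (GOE n) (\<lambda>w. (F w)\<^sup>2)"
    and "(\<integral>w. (F w - (\<integral>w. F w \<partial>GOE n))\<^sup>2 \<partial>GOE n) \<le> 36 / (n\<^sup>2 * e^4)"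
    and "(\<integral>w. \<bar>F w - (\<integral>w. F w \<partial>GOE n)\<bar> \<partial>GOE n) \<le> 9 / (n * e\<^sup>2)"
    and "F \<in> borel_measurable (GOE n)"
proof -
  have l: "lip (2 / e\<^sup>2) f" using f lip_res[OF e] by auto
  have s2: "2 * sqrt 2 \<le> (3::real)"
    by (rule power2_le_imp_le) (simp_all add: power_mult_distrib)
  have L: "0 < 3 / (n * e\<^sup>2)" using n e by simp
  have lipF: "\<bar>F x - F y\<bar> \<le> 3 / (n * e\<^sup>2) * goe_dist n x y" for x y
  proof -
    define S where "S = goe_dist n x y"
    have S: "0 \<le> S" unfolding S_def using goe_var_pos[OF n] by (auto intro!: sum_nonneg divide_nonneg_nonneg simp: less_imp_le)
    have "\<bar>F x - F y\<bar> = \<bar>mattr n f (goe_mat x) - mattr n f (goe_mat y)\<bar> / n"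
      unfolding F_def by (simp flip: diff_divide_distrib)
    also have "\<dots> \<le> 2 / e\<^sup>2 * sqrt 2 * S / n"
      using mattr_goe_lipschitz[OF n l] unfolding S_def by (intro divide_right_mono) auto
    also have "\<dots> = (2 * sqrt 2) * (S / (n * e\<^sup>2))" by (simp add: field_simps)
    also have "\<dots> \<le> 3 * (S / (n * e\<^sup>2))"
      using S by (intro mult_right_mono s2) simp
    finally show ?thesis unfolding S_def by simp
  qed
  show "\<bar>F x - F y\<bar> \<le> 3 / (n * e\<^sup>2) * goe_dist n x y"
    by (rule lipF)
  show "integrable (GOE n) F" "integrable (GOE n) (\<lambda>w. (F w)\<^sup>2)"
    by (rule goe_lipschitz[OF n L lipF])+
  show "(\<integral>w. (F w - (\<integral>w. F w \<partial>GOE n))\<^sup>2 \<partial>GOE n) \<le> 36 / (n\<^sup>2 * e^4)"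
    using variance_goe_lipschitz[OF n L lipF] by (simp add: power_divide power_mult_distrib flip: power_mult)
  show "(\<integral>w. \<bar>F w - (\<integral>w. F w \<partial>GOE n)\<bar> \<partial>GOE n) \<le> 9 / (n * e\<^sup>2)"
    using mean_abs_deviation_goe_lipschitz[OF n L lipF] by simp
  show "F \<in> borel_measurable (GOE n)" by (rule borel_measurable_goe_lipschitz[OF lipF])
qed

lemma mattr_cmult: "sym_mat n A \<Longrightarrow> mattr n (\<lambda>x. c * f x) A = c * mattr n f A"
  unfolding mattr_def by (simp add: matfun_cmult sum_distrib_left)

lemma mean_re:
  assumes n: "0 < n" and e: "0 < e"
  shows "(\<integral>w. mattr n (res_re e) (goe_mat w) / n \<partial>GOE n) = 0"
proof -
  have "res_re e (- x) = (-1) * res_re e x" for x by (simp add: res_re_def)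
  then have "mattr n (\<lambda>x. res_re e (- x)) (goe_mat w) = - mattr n (res_re e) (goe_mat w)" for w
    using mattr_cmult[OF sym_mat_goe, of n "-1" "res_re e" w] by simp
  then show ?thesis
    using integral_mattr_goe_uminus[OF n lip_res_re[OF e]] by simp
qed

lemma mean_im_nonneg:
  assumes e: "0 < e"
  shows "0 \<le> mean_im n e"
proof -
  have "0 \<le> mattr n (res_im e) (goe_mat w)" for w
  proof -
    obtain lam u where "diagonalizes n (goe_mat w) lam u" by (rule sym_mat_diagonalizes[OF sym_mat_goe])
    from mattr_eq[OF this] show ?thesis by (simp add: sum_nonneg res_im_nonneg[OF e])
  qed
  then show ?thesis unfolding mean_im_def by (intro Bochner_Integration.integral_nonneg) simp
qed

text \<open>Averaging the resolvent equation over k turns its products into the second moments of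
  \<beta> and \<alpha>. Replacing them by squared means costs two variances, hence 72 = 2 * 36, and
  \<alpha> has mean 0 by symmetry. With s = \<i> b and z = \<i> e this is the equation s^2 + z s + 1
  = 0 up to an error.\<close>

lemma mean_im_equation:
  assumes n: "0 < n" and e: "0 < e"
  shows "\<bar>1 - e * mean_im n e - (mean_im n e)\<^sup>2\<bar> \<le> 1 / (n * e\<^sup>2) + 72 / (n\<^sup>2 * e^4)"
proof -
  interpret prob_space "GOE n" by (rule prob_space_GOE[OF n])
  define A where "A = (\<lambda>w. matfun n (res_re e) (goe_mat w))"
  define B where "B = (\<lambda>w. matfun n (res_im e) (goe_mat w))"
  define \<alpha> where "\<alpha> = (\<lambda>w. mattr n (res_re e) (goe_mat w) / n)"
  define \<beta> where "\<beta> = (\<lambda>w. mattr n (res_im e) (goe_mat w) / n)"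
  have tr: "(\<Sum>k<n. A w k k) = n * \<alpha> w" "(\<Sum>k<n. B w k k) = n * \<beta> w" for w
    using n by (simp_all add: A_def B_def \<alpha>_def \<beta>_def mattr_def)
  have a: "\<alpha> \<in> borel_measurable (GOE n)" "integrable (GOE n) \<alpha>" "integrable (GOE n) (\<lambda>w. (\<alpha> w)\<^sup>2)"
    "(\<integral>w. (\<alpha> w - (\<integral>w. \<alpha> w \<partial>GOE n))\<^sup>2 \<partial>GOE n) \<le> 36 / (n\<^sup>2 * e^4)"
    unfolding \<alpha>_def by (rule mattr_res_average[OF n e]; simp)+
  have b: "\<beta> \<in> borel_measurable (GOE n)" "integrable (GOE n) \<beta>" "integrable (GOE n) (\<lambda>w. (\<beta> w)\<^sup>2)"
    "(\<integral>w. (\<beta> w - (\<integral>w. \<beta> w \<partial>GOE n))\<^sup>2 \<partial>GOE n) \<le> 36 / (n\<^sup>2 * e^4)"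
    unfolding \<beta>_def by (rule mattr_res_average[OF n e]; simp)+
  have mB: "(\<lambda>w. B w k k) \<in> borel_measurable (GOE n)" "(\<lambda>w. A w k k) \<in> borel_measurable (GOE n)" if "k < n" for k
    unfolding A_def B_def using that by (auto intro!: borel_measurable_matfun_goe n lip_res[OF e])
  have bB: "\<bar>B w k k\<bar> \<le> 1 / e" "\<bar>A w k k\<bar> \<le> 1 / e" if "k < n" for k w
    unfolding A_def B_def using that by (auto intro!: matfun_bound sym_mat_goe res_re_bound res_im_bound e)
  have iB: "integrable (GOE n) (\<lambda>w. B w k k)" if "k < n" for k
    by (rule integrable_GOE_bounded[OF n mB(1)[OF that] bB(1)[OF that]])
  have iprod: "integrable (GOE n) (\<lambda>w. B w k k * \<beta> w - A w k k * \<alpha> w)" if k: "k < n" for k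
  proof (rule Bochner_Integration.integrable_diff)
    show "integrable (GOE n) (\<lambda>w. B w k k * \<beta> w)"
    proof (rule Bochner_Integration.integrable_bound[OF integrable_mult_right[OF b(2), of "1 / e"]])
      show "AE w in GOE n. norm (B w k k * \<beta> w) \<le> norm (1 / e * \<beta> w)"
        using mult_right_mono[OF bB(1)[OF k] abs_ge_zero[of "\<beta> _"]] e by (intro AE_I2) (simp add: abs_mult)
    qed (intro borel_measurable_times mB k b)
    show "integrable (GOE n) (\<lambda>w. A w k k * \<alpha> w)"
    proof (rule Bochner_Integration.integrable_bound[OF integrable_mult_right[OF a(2), of "1 / e"]])
      show "AE w in GOE n. norm (A w k k * \<alpha> w) \<le> norm (1 / e * \<alpha> w)"
        using mult_right_mono[OF bB(2)[OF k] abs_ge_zero[of "\<alpha> _"]] e by (intro AE_I2) (simp add: abs_mult)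
    qed (intro borel_measurable_times mB k a)
  qed
  define X where "X = (\<lambda>k. (1 - e * (\<integral>w. B w k k \<partial>GOE n)) - (\<integral>w. B w k k * \<beta> w - A w k k * \<alpha> w \<partial>GOE n))"
  have X: "\<bar>X k\<bar> \<le> 1 / (n * e\<^sup>2)" if "k < n" for k
    unfolding X_def A_def B_def \<alpha>_def \<beta>_def by (rule resolvent_equation[OF n e that])
  have "(\<Sum>k<n. X k) = n - e * (\<Sum>k<n. \<integral>w. B w k k \<partial>GOE n) - (\<Sum>k<n. \<integral>w. B w k k * \<beta> w - A w k k * \<alpha> w \<partial>GOE n)"
    unfolding X_def by (simp add: sum_subtractf sum_distrib_left)
  also have "(\<Sum>k<n. \<integral>w. B w k k \<partial>GOE n) = (\<integral>w. (\<Sum>k<n. B w k k) \<partial>GOE n)"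
    using iB by (intro Bochner_Integration.integral_sum[symmetric]) auto
  also have "\<dots> = n * mean_im n e" unfolding tr mean_im_def \<beta>_def by simp
  also have "(\<Sum>k<n. \<integral>w. B w k k * \<beta> w - A w k k * \<alpha> w \<partial>GOE n) = (\<integral>w. (\<Sum>k<n. B w k k * \<beta> w - A w k k * \<alpha> w) \<partial>GOE n)"
    using iprod by (intro Bochner_Integration.integral_sum[symmetric]) auto
  also have "(\<lambda>w. \<Sum>k<n. B w k k * \<beta> w - A w k k * \<alpha> w) = (\<lambda>w. n * ((\<beta> w)\<^sup>2 - (\<alpha> w)\<^sup>2))"
    unfolding sum_subtractf sum_distrib_right[symmetric] tr by (simp add: power2_eq_square right_diff_distrib mult.assoc)
  also have "(\<integral>w. n * ((\<beta> w)\<^sup>2 - (\<alpha> w)\<^sup>2) \<partial>GOE n) = n * ((\<integral>w. (\<beta> w)\<^sup>2 \<partial>GOE n) - (\<integral>w. (\<alpha> w)\<^sup>2 \<partial>GOE n))"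
    using a(3) b(3) by simp
  finally have "(\<Sum>k<n. X k) = n * (1 - e * mean_im n e - ((\<integral>w. (\<beta> w)\<^sup>2 \<partial>GOE n) - (\<integral>w. (\<alpha> w)\<^sup>2 \<partial>GOE n)))"
    by (simp add: algebra_simps)
  moreover have "\<bar>\<Sum>k<n. X k\<bar> \<le> (\<Sum>k<n. 1 / (n * e\<^sup>2))"
    by (rule order_trans[OF sum_abs sum_mono]) (use X in simp)
  ultimately have "n * \<bar>1 - e * mean_im n e - ((\<integral>w. (\<beta> w)\<^sup>2 \<partial>GOE n) - (\<integral>w. (\<alpha> w)\<^sup>2 \<partial>GOE n))\<bar> \<le> n * (1 / (n * e\<^sup>2))"
    by (simp add: abs_mult)
  then have main: "\<bar>1 - e * mean_im n e - ((\<integral>w. (\<beta> w)\<^sup>2 \<partial>GOE n) - (\<integral>w. (\<alpha> w)\<^sup>2 \<partial>GOE n))\<bar> \<le> 1 / (n * e\<^sup>2)"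
    using n by (subst (asm) mult_le_cancel_left_pos) auto
  have mb: "(\<integral>w. \<beta> w \<partial>GOE n) = mean_im n e" unfolding mean_im_def \<beta>_def ..
  have ma: "(\<integral>w. \<alpha> w \<partial>GOE n) = 0" unfolding \<alpha>_def by (rule mean_re[OF n e])
  have va: "(\<integral>w. (\<alpha> w)\<^sup>2 \<partial>GOE n) \<le> 36 / (n\<^sup>2 * e^4)" using a(4) unfolding ma by simp
  have "(\<integral>w. (\<beta> w - mean_im n e)\<^sup>2 \<partial>GOE n) = (\<integral>w. (\<beta> w)\<^sup>2 \<partial>GOE n) - (mean_im n e)\<^sup>2"
    using variance_eq[OF b(2) b(3)] unfolding mb .
  then have vb: "(\<integral>w. (\<beta> w)\<^sup>2 \<partial>GOE n) - (mean_im n e)\<^sup>2 \<le> 36 / (n\<^sup>2 * e^4)" "0 \<le> (\<integral>w. (\<beta> w)\<^sup>2 \<partial>GOE n) - (mean_im n e)\<^sup>2"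
    using b(4) unfolding mb by (auto simp flip: \<open>(\<integral>w. (\<beta> w - mean_im n e)\<^sup>2 \<partial>GOE n) = _\<close>)
  have "0 \<le> (\<integral>w. (\<alpha> w)\<^sup>2 \<partial>GOE n)" by simp
  moreover have "\<bar>y - s\<bar> \<le> c + (d + d)" if "\<bar>y - (b - a)\<bar> \<le> c" "0 \<le> a" "a \<le> d" "b - s \<le> d" "0 \<le> b - s" for y a b s c d :: real
    using that by linarith
  ultimately have "\<bar>1 - e * mean_im n e - (mean_im n e)\<^sup>2\<bar> \<le> 1 / (n * e\<^sup>2) + (36 / (n\<^sup>2 * e^4) + 36 / (n\<^sup>2 * e^4))"
    using main va vb by blast
  then show ?thesis by (simp add: mult.commute)
qed

text \<open>For a single k the products are not squares. Instead the traces are replaced by their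
  means, at the cost of the entry bound 1/e times the mean deviation 9/(n e^2), once for \<alpha>
  and once for \<beta>.\<close>

lemma diagonal_equation:
  assumes n: "0 < n" and e: "0 < e" and k: "k < n"
  shows "\<bar>1 - (e + mean_im n e) * (\<integral>w. matfun n (res_im e) (goe_mat w) k k \<partial>GOE n)\<bar> \<le> 1 / (n * e\<^sup>2) + 18 / (n * e^3)"
proof -
  interpret prob_space "GOE n" by (rule prob_space_GOE[OF n])
  define A where "A = (\<lambda>w. matfun n (res_re e) (goe_mat w) k k)"
  define B where "B = (\<lambda>w. matfun n (res_im e) (goe_mat w) k k)"
  define \<alpha> where "\<alpha> = (\<lambda>w. mattr n (res_re e) (goe_mat w) / n)"
  define \<beta> where "\<beta> = (\<lambda>w. mattr n (res_im e) (goe_mat w) / n)"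
  note a = mattr_res_average[OF n e, of "res_re e", folded \<alpha>_def, simplified]
  note b = mattr_res_average[OF n e, of "res_im e", folded \<beta>_def, simplified]
  have mB: "B \<in> borel_measurable (GOE n)" "A \<in> borel_measurable (GOE n)"
    unfolding A_def B_def using k by (auto intro!: borel_measurable_matfun_goe n lip_res[OF e])
  have bB: "\<bar>B w\<bar> \<le> 1 / e" "\<bar>A w\<bar> \<le> 1 / e" for w
    unfolding A_def B_def using k by (auto intro!: matfun_bound sym_mat_goe res_re_bound res_im_bound e)
  have iB: "integrable (GOE n) B" by (rule integrable_GOE_bounded[OF n mB(1) bB(1)])
  have mb: "(\<integral>w. \<beta> w \<partial>GOE n) = mean_im n e" unfolding mean_im_def \<beta>_def ..
  have ma: "(\<integral>w. \<alpha> w \<partial>GOE n) = 0" unfolding \<alpha>_def by (rule mean_re[OF n e])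
  have prod: "integrable (GOE n) (\<lambda>w. C w * (g w - c))" "\<bar>\<integral>w. C w * (g w - c) \<partial>GOE n\<bar> \<le> 1 / e * (\<integral>w. \<bar>g w - c\<bar> \<partial>GOE n)"
    if C: "C \<in> borel_measurable (GOE n)" "\<And>w. \<bar>C w\<bar> \<le> 1 / e" and g: "integrable (GOE n) g" for C g and c :: real
  proof -
    have ig: "integrable (GOE n) (\<lambda>w. \<bar>g w - c\<bar>)" using g by auto
    have ptw: "\<bar>C w * (g w - c)\<bar> \<le> 1 / e * \<bar>g w - c\<bar>" for w
      unfolding abs_mult by (rule mult_right_mono[OF C(2)]) simp
    show int: "integrable (GOE n) (\<lambda>w. C w * (g w - c))"
    proof (rule Bochner_Integration.integrable_bound[OF integrable_mult_right[OF ig, of "1 / e"]])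
      show "AE w in GOE n. norm (C w * (g w - c)) \<le> norm (1 / e * \<bar>g w - c\<bar>)"
        using ptw e by (intro AE_I2) simp
      show "(\<lambda>w. C w * (g w - c)) \<in> borel_measurable (GOE n)"
        using C(1) g by (intro borel_measurable_times borel_measurable_diff) auto
    qed
    have "\<bar>\<integral>w. C w * (g w - c) \<partial>GOE n\<bar> \<le> (\<integral>w. \<bar>C w * (g w - c)\<bar> \<partial>GOE n)" by (rule integral_abs_bound)
    also have "\<dots> \<le> (\<integral>w. 1 / e * \<bar>g w - c\<bar> \<partial>GOE n)"
      by (rule integral_mono) (use int ig ptw in auto)
    finally show "\<bar>\<integral>w. C w * (g w - c) \<partial>GOE n\<bar> \<le> 1 / e * (\<integral>w. \<bar>g w - c\<bar> \<partial>GOE n)" by simp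
  qed
  note p1 = prod[OF mB(1) bB(1) b(2), of "mean_im n e"]
  note p2 = prod[OF mB(2) bB(2) a(2), of 0]
  have db: "(\<integral>w. \<bar>\<beta> w - mean_im n e\<bar> \<partial>GOE n) \<le> 9 / (n * e\<^sup>2)"
    using mattr_res_average(5)[OF n e, of "res_im e"] by (simp add: \<beta>_def mean_im_def)
  have da: "(\<integral>w. \<bar>\<alpha> w - 0\<bar> \<partial>GOE n) \<le> 9 / (n * e\<^sup>2)"
    using mattr_res_average(5)[OF n e, of "res_re e"] unfolding mean_re[OF n e] \<alpha>_def by simp
  have q1: "\<bar>\<integral>w. B w * (\<beta> w - mean_im n e) \<partial>GOE n\<bar> \<le> 1 / e * (9 / (n * e\<^sup>2))"
    using e by (intro order_trans[OF p1(2)] mult_left_mono db) auto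
  have q2: "\<bar>\<integral>w. A w * (\<alpha> w - 0) \<partial>GOE n\<bar> \<le> 1 / e * (9 / (n * e\<^sup>2))"
    using e by (intro order_trans[OF p2(2)] mult_left_mono da) auto
  have "(\<integral>w. B w * \<beta> w - A w * \<alpha> w \<partial>GOE n) =
     (\<integral>w. B w * (\<beta> w - mean_im n e) - A w * (\<alpha> w - 0) + mean_im n e * B w \<partial>GOE n)"
    by (intro Bochner_Integration.integral_cong refl) (simp add: algebra_simps)
  also have "\<dots> = (\<integral>w. B w * (\<beta> w - mean_im n e) \<partial>GOE n) - (\<integral>w. A w * (\<alpha> w - 0) \<partial>GOE n) + mean_im n e * (\<integral>w. B w \<partial>GOE n)"
    using p1(1) p2(1) iB
    by (subst Bochner_Integration.integral_add) (auto simp: Bochner_Integration.integral_diff)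
  finally have eq: "(\<integral>w. B w * \<beta> w - A w * \<alpha> w \<partial>GOE n) = \<dots>" .
  have "\<bar>(1 - e * (\<integral>w. B w \<partial>GOE n)) - (\<integral>w. B w * \<beta> w - A w * \<alpha> w \<partial>GOE n)\<bar> \<le> 1 / (n * e\<^sup>2)"
    unfolding A_def B_def \<alpha>_def \<beta>_def by (rule resolvent_equation[OF n e k])
  moreover have "1 - (e + mean_im n e) * (\<integral>w. B w \<partial>GOE n) = 1 - e * (\<integral>w. B w \<partial>GOE n) - mean_im n e * (\<integral>w. B w \<partial>GOE n)"
    by (simp add: algebra_simps)
  moreover have "\<bar>x\<bar> \<le> c + (d + d)" if "\<bar>y - (p - q + z)\<bar> \<le> c" "x = y - z" "\<bar>p\<bar> \<le> d" "\<bar>q\<bar> \<le> d" for x y z p q c d :: real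
    using that by linarith
  ultimately have "\<bar>1 - (e + mean_im n e) * (\<integral>w. B w \<partial>GOE n)\<bar> \<le> 1 / (n * e\<^sup>2) + (1 / e * (9 / (n * e\<^sup>2)) + 1 / e * (9 / (n * e\<^sup>2)))"
    using q1 q2 unfolding eq by blast
  also have "1 / e * (9 / (n * e\<^sup>2)) + 1 / e * (9 / (n * e\<^sup>2)) = 18 / (n * e^3)"
    by (simp add: power2_eq_square power3_eq_cube)
  finally show ?thesis unfolding B_def .
qed

text \<open>Imaginary part at \<i> e of the Stieltjes transform of the semicircle law on [-2, 2];
  the positive root of c^2 + e c = 1.\<close>

definition sc_im :: "real \<Rightarrow> real" where
  "sc_im e = (sqrt (e\<^sup>2 + 4) - e) / 2"

lemma sc_im_props:
  assumes "0 \<le> e"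
  shows sc_im_pos: "0 < sc_im e" and sc_im_eq: "(sc_im e)\<^sup>2 + e * sc_im e = 1"
proof -
  have "sqrt (e\<^sup>2) < sqrt (e\<^sup>2 + 4)" by (intro real_sqrt_less_mono) simp
  then show "0 < sc_im e" using assms by (simp add: sc_im_def)
  have "(sqrt (e\<^sup>2 + 4))\<^sup>2 = e\<^sup>2 + 4" by (intro real_sqrt_pow2) (simp add: add_nonneg_nonneg)
  then show "(sc_im e)\<^sup>2 + e * sc_im e = 1"
    unfolding sc_im_def by (simp add: power2_eq_square field_simps)
qed

text \<open>Stability of the quadratic equation: its defect at m is (c - m) (c + m + e), whose
  second factor is at least c + e > 0 because m >= 0. The diagonal equation then gives the limit
  1/(e + c) = c.\<close>

lemma tendsto_diagonal_res_im:
  assumes e: "0 < e" and k: "\<And>n. 0 < n \<Longrightarrow> k n < n"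
  shows "(\<lambda>n. \<integral>w. matfun n (res_im e) (goe_mat w) (k n) (k n) \<partial>GOE n) \<longlonglongrightarrow> sc_im e"
proof -
  define c where "c = sc_im e"
  have c: "0 < c" "c\<^sup>2 + e * c = 1" using sc_im_props[of e] e unfolding c_def by auto
  define m where "m = (\<lambda>n. mean_im n e)"
  define b where "b = (\<lambda>n. \<integral>w. matfun n (res_im e) (goe_mat w) (k n) (k n) \<partial>GOE n)"
  have m0: "0 \<le> m n" for n unfolding m_def by (rule mean_im_nonneg[OF e])
  have bound1: "(\<lambda>n. 1 / (real n * e\<^sup>2) + 72 / ((real n)\<^sup>2 * e^4)) \<longlonglongrightarrow> 0"
  proof -
    have "(\<lambda>n. inverse (real n) * (1 / e\<^sup>2) + inverse (real n) * inverse (real n) * (72 / e^4)) \<longlonglongrightarrow> 0 * (1 / e\<^sup>2) + 0 * 0 * (72 / e^4)"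
      by (intro tendsto_intros lim_inverse_n)
    then show ?thesis by (simp add: field_simps power2_eq_square)
  qed
  have bound2: "(\<lambda>n. 1 / (real n * e\<^sup>2) + 18 / (real n * e^3)) \<longlonglongrightarrow> 0"
  proof -
    have "(\<lambda>n. inverse (real n) * (1 / e\<^sup>2) + inverse (real n) * (18 / e^3)) \<longlonglongrightarrow> 0 * (1 / e\<^sup>2) + 0 * (18 / e^3)"
      by (intro tendsto_intros lim_inverse_n)
    then show ?thesis by (simp add: field_simps)
  qed
  have ev: "eventually (\<lambda>n::nat. 0 < n) sequentially" by (rule eventually_gt_at_top)
  have "(\<lambda>n. 1 - e * m n - (m n)\<^sup>2) \<longlonglongrightarrow> 0"
    by (rule Lim_null_comparison[OF _ bound1]) (use ev in eventually_elim, use mean_im_equation[OF _ e] in \<open>auto simp: m_def\<close>)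
  then have "(\<lambda>n. (1 - e * m n - (m n)\<^sup>2) / (c + e)) \<longlonglongrightarrow> 0"
    using tendsto_divide[OF _ tendsto_const, of _ 0 sequentially "c + e"] c e by simp
  then have lim: "(\<lambda>n. \<bar>(1 - e * m n - (m n)\<^sup>2) / (c + e)\<bar>) \<longlonglongrightarrow> 0" by (rule tendsto_rabs_zero)
  have "(\<lambda>n. m n - c) \<longlonglongrightarrow> 0"
  proof (rule Lim_null_comparison[OF _ lim], intro eventuallyI)
    fix n
    have "1 - e * m n - (m n)\<^sup>2 = (c - m n) * (c + m n + e)"
      using c(2) by (simp add: power2_eq_square algebra_simps)
    then have "\<bar>1 - e * m n - (m n)\<^sup>2\<bar> = \<bar>m n - c\<bar> * (c + m n + e)"
      using m0[of n] c e by (simp add: abs_mult abs_minus_commute)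
    moreover have "\<bar>m n - c\<bar> * (c + e) \<le> \<bar>m n - c\<bar> * (c + m n + e)"
      using m0[of n] by (intro mult_left_mono) auto
    ultimately show "norm (m n - c) \<le> \<bar>(1 - e * m n - (m n)\<^sup>2) / (c + e)\<bar>"
      using c e by (simp add: abs_divide pos_le_divide_eq)
  qed
  then have mlim: "m \<longlonglongrightarrow> c" by (simp add: LIM_zero_iff)
  have "(\<lambda>n. 1 - (e + m n) * b n) \<longlonglongrightarrow> 0"
    by (rule Lim_null_comparison[OF _ bound2]) (use ev in eventually_elim, use diagonal_equation[OF _ e k] in \<open>auto simp: m_def b_def\<close>)
  then have "(\<lambda>n. (1 - (1 - (e + m n) * b n)) / (e + m n)) \<longlonglongrightarrow> (1 - 0) / (e + c)"
    using c e by (intro tendsto_intros mlim) auto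
  moreover have "(1 - (1 - (e + m n) * b n)) / (e + m n) = b n" for n
    using m0[of n] e by simp
  moreover have "(1 - 0) / (e + c) = c"
    using c e by (simp add: field_simps power2_eq_square)
  ultimately show ?thesis unfolding b_def c_def by simp
qed

section \<open>The mean of the positive part\<close>

lemma riemann_sum_antimono:
  fixes F w :: "real \<Rightarrow> real"
  assumes h: "0 < h" and d: "\<And>e. 0 \<le> e \<Longrightarrow> (F has_real_derivative w e) (at e)"
    and anti: "\<And>x y. 0 \<le> x \<Longrightarrow> x \<le> y \<Longrightarrow> w y \<le> w x" and w: "\<And>x. 0 \<le> x \<Longrightarrow> 0 \<le> w x"
  shows "(\<Sum>j=1..J. h * w (real j * h)) \<le> F (real J * h) - F 0"
    and "F (real J * h) - F 0 \<le> h * w 0 + (\<Sum>j=1..J. h * w (real j * h))"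
proof -
  have step: "h * w (real (Suc j) * h) \<le> F (real (Suc j) * h) - F (real j * h)"
    "F (real (Suc j) * h) - F (real j * h) \<le> h * w (real j * h)" for j
  proof -
    have lt: "real j * h < real (Suc j) * h" using h by simp
    have "\<exists>z>real j * h. z < real (Suc j) * h \<and> F (real (Suc j) * h) - F (real j * h) = (real (Suc j) * h - real j * h) * w z"
      using h by (intro MVT2[OF lt] d) (auto intro: order_trans[rotated])
    then obtain z where z: "real j * h < z" "z < real (Suc j) * h" "F (real (Suc j) * h) - F (real j * h) = h * w z"
      by (auto simp: algebra_simps)
    have "0 \<le> real j * h" using h by simp
    moreover from this have "0 \<le> z" using z(1) by linarith
    ultimately show "h * w (real (Suc j) * h) \<le> F (real (Suc j) * h) - F (real j * h)"
      "F (real (Suc j) * h) - F (real j * h) \<le> h * w (real j * h)"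
      unfolding z(3) using z(1,2) h by (auto intro!: mult_left_mono anti)
  qed
  show "(\<Sum>j=1..J. h * w (real j * h)) \<le> F (real J * h) - F 0"
  proof (induction J)
    case (Suc J)
    then show ?case using step(1)[of J] by simp
  qed simp
  \<comment> \<open>The additional term h * w (J h) carries the induction: it bounds the increment
    of F over the next cell.\<close>
  have "F (real J * h) - F 0 + h * w (real J * h) \<le> h * w 0 + (\<Sum>j=1..J. h * w (real j * h))"
  proof (induction J)
    case (Suc J)
    then show ?case using step(2)[of J] by simp
  qed simp
  moreover have "0 \<le> h * w (real J * h)" using h by (intro mult_nonneg_nonneg w) auto
  ultimately show "F (real J * h) - F 0 \<le> h * w 0 + (\<Sum>j=1..J. h * w (real j * h))" by linarith
qed

lemma res_re_antimono: "0 \<le> e \<Longrightarrow> e \<le> e' \<Longrightarrow> x * res_re e' x \<le> x * res_re e x"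
proof (cases "x = 0")
  case False
  assume "0 \<le> e" "e \<le> e'"
  then have "e\<^sup>2 \<le> e'\<^sup>2" by (intro power_mono) auto
  then have "x\<^sup>2 / (x\<^sup>2 + e'\<^sup>2) \<le> x\<^sup>2 / (x\<^sup>2 + e\<^sup>2)"
    using False by (intro divide_left_mono mult_pos_pos add_pos_nonneg) auto
  then show ?thesis by (simp add: res_re_def power2_eq_square)
qed simp

text \<open>A Riemann sum for \<open>\<pi> / 2 * \<bar>x\<bar> = \<integral> x\<^sup>2 / (x\<^sup>2 + e\<^sup>2) de\<close> over \<open>e > 0\<close>.\<close>

lemma abs_riemann_sum:
  fixes x :: real
  assumes N: "0 < N"
  defines "S \<equiv> \<Sum>j=1..N * N. 1 / real N * (x * res_re (real j * (1 / real N)) x)"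
  shows "S \<le> pi / 2 * \<bar>x\<bar>" and "pi / 2 * \<bar>x\<bar> \<le> S + 1 / real N + x\<^sup>2 / real N"
proof -
  have "S \<le> pi / 2 * \<bar>x\<bar> \<and> pi / 2 * \<bar>x\<bar> \<le> S + 1 / real N + x\<^sup>2 / real N"
  proof (cases "x = 0")
    case True
    then show ?thesis by (simp add: S_def)
  next
    case False
    define F where "F = (\<lambda>e. x * arctan (e / x))"
    have d: "(F has_real_derivative x * res_re e x) (at e)" for e
    proof -
      have "(F has_real_derivative x * (inverse (1 + (e / x)\<^sup>2) * (1 / x))) (at e)"
        unfolding F_def using False
        by (auto intro!: derivative_eq_intros)
      also have "x * (inverse (1 + (e / x)\<^sup>2) * (1 / x)) = x * res_re e x"
      proof -
        have "1 + (e / x)\<^sup>2 = (x\<^sup>2 + e\<^sup>2) / x\<^sup>2" using False by (simp add: power_divide field_simps)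
        then show ?thesis using False by (simp add: res_re_def power2_eq_square)
      qed
      finally show ?thesis .
    qed
    have nn: "0 \<le> x * res_re e x" for e by (simp add: res_re_def)
    have h: "0 < 1 / real N" using N by simp
    note r = riemann_sum_antimono[OF h, where F=F and w="\<lambda>e. x * res_re e x" and J="N * N", OF d res_re_antimono nn, folded S_def]
    have NN: "real (N * N) * (1 / real N) = real N" using N by simp
    have F0: "F 0 = 0" by (simp add: F_def)
    have w0: "1 / real N * (x * res_re 0 x) \<le> 1 / real N"
      using N False by (simp add: res_re_def power2_eq_square)
    have FN: "F N = \<bar>x\<bar> * arctan (N / \<bar>x\<bar>)"
      unfolding F_def by (cases "0 \<le> x") (auto simp: arctan_minus)
    have up: "F N \<le> pi / 2 * \<bar>x\<bar>"
      unfolding FN using arctan_ubound[of "N / \<bar>x\<bar>"] mult_left_mono[of "arctan (N / \<bar>x\<bar>)" "pi / 2" "\<bar>x\<bar>"] by (simp add: mult.commute)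
    \<comment> \<open>The part of the integral beyond e = N is |x| arctan(|x|/N) <= x^2/N, an error
      that the second moment of the spectral measure controls.\<close>
    have "arctan (\<bar>x\<bar> / N) = pi / 2 - arctan (N / \<bar>x\<bar>)"
      using arctan_inverse[of "N / \<bar>x\<bar>"] False N by simp
    moreover have "arctan (\<bar>x\<bar> / N) \<le> \<bar>x\<bar> / N" by (rule arctan_le_self) simp
    ultimately have "pi / 2 - \<bar>x\<bar> / N \<le> arctan (N / \<bar>x\<bar>)" by linarith
    then have "\<bar>x\<bar> * (pi / 2 - \<bar>x\<bar> / N) \<le> F N" unfolding FN by (rule mult_left_mono) simp
    then have "pi / 2 * \<bar>x\<bar> - x\<^sup>2 / N \<le> F N" by (simp add: algebra_simps power2_eq_square abs_mult_self_eq)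
    then show ?thesis using r up w0 unfolding NN F0 by linarith
  qed
  then show "S \<le> pi / 2 * \<bar>x\<bar>" "pi / 2 * \<bar>x\<bar> \<le> S + 1 / real N + x\<^sup>2 / real N" by auto
qed

text \<open>The rationalized form, in which the decrease in e is visible.\<close>

lemma sc_im_eq2:
  assumes "0 \<le> e"
  shows "sc_im e = 2 / (sqrt (e\<^sup>2 + 4) + e)"
proof -
  have p: "0 < sqrt (e\<^sup>2 + 4)" by (simp add: add_nonneg_pos)
  have "(sqrt (e\<^sup>2 + 4))\<^sup>2 = e\<^sup>2 + 4" by (intro real_sqrt_pow2) (simp add: add_nonneg_nonneg)
  then have "(sqrt (e\<^sup>2 + 4) - e) * (sqrt (e\<^sup>2 + 4) + e) = 4" by (simp add: power2_eq_square algebra_simps)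
  moreover have "sqrt (e\<^sup>2 + 4) + e \<noteq> 0" using p assms by linarith
  ultimately have eq: "sqrt (e\<^sup>2 + 4) - e = 4 / (sqrt (e\<^sup>2 + 4) + e)" by (simp add: eq_divide_eq)
  have half: "4 / x / 2 = 2 / x" for x :: real by (simp add: field_simps)
  show ?thesis unfolding sc_im_def eq half ..
qed

text \<open>An antiderivative of c^2 is -(c + c^3/3): with S = sqrt(e^2 + 4) = 2 c + e one has c' =
  -c/S, and c^2 + e c = 1 gives 1 + c^2 = c S. At 0, where c = 1, it equals -4/3; beyond N it
  contributes at most 2/N because c <= 1/N, and the first cell adds 1/N.\<close>

lemma sc_riemann_sum:
  assumes N: "0 < N"
  shows "\<bar>(\<Sum>j=1..N * N. 1 / real N * (sc_im (real j * (1 / real N)))\<^sup>2) - 4 / 3\<bar> \<le> 3 / real N"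
proof -
  define F where "F = (\<lambda>e. - (sc_im e + (sc_im e)^3 / 3))"
  have d: "(F has_real_derivative (sc_im e)\<^sup>2) (at e)" if e: "0 \<le> e" for e
  proof -
    define S where "S = sqrt (e\<^sup>2 + 4)"
    define c where "c = sc_im e"
    have S: "0 < S" unfolding S_def by (simp add: add_nonneg_pos)
    have Sc: "S = 2 * c + e" unfolding c_def sc_im_def S_def by (simp add: field_simps)
    have "(sc_im has_real_derivative (e / S - 1) / 2) (at e)"
    proof -
      have "((\<lambda>e. (sqrt (e\<^sup>2 + 4) - e) / 2) has_real_derivative (inverse (sqrt (e\<^sup>2 + 4)) / 2 * (2 * e) - 1) / 2) (at e)"
        using add_nonneg_pos[OF zero_le_power2[of e], of 4] by (auto intro!: derivative_eq_intros)
      also have "inverse (sqrt (e\<^sup>2 + 4)) / 2 * (2 * e) = e / S"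
        unfolding S_def by (simp add: inverse_eq_divide)
      finally show ?thesis unfolding sc_im_def[abs_def] .
    qed
    also have "(e / S - 1) / 2 = - c / S" using S unfolding Sc by (simp add: field_simps)
    finally have dc: "(sc_im has_real_derivative - c / S) (at e)" .
    have "(F has_real_derivative - (- c / S + real 3 * (- c / S * sc_im e ^ (3 - Suc 0)) / 3)) (at e)"
      unfolding F_def by (rule DERIV_minus[OF DERIV_add[OF dc DERIV_cdivide[OF DERIV_power[OF dc]]]])
    also have "- (- c / S + real 3 * (- c / S * sc_im e ^ (3 - Suc 0)) / 3) = (c + c * c\<^sup>2) / S"
      unfolding c_def by (simp add: power2_eq_square add_divide_distrib)
    also have "c + c * c\<^sup>2 = c * (1 + c\<^sup>2)" by (simp add: algebra_simps)
    also have "1 + c\<^sup>2 = c * S" using sc_im_eq[OF e] unfolding Sc c_def by (simp add: power2_eq_square algebra_simps)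
    also have "c * (c * S) / S = c\<^sup>2" using S by (simp add: power2_eq_square)
    finally show ?thesis unfolding c_def .
  qed
  have anti: "(sc_im e')\<^sup>2 \<le> (sc_im e)\<^sup>2" if "0 \<le> e" "e \<le> e'" for e e'
  proof -
    have "0 < sqrt (e\<^sup>2 + 4) + e" using that by (intro add_pos_nonneg) (auto simp: add_nonneg_pos)
    moreover have "sqrt (e\<^sup>2 + 4) + e \<le> sqrt (e'\<^sup>2 + 4) + e'"
      using that by (intro add_mono real_sqrt_le_mono power_mono) auto
    ultimately have "sc_im e' \<le> sc_im e"
      using that by (subst (1 2) sc_im_eq2) (auto intro!: divide_left_mono mult_pos_pos)
    then show ?thesis using sc_im_pos[of e'] that by (intro power_mono) auto
  qed
  have h: "0 < 1 / real N" using N by simp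
  note r = riemann_sum_antimono[OF h, where F=F and w="\<lambda>e. (sc_im e)\<^sup>2" and J="N * N", OF d anti]
  have NN: "real (N * N) * (1 / real N) = real N" using N by simp
  have sc0: "sc_im 0 = 1" by (simp add: sc_im_def)
  then have F0: "F 0 = - (4 / 3)" by (simp add: F_def)
  have c: "0 < sc_im N" by (rule sc_im_pos) simp
  have "real N * sc_im N \<le> 1" using sc_im_eq[OF of_nat_0_le_iff[of N]] zero_le_power2[of "sc_im N"] by linarith
  then have cN: "sc_im N \<le> 1 / N" using N by (simp add: field_simps)
  have "1 / real N \<le> 1" using N by simp
  then have c1: "sc_im N \<le> 1" using cN by linarith
  have "(sc_im N)^3 \<le> sc_im N" using c c1 power_decreasing[of 1 3 "sc_im N"] by simp
  moreover have "0 \<le> (sc_im N)^3" using c by simp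
  moreover have "2 / real N = 2 * (1 / real N)" by simp
  ultimately have "- (2 / N) \<le> F N" "F N \<le> 0" unfolding F_def using c cN by linarith+
  moreover have "3 / real N = 2 / N + 1 / N" by (simp flip: add_divide_distrib)
  moreover have "0 < 1 / real N" by (rule h)
  ultimately show ?thesis
    using r unfolding NN F0 sc0 abs_le_iff by simp
qed

lemma matfun_sum:
  assumes A: "sym_mat n A" and ab: "a < n" "b < n" and "finite S"
  shows "matfun n (\<lambda>x. \<Sum>j\<in>S. f j x) A a b = (\<Sum>j\<in>S. matfun n (f j) A a b)"
  using \<open>finite S\<close>
proof (induction S rule: finite_induct)
  case empty
  show ?case using matfun_cmult[OF A ab, of 0 "\<lambda>_. 0"] by simp
next
  case (insert j S)
  then show ?case by (simp add: matfun_add[OF A ab])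
qed

lemma goe_entry_moments:
  assumes n: "0 < n" and kj: "k < n" "j < n"
  shows "(\<integral>w. goe_mat w k j \<partial>GOE n) = 0" "integrable (GOE n) (\<lambda>w. goe_mat w k j)"
    "(\<integral>w. (goe_mat w k j)\<^sup>2 \<partial>GOE n) = (if k = j then 2 / n else 1 / n)" "integrable (GOE n) (\<lambda>w. (goe_mat w k j)\<^sup>2)"
proof -
  define p where "p = (min k j, max k j)"
  have p: "p \<in> goe_index n" using kj by (auto simp: p_def goe_index_def)
  have Yp: "goe_mat w k j = w p" for w by (auto simp: goe_mat_def p_def min_def max_def)
  have s: "0 < goe_var n p" by (rule goe_var_pos[OF n])
  have m1: "(\<lambda>x::real. x) \<in> borel_measurable borel" and m2: "(\<lambda>x::real. x\<^sup>2) \<in> borel_measurable borel" by simp_all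
  have "(\<integral>x. x * 1 \<partial>gaussian (goe_var n p)) = goe_var n p * (\<integral>x. 0 \<partial>gaussian (goe_var n p))"
    by (rule gaussian_integration_by_parts[OF s, where C=1 and C'=0]) (auto intro!: derivative_eq_intros)
  then show "(\<integral>w. goe_mat w k j \<partial>GOE n) = 0"
    unfolding Yp GOE_coordinate(1)[OF n p m1] by simp
  show "integrable (GOE n) (\<lambda>w. goe_mat w k j)"
    unfolding Yp GOE_coordinate(2)[OF n p m1] using integrable_gaussian_moment[OF s, of 1] by simp
  show "(\<integral>w. (goe_mat w k j)\<^sup>2 \<partial>GOE n) = (if k = j then 2 / n else 1 / n)"
    unfolding Yp GOE_coordinate(1)[OF n p m2] gaussian_second_moment[OF s]
    by (auto simp: goe_var_def p_def min_def max_def)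
  show "integrable (GOE n) (\<lambda>w. (goe_mat w k j)\<^sup>2)"
    unfolding Yp GOE_coordinate(2)[OF n p m2] by (rule integrable_gaussian_moment[OF s])
qed

text \<open>The entry is the squared norm of row k, with mean 1 + 1/n. This is what controls the
  influence of large eigenvalues.\<close>

lemma goe_second_moment:
  assumes n: "0 < n" and k: "k < n"
  shows "integrable (GOE n) (\<lambda>w. matfun n (\<lambda>x. x\<^sup>2) (goe_mat w) k k)"
    and "(\<integral>w. matfun n (\<lambda>x. x\<^sup>2) (goe_mat w) k k \<partial>GOE n) \<le> 2"
proof -
  have eq: "matfun n (\<lambda>x. x\<^sup>2) (goe_mat w) k k = (\<Sum>j<n. (goe_mat w k j)\<^sup>2)" for w
  proof -
    have "(\<Sum>j<n. (goe_mat w k j)\<^sup>2) = (\<Sum>j<n. matfun n (\<lambda>x. x) (goe_mat w) k j * matfun n (\<lambda>x. x) (goe_mat w) j k)"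
      using k sym_mat_goe[of n w] by (intro sum.cong refl) (simp add: matfun_id sym_mat_def power2_eq_square)
    also have "\<dots> = matfun n (\<lambda>x. x\<^sup>2) (goe_mat w) k k"
      unfolding matfun_mult[OF sym_mat_goe k k] power2_eq_square ..
    finally show ?thesis ..
  qed
  show "integrable (GOE n) (\<lambda>w. matfun n (\<lambda>x. x\<^sup>2) (goe_mat w) k k)"
    unfolding eq using goe_entry_moments(4)[OF n k] by (intro Bochner_Integration.integrable_sum) auto
  have "(\<integral>w. matfun n (\<lambda>x. x\<^sup>2) (goe_mat w) k k \<partial>GOE n) = (\<Sum>j<n. \<integral>w. (goe_mat w k j)\<^sup>2 \<partial>GOE n)"
    unfolding eq using goe_entry_moments(4)[OF n k] by (intro Bochner_Integration.integral_sum) auto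
  also have "\<dots> = (\<Sum>j<n. 1 / n + (if k = j then 1 else 0) * (1 / n))"
    using goe_entry_moments(3)[OF n k] by (intro sum.cong refl) (auto simp flip: add_divide_distrib)
  also have "\<dots> = n * (1 / n) + 1 / n"
    unfolding sum.distrib sum_delta_lt[OF k] by simp
  also have "\<dots> \<le> 2" using n by simp
  finally show "(\<integral>w. matfun n (\<lambda>x. x\<^sup>2) (goe_mat w) k k \<partial>GOE n) \<le> 2" .
qed

lemma lip_abs: "lip 1 (\<lambda>x. \<bar>x\<bar>)"
  by (auto simp: lip_def)

lemma lip_posneg: "lip 1 (\<lambda>x. max x 0)" "lip 1 (\<lambda>x. min x 0)"
  by (auto simp: lip_def max_def min_def)

lemma integrable_matfun_goe:
  assumes "0 < n" "a < n" "b < n" and f: "lip L f"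
  shows "integrable (GOE n) (\<lambda>w. matfun n f (goe_mat w) a b)"
proof -
  have "0 < L * sqrt (2 / n)" using f \<open>0 < n\<close> by (simp add: lip_def)
  then show ?thesis by (rule integrable_goe_lipschitz[OF \<open>0 < n\<close> _ matfun_goe_lipschitz[OF assms]])
qed

text \<open>For a fixed mesh 1/N the Riemann sum has finitely many terms, so its mean converges as n
  grows, while its distance from \<pi>/2 times the mean of the absolute value is at most 3/N
  uniformly in n. Then N is taken large.\<close>

lemma tendsto_diagonal_abs:
  assumes k: "\<And>n. 0 < n \<Longrightarrow> k n < n"
  shows "(\<lambda>n. \<integral>w. matfun n (\<lambda>x. \<bar>x\<bar>) (goe_mat w) (k n) (k n) \<partial>GOE n) \<longlonglongrightarrow> 8 / (3 * pi)"
proof -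
  define E where "E = (\<lambda>n. \<integral>w. matfun n (\<lambda>x. \<bar>x\<bar>) (goe_mat w) (k n) (k n) \<partial>GOE n)"
  have "(\<lambda>n. pi / 2 * E n) \<longlonglongrightarrow> 4 / 3"
  proof (rule LIMSEQ_I)
    fix r :: real assume r: "0 < r"
    \<comment> \<open>7/N collects 3/N from the Riemann sum for |x|, 1/N from the limit in n, and
      3/N from the Riemann sum of the limit.\<close>
    obtain N :: nat where N: "7 / r < N" using reals_Archimedean2 by blast
    then have N0: "0 < N" using r by (metis divide_pos_pos of_nat_0_less_iff order.strict_trans zero_less_numeral)
    have N7: "7 / N < r" using N r N0 by (simp add: field_simps)
    define e where "e = (\<lambda>j::nat. real j * (1 / real N))"
    have e: "0 < e j" if "j \<in> {1..N * N}" for j using that N0 by (simp add: e_def)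
    define s where "s = (\<lambda>n. \<Sum>j=1..N * N. 1 / real N * (1 - e j * (\<integral>w. matfun n (res_im (e j)) (goe_mat w) (k n) (k n) \<partial>GOE n)))"
    have "s \<longlonglongrightarrow> (\<Sum>j=1..N * N. 1 / real N * (1 - e j * sc_im (e j)))"
      unfolding s_def by (intro tendsto_intros tendsto_diagonal_res_im e k) auto
    also have "(\<Sum>j=1..N * N. 1 / real N * (1 - e j * sc_im (e j))) = (\<Sum>j=1..N * N. 1 / real N * (sc_im (e j))\<^sup>2)"
    proof (intro sum.cong refl)
      fix j assume "j \<in> {1..N * N}"
      then have "0 \<le> e j" using e less_imp_le by blast
      from sc_im_eq[OF this] have "1 - e j * sc_im (e j) = (sc_im (e j))\<^sup>2" by linarith
      then show "1 / real N * (1 - e j * sc_im (e j)) = 1 / real N * (sc_im (e j))\<^sup>2" by simp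
    qed
    finally have "\<exists>M. \<forall>n\<ge>M. norm (s n - (\<Sum>j=1..N * N. 1 / real N * (sc_im (e j))\<^sup>2)) < 1 / N"
      using N0 by (intro LIMSEQ_D) auto
    then obtain M where M: "\<And>n. n \<ge> M \<Longrightarrow> \<bar>s n - (\<Sum>j=1..N * N. 1 / real N * (sc_im (e j))\<^sup>2)\<bar> < 1 / N"
      by auto
    have close: "\<bar>pi / 2 * E n - s n\<bar> \<le> 3 / N" if n: "0 < n" for n
    proof -
      interpret prob_space "GOE n" by (rule prob_space_GOE[OF n])
      note kn = k[OF n] k[OF n]
      define g where "g = (\<lambda>x. \<Sum>j=1..N * N. 1 / real N * (x * res_re (e j) x))"
      define Mf where "Mf = (\<lambda>f w. matfun n f (goe_mat w) (k n) (k n))"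
      have Mg: "Mf g w = (\<Sum>j=1..N * N. 1 / real N * (1 - e j * Mf (res_im (e j)) w))" for w
      proof -
        \<comment> \<open>x res_re = 1 - e res_im expresses the integrand through the resolvent
          entry whose limit is known.\<close>
        have g_eq: "g = (\<lambda>x. \<Sum>j=1..N * N. 1 / real N * (1 - e j * res_im (e j) x))"
          unfolding g_def by (intro ext sum.cong refl) (simp add: res_id[OF e])
        show ?thesis unfolding Mf_def g_eq
          by (simp only: matfun_sum[OF sym_mat_goe kn finite_atLeastAtMost] matfun_cmult[OF sym_mat_goe kn]
            matfun_diff[OF sym_mat_goe kn] matfun_1[OF sym_mat_goe kn] simp_thms if_True)
      qed
      have ii: "integrable (GOE n) (Mf (res_im (e j)))" if "j \<in> {1..N * N}" for j
        unfolding Mf_def by (rule integrable_matfun_goe[OF n kn lip_res_im[OF e[OF that]]])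
      have ig: "integrable (GOE n) (Mf g)"
        unfolding Mg using ii by (intro Bochner_Integration.integrable_sum) auto
      have "(\<integral>w. Mf g w \<partial>GOE n) = (\<Sum>j=1..N * N. \<integral>w. 1 / real N * (1 - e j * Mf (res_im (e j)) w) \<partial>GOE n)"
        unfolding Mg using ii by (intro Bochner_Integration.integral_sum) auto
      also have "\<dots> = s n"
        using ii unfolding s_def Mf_def by (intro sum.cong refl) (simp add: prob_space)
      finally have Eg: "(\<integral>w. Mf g w \<partial>GOE n) = s n" .
      have ia: "integrable (GOE n) (Mf (\<lambda>x. \<bar>x\<bar>))"
        unfolding Mf_def by (rule integrable_matfun_goe[OF n kn lip_abs])
      have i2: "integrable (GOE n) (Mf (\<lambda>x. x\<^sup>2))"
        unfolding Mf_def by (rule goe_second_moment(1)[OF n kn(1)])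
      have lo: "Mf g w \<le> pi / 2 * Mf (\<lambda>x. \<bar>x\<bar>) w" for w
        unfolding Mf_def matfun_cmult[OF sym_mat_goe kn, symmetric] g_def e_def
        by (rule matfun_diag_mono[OF sym_mat_goe kn(1)]) (rule abs_riemann_sum(1)[OF N0])
      have hi: "pi / 2 * Mf (\<lambda>x. \<bar>x\<bar>) w \<le> Mf g w + 1 / N * (1 + Mf (\<lambda>x. x\<^sup>2) w)" for w
      proof -
        have "matfun n (\<lambda>x. pi / 2 * \<bar>x\<bar>) (goe_mat w) (k n) (k n) \<le> matfun n (\<lambda>x. g x + 1 / N * (1 + x\<^sup>2)) (goe_mat w) (k n) (k n)"
        proof (rule matfun_diag_mono[OF sym_mat_goe kn(1)])
          fix x show "pi / 2 * \<bar>x\<bar> \<le> g x + 1 / N * (1 + x\<^sup>2)"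
            using abs_riemann_sum(2)[OF N0, of x] unfolding g_def e_def by (simp add: add_divide_distrib)
        qed
        then show ?thesis
          by (simp only: Mf_def matfun_cmult[OF sym_mat_goe kn] matfun_add[OF sym_mat_goe kn] matfun_1[OF sym_mat_goe kn] if_True simp_thms)
      qed
      have "s n \<le> (\<integral>w. pi / 2 * Mf (\<lambda>x. \<bar>x\<bar>) w \<partial>GOE n)"
        unfolding Eg[symmetric] using lo ig ia by (intro integral_mono) auto
      moreover have "(\<integral>w. pi / 2 * Mf (\<lambda>x. \<bar>x\<bar>) w \<partial>GOE n) \<le> (\<integral>w. Mf g w + 1 / N * (1 + Mf (\<lambda>x. x\<^sup>2) w) \<partial>GOE n)"
        using hi ig ia i2 by (intro integral_mono) auto
      moreover have "(\<integral>w. Mf g w + 1 / N * (1 + Mf (\<lambda>x. x\<^sup>2) w) \<partial>GOE n) = s n + 1 / N * (1 + (\<integral>w. Mf (\<lambda>x. x\<^sup>2) w \<partial>GOE n))"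
        using ig i2 by (simp add: Eg prob_space)
      moreover have "1 / N * (1 + (\<integral>w. Mf (\<lambda>x. x\<^sup>2) w \<partial>GOE n)) \<le> 1 / N * 3"
        using goe_second_moment(2)[OF n kn(1)] unfolding Mf_def by (intro mult_left_mono) auto
      moreover have "(\<integral>w. pi / 2 * Mf (\<lambda>x. \<bar>x\<bar>) w \<partial>GOE n) = pi / 2 * E n"
        unfolding E_def Mf_def by simp
      moreover have "\<bar>p - s\<bar> \<le> c" if "s \<le> I" "I \<le> J" "J = s + d" "d \<le> c" "I = p" for p s I J c d :: real
        using that by linarith
      ultimately have "\<bar>pi / 2 * E n - s n\<bar> \<le> 1 / N * 3" by blast
      then show ?thesis by simp
    qed
    show "\<exists>no. \<forall>n\<ge>no. norm (pi / 2 * E n - 4 / 3) < r"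
    proof (intro exI[of _ "max 1 M"] allI impI)
      fix n assume "max 1 M \<le> n"
      then have "0 < n" "M \<le> n" by auto
      have "7 / real N = 3 / N + 3 / N + 1 / N" by (simp flip: add_divide_distrib)
      then show "norm (pi / 2 * E n - 4 / 3) < r"
        using close[OF \<open>0 < n\<close>] M[OF \<open>M \<le> n\<close>] sc_riemann_sum[OF N0] N7 unfolding e_def real_norm_def by linarith
    qed
  qed
  then have "(\<lambda>n. 2 / pi * (pi / 2 * E n)) \<longlonglongrightarrow> 2 / pi * (4 / 3)"
    by (intro tendsto_intros)
  then show ?thesis unfolding E_def by (simp add: mult.commute[of pi])
qed

text \<open>max x 0 and min x 0 are (x + |x|)/2 and (x - |x|)/2, and the diagonal entries of the
  ensemble have mean 0.\<close>

lemma tendsto_diagonal_posneg: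
  assumes k: "\<And>n. 0 < n \<Longrightarrow> k n < n"
  shows "(\<lambda>n. \<integral>w. matfun n (\<lambda>x. max x 0) (goe_mat w) (k n) (k n) \<partial>GOE n) \<longlonglongrightarrow> 4 / (3 * pi)"
    and "(\<lambda>n. \<integral>w. matfun n (\<lambda>x. min x 0) (goe_mat w) (k n) (k n) \<partial>GOE n) \<longlonglongrightarrow> - (4 / (3 * pi))"
proof -
  define E where "E = (\<lambda>n. \<integral>w. matfun n (\<lambda>x. \<bar>x\<bar>) (goe_mat w) (k n) (k n) \<partial>GOE n)"
  have main: "(\<integral>w. matfun n f (goe_mat w) (k n) (k n) \<partial>GOE n) = s / 2 * E n"
    if n: "0 < n" and f: "\<And>x. f x = s / 2 * \<bar>x\<bar> + 1 / 2 * x" for n f and s :: real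
  proof -
    note kn = k[OF n] k[OF n]
    have fe: "f = (\<lambda>x. s / 2 * \<bar>x\<bar> + 1 / 2 * x)" using f by auto
    have "matfun n f (goe_mat w) (k n) (k n) = s / 2 * matfun n (\<lambda>x. \<bar>x\<bar>) (goe_mat w) (k n) (k n) + 1 / 2 * goe_mat w (k n) (k n)" for w
      unfolding fe by (simp only: matfun_add[OF sym_mat_goe kn] matfun_cmult[OF sym_mat_goe kn] matfun_id[OF sym_mat_goe kn])
    then show ?thesis
      unfolding E_def using integrable_matfun_goe[OF n kn lip_abs] goe_entry_moments(1,2)[OF n kn] by simp
  qed
  have ev: "eventually (\<lambda>n::nat. 0 < n) sequentially" by (rule eventually_gt_at_top)
  have lim: "(\<lambda>n. s / 2 * E n) \<longlonglongrightarrow> s / 2 * (8 / (3 * pi))" for s :: real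
    unfolding E_def by (intro tendsto_intros tendsto_diagonal_abs k)
  have "(\<lambda>n. \<integral>w. matfun n (\<lambda>x. max x 0) (goe_mat w) (k n) (k n) \<partial>GOE n) \<longlonglongrightarrow> 1 / 2 * (8 / (3 * pi))"
    by (rule Lim_transform_eventually[OF lim[of 1]], use ev in eventually_elim, subst main[of _ _ 1]) (auto simp: max_def)
  then show "(\<lambda>n. \<integral>w. matfun n (\<lambda>x. max x 0) (goe_mat w) (k n) (k n) \<partial>GOE n) \<longlonglongrightarrow> 4 / (3 * pi)" by simp
  have "(\<lambda>n. \<integral>w. matfun n (\<lambda>x. min x 0) (goe_mat w) (k n) (k n) \<partial>GOE n) \<longlonglongrightarrow> - 1 / 2 * (8 / (3 * pi))"
    by (rule Lim_transform_eventually[OF lim[of "-1"]], use ev in eventually_elim, subst main[of _ _ "-1"]) (auto simp: min_def)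
  then show "(\<lambda>n. \<integral>w. matfun n (\<lambda>x. min x 0) (goe_mat w) (k n) (k n) \<partial>GOE n) \<longlonglongrightarrow> - (4 / (3 * pi))" by simp
qed

section \<open>The median eigenvalue\<close>

definition clamp1 :: "real \<Rightarrow> real" where "clamp1 x = max (-1) (min 1 x)"

text \<open>Difference of two Lorentzians on the scales \<open>e\<close> and \<open>4 e\<close>: of positive mean, but nonpositive off \<open>[-4 e, 4 e]\<close>.\<close>

definition bump :: "real \<Rightarrow> real \<Rightarrow> real" where
  "bump e x = e * res_im e x - e / 2 * res_im (4 * e) x"

text \<open>The trace of the following function is nonnegative if more than half of the eigenvalues lie beyond \<open>8 e\<close>
  in the direction \<open>s\<close>, but its mean is of order \<open>- n e\<close>.\<close>

definition imbalance :: "real \<Rightarrow> real \<Rightarrow> real \<Rightarrow> real" where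
  "imbalance s e x = s * clamp1 (x / (8 * e)) - 1 / 2 * bump e x"

lemma lip_combine:
  assumes "lip L f" "lip L' g"
  shows "lip (L + L') (\<lambda>x. f x - g x)"
  unfolding lip_def
proof (intro conjI allI)
  show "0 < L + L'" using assms by (simp add: lip_def)
  fix x y
  have "\<bar>f x - f y\<bar> \<le> L * \<bar>x - y\<bar>" "\<bar>g x - g y\<bar> \<le> L' * \<bar>x - y\<bar>" using assms by (simp_all add: lip_def)
  then show "\<bar>f x - g x - (f y - g y)\<bar> \<le> (L + L') * \<bar>x - y\<bar>" by (simp add: distrib_right)
qed

lemma lip_cmult:
  assumes "lip L f" "0 < \<bar>c\<bar>"
  shows "lip (\<bar>c\<bar> * L) (\<lambda>x. c * f x)"
  unfolding lip_def
proof (intro conjI allI)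
  show "0 < \<bar>c\<bar> * L" using assms by (simp add: lip_def)
  fix x y
  have "\<bar>c\<bar> * \<bar>f x - f y\<bar> \<le> \<bar>c\<bar> * (L * \<bar>x - y\<bar>)" using assms by (intro mult_left_mono) (auto simp: lip_def)
  then show "\<bar>c * f x - c * f y\<bar> \<le> \<bar>c\<bar> * L * \<bar>x - y\<bar>" by (simp add: mult.assoc flip: abs_mult right_diff_distrib)
qed

lemma lip_mono:
  assumes "lip L f" "L \<le> L'"
  shows "lip L' f"
proof -
  have "\<bar>f x - f y\<bar> \<le> L' * \<bar>x - y\<bar>" for x y
    using assms mult_right_mono[OF assms(2) abs_ge_zero[of "x - y"]] unfolding lip_def by (meson order_trans)
  then show ?thesis using assms by (simp add: lip_def)
qed

lemma lip_clamp1: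
  assumes "0 < d"
  shows "lip (1 / d) (\<lambda>x. clamp1 (x / d))"
  unfolding lip_def
proof (intro conjI allI)
  show "0 < 1 / d" using assms by simp
  fix x y
  have "\<bar>clamp1 u - clamp1 v\<bar> \<le> \<bar>u - v\<bar>" for u v by (auto simp: clamp1_def max_def min_def)
  then have "\<bar>clamp1 (x / d) - clamp1 (y / d)\<bar> \<le> \<bar>x / d - y / d\<bar>" .
  also have "\<dots> = 1 / d * \<bar>x - y\<bar>" using assms by (simp add: abs_divide flip: diff_divide_distrib)
  finally show "\<bar>clamp1 (x / d) - clamp1 (y / d)\<bar> \<le> 1 / d * \<bar>x - y\<bar>" .
qed

lemma lip_bump:
  assumes e: "0 < e"
  shows "lip (3 / e) (bump e)"
proof -
  have e4: "0 < 4 * e" using e by simp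
  have "lip (\<bar>e\<bar> * (2 / e\<^sup>2) + \<bar>e / 2\<bar> * (2 / (4 * e)\<^sup>2)) (\<lambda>x. e * res_im e x - e / 2 * res_im (4 * e) x)"
    using e by (intro lip_combine lip_cmult lip_res_im e4) auto
  moreover have "\<bar>e\<bar> * (2 / e\<^sup>2) + \<bar>e / 2\<bar> * (2 / (4 * e)\<^sup>2) \<le> 3 / e"
  proof -
    have "\<bar>e\<bar> * (2 / e\<^sup>2) + \<bar>e / 2\<bar> * (2 / (4 * e)\<^sup>2) = (2 + 1 / 16) * (1 / e)"
      using e by (simp add: power2_eq_square field_simps)
    also have "\<dots> \<le> 3 * (1 / e)" using e by (intro mult_right_mono) auto
    finally show ?thesis by simp
  qed
  ultimately show ?thesis unfolding bump_def[abs_def] by (rule lip_mono)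
qed

lemma lip_imbalance:
  assumes e: "0 < e" and s: "\<bar>s\<bar> = 1"
  shows "lip (2 / e) (imbalance s e)"
proof -
  have "lip (\<bar>s\<bar> * (1 / (8 * e)) + \<bar>1 / 2\<bar> * (3 / e)) (\<lambda>x. s * clamp1 (x / (8 * e)) - 1 / 2 * bump e x)"
    using e s by (intro lip_combine lip_cmult lip_bump lip_clamp1) auto
  moreover have "\<bar>s\<bar> * (1 / (8 * e)) + \<bar>1 / 2\<bar> * (3 / e) \<le> 2 / e"
  proof -
    have "\<bar>s\<bar> * (1 / (8 * e)) + \<bar>1 / 2\<bar> * (3 / e) = (1 / 8 + 3 / 2) * (1 / e)"
      using e s by (simp add: field_simps)
    also have "\<dots> \<le> 2 * (1 / e)" using e by (intro mult_right_mono) auto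
    finally show ?thesis by simp
  qed
  ultimately show ?thesis unfolding imbalance_def[abs_def] by (rule lip_mono)
qed

text \<open>The two terms are e^2/(x^2 + e^2) and 2 e^2/(x^2 + 16 e^2); the second is the larger one
  as soon as 16 e^2 <= x^2.\<close>

lemma bump_bounds:
  assumes e: "0 < e"
  shows "bump e x \<le> 1" and "4 * e \<le> \<bar>x\<bar> \<Longrightarrow> bump e x \<le> 0"
proof -
  have e4: "0 < 4 * e" using e by simp
  have "e * res_im e x \<le> 1" using res_im_bound[OF e, of x] e by (simp add: field_simps abs_le_iff)
  moreover have "0 \<le> e / 2 * res_im (4 * e) x" using res_im_nonneg[OF e4, of x] e by simp
  ultimately show "bump e x \<le> 1" unfolding bump_def by linarith
  assume x: "4 * e \<le> \<bar>x\<bar>"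
  then have "(4 * e)\<^sup>2 \<le> x\<^sup>2" using e by (subst abs_le_square_iff[symmetric]) auto
  moreover have "p + q \<le> 2 * (p + r)" if "q \<le> p" "0 \<le> r" for p q r :: real using that by (simp add: algebra_simps)
  ultimately have le: "x\<^sup>2 + (4 * e)\<^sup>2 \<le> 2 * (x\<^sup>2 + e\<^sup>2)" using zero_le_power2[of e] by blast
  have p: "0 < x\<^sup>2 + e\<^sup>2" "0 < x\<^sup>2 + (4 * e)\<^sup>2" by (rule res_pos[OF e], rule res_pos[OF e4])
  have "e * res_im e x = 2 * e\<^sup>2 / (2 * (x\<^sup>2 + e\<^sup>2))"
    unfolding res_im_def by (subst mult_divide_mult_cancel_left) (simp_all add: power2_eq_square)
  also have "\<dots> \<le> 2 * e\<^sup>2 / (x\<^sup>2 + (4 * e)\<^sup>2)" using le p by (intro divide_left_mono) auto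
  also have "\<dots> = e / 2 * res_im (4 * e) x" by (simp add: res_im_def power2_eq_square)
  finally show "bump e x \<le> 0" unfolding bump_def by simp
qed

text \<open>The clamp saturates at 8 e, twice the range 4 e on which the bump can be positive. On
  that range the clamp is at most 1/2 in absolute value and half the bump at most 1/2, so the sum
  stays above -1; outside it the bump only helps.\<close>

lemma imbalance_bounds:
  assumes e: "0 < e" and s: "s = 1 \<or> s = -1"
  shows "- 1 \<le> imbalance s e x" and "8 * e < s * x \<Longrightarrow> 1 \<le> imbalance s e x"
proof -
  have c: "-1 \<le> clamp1 y" "clamp1 y \<le> 1" for y by (auto simp: clamp1_def)
  show "- 1 \<le> imbalance s e x"
  proof (cases "4 * e \<le> \<bar>x\<bar>")
    case True
    then show ?thesis using bump_bounds(2)[OF e True] s c[of "x / (8 * e)"] unfolding imbalance_def by auto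
  next
    case False
    have "\<bar>x / (8 * e)\<bar> \<le> 1 / 2" using False e by (simp add: abs_divide field_simps)
    moreover have "\<bar>clamp1 y\<bar> \<le> \<bar>y\<bar>" for y by (auto simp: clamp1_def max_def min_def)
    ultimately have "\<bar>clamp1 (x / (8 * e))\<bar> \<le> 1 / 2" by (rule order_trans[rotated])
    then show ?thesis using bump_bounds(1)[OF e, of x] s unfolding imbalance_def by auto
  qed
  assume x: "8 * e < s * x"
  then have "4 * e \<le> \<bar>x\<bar>" using s e by auto
  then have b: "bump e x \<le> 0" by (rule bump_bounds(2)[OF e])
  have "1 < s * (x / (8 * e))" using x e by (simp add: field_simps)
  then have "s * clamp1 (x / (8 * e)) = 1" using s by (auto simp: clamp1_def)
  then show "1 \<le> imbalance s e x" using b unfolding imbalance_def by simp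
qed

section \<open>From the trace of the imbalance to the median eigenvalues\<close>

lemma sum_signs:
  fixes f :: "nat \<Rightarrow> real"
  assumes S: "S \<subseteq> {..<n}" "n \<le> 2 * card S" and f: "\<And>l. l < n \<Longrightarrow> -1 \<le> f l" "\<And>l. l \<in> S \<Longrightarrow> 1 \<le> f l"
  shows "0 \<le> (\<Sum>l<n. f l)"
proof -
  have fin: "finite S" using S finite_subset by blast
  have "real (card ({..<n} - S)) = real n - real (card S)"
    using S fin by (subst card_Diff_subset) (auto simp: of_nat_diff card_mono[of "{..<n}" S, simplified])
  then have "0 \<le> real (card S) - real (card ({..<n} - S))" using S(2) by linarith
  also have "\<dots> = (\<Sum>l\<in>S. 1) + (\<Sum>l\<in>{..<n} - S. -1)" by simp
  also have "\<dots> \<le> (\<Sum>l\<in>S. f l) + (\<Sum>l\<in>{..<n} - S. f l)"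
    using f by (intro add_mono sum_mono) auto
  also have "\<dots> = (\<Sum>l<n. f l)" using sum.subset_diff[OF S(1), of f] by simp
  finally show ?thesis .
qed

lemma eigdecomp_diagonalizes: "eigdecomp n A lam u \<Longrightarrow> diagonalizes n A lam u"
  unfolding eigdecomp_def diagonalizes_def orthonormal_rows_def by simp

lemma eigdecomp_antimono:
  assumes "eigdecomp n A lam u" "i \<le> j" "j < n"
  shows "lam j \<le> lam i"
  using assms(2,3)
proof (induction j rule: dec_induct)
  case (step j)
  then have "lam (Suc j) \<le> lam j" using assms(1) unfolding eigdecomp_def by blast
  then show ?case using step by auto
qed simp

text \<open>If lam l > 8 e for some l >= m, the ordering puts the l + 1 > m largest eigenvalues
  beyond 8 e. They outweigh the remaining ones and make the trace nonnegative. The second bound is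
  the mirror image, with the 2 m - l > m smallest eigenvalues.\<close>

lemma median_bound:
  assumes ed: "eigdecomp (2 * m) A lam u" and e: "0 < e"
  shows "mattr (2 * m) (imbalance 1 e) A < 0 \<Longrightarrow> m \<le> l \<Longrightarrow> l < 2 * m \<Longrightarrow> lam l \<le> 8 * e"
    and "mattr (2 * m) (imbalance (-1) e) A < 0 \<Longrightarrow> l < m \<Longrightarrow> - (8 * e) \<le> lam l"
proof -
  note tr = mattr_eq[OF eigdecomp_diagonalizes[OF ed]]
  have one: "(1::real) = 1 \<or> (1::real) = -1" and mone: "(-1::real) = 1 \<or> (-1::real) = -1" by simp_all
  {
    assume neg: "mattr (2 * m) (imbalance 1 e) A < 0" and l: "m \<le> l" "l < 2 * m"
    show "lam l \<le> 8 * e"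
    proof (rule ccontr)
      assume "\<not> lam l \<le> 8 * e"
      then have "8 * e < 1 * lam i" if "i \<in> {..l}" for i
        using eigdecomp_antimono[OF ed, of i l] that l by auto
      then have "1 \<le> imbalance 1 e (lam i)" if "i \<in> {..l}" for i
        using imbalance_bounds(2)[OF e one] that by blast
      then have "0 \<le> (\<Sum>i<2 * m. imbalance 1 e (lam i))"
        using l imbalance_bounds(1)[OF e one] by (intro sum_signs[of "{..l}"]) auto
      then show False using neg unfolding tr by simp
    qed
  }
  {
    assume neg: "mattr (2 * m) (imbalance (-1) e) A < 0" and l: "l < m"
    show "- (8 * e) \<le> lam l"
    proof (rule ccontr)
      assume "\<not> - (8 * e) \<le> lam l"
      then have "8 * e < -1 * lam i" if "i \<in> {l..<2 * m}" for i
        using eigdecomp_antimono[OF ed, of l i] that l by auto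
      then have "1 \<le> imbalance (-1) e (lam i)" if "i \<in> {l..<2 * m}" for i
        using imbalance_bounds(2)[OF e mone] that by blast
      then have "0 \<le> (\<Sum>i<2 * m. imbalance (-1) e (lam i))"
        using l imbalance_bounds(1)[OF e mone] by (intro sum_signs[of "{l..<2 * m}"]) auto
      then show False using neg unfolding tr by simp
    qed
  }
qed

lemma mattr_diff:
  assumes "sym_mat n A"
  shows "mattr n (\<lambda>x. f x - g x) A = mattr n f A - mattr n g A"
  unfolding mattr_def using assms by (simp add: matfun_diff sum_subtractf)

lemma integrable_mattr_goe:
  assumes n: "0 < n" and f: "lip L f"
  shows "integrable (GOE n) (\<lambda>w. mattr n f (goe_mat w))"
proof -
  have "0 < L * sqrt 2" using f by (simp add: lip_def)
  then show ?thesis by (rule integrable_goe_lipschitz[OF n _ mattr_goe_lipschitz[OF n f]])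
qed

text \<open>The odd clamp averages to 0 and only the bump remains. At the scale n^(-1/3) the bracket
  tends to 1 - 1/2, so the mean is about - n e/4 for either sign s.\<close>

lemma mean_imbalance:
  assumes n: "0 < n" and e: "0 < e"
  shows "(\<integral>w. mattr n (imbalance s e) (goe_mat w) \<partial>GOE n) = - (n * e / 2) * (mean_im n e - mean_im n (4 * e) / 2)"
proof -
  have e4: "0 < 4 * e" and e8: "0 < 8 * e" using e by simp_all
  define c where "c = (\<lambda>x. clamp1 (x / (8 * e)))"
  have lc: "lip (1 / (8 * e)) c" unfolding c_def by (rule lip_clamp1[OF e8])
  have "c (- x) = -1 * c x" for x unfolding c_def clamp1_def by (simp add: max_def min_def)
  then have "mattr n (\<lambda>x. c (- x)) (goe_mat w) = - mattr n c (goe_mat w)" for w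
    using mattr_cmult[OF sym_mat_goe, of n "-1" c w] by simp
  then have c0: "(\<integral>w. mattr n c (goe_mat w) \<partial>GOE n) = 0"
    using integral_mattr_goe_uminus[OF n lc] by simp
  have mi: "(\<integral>w. mattr n (res_im e) (goe_mat w) \<partial>GOE n) = n * mean_im n e"
    "(\<integral>w. mattr n (res_im (4 * e)) (goe_mat w) \<partial>GOE n) = n * mean_im n (4 * e)"
    unfolding mean_im_def using n by simp_all
  have eq: "mattr n (imbalance s e) (goe_mat w) = s * mattr n c (goe_mat w)
      - 1 / 2 * (e * mattr n (res_im e) (goe_mat w) - e / 2 * mattr n (res_im (4 * e)) (goe_mat w))" for w
    unfolding imbalance_def[abs_def] bump_def c_def
    by (simp only: mattr_diff[OF sym_mat_goe] mattr_cmult[OF sym_mat_goe])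
  have "(\<integral>w. mattr n (imbalance s e) (goe_mat w) \<partial>GOE n) = s * (\<integral>w. mattr n c (goe_mat w) \<partial>GOE n)
      - 1 / 2 * (e * (\<integral>w. mattr n (res_im e) (goe_mat w) \<partial>GOE n) - e / 2 * (\<integral>w. mattr n (res_im (4 * e)) (goe_mat w) \<partial>GOE n))"
    unfolding eq
    using integrable_mattr_goe[OF n lc] integrable_mattr_goe[OF n lip_res_im[OF e]] integrable_mattr_goe[OF n lip_res_im[OF e4]]
    by simp
  then show ?thesis unfolding c0 mi by (simp add: algebra_simps)
qed

text \<open>The gap 1/4 puts the mean below -r with r = n e/8, and the Lipschitz constant is 3/e;
  hence the exponent r^2/(4 (3/e)^2) = n^2 e^4/2304.\<close>

lemma imbalance_tail:
  assumes n: "0 < n" and e: "0 < e" and s: "\<bar>s\<bar> = 1" and m: "1 / 4 \<le> mean_im n e - mean_im n (4 * e) / 2"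
  shows "measure (GOE n) {w \<in> space (GOE n). 0 \<le> mattr n (imbalance s e) (goe_mat w)} \<le> exp (- ((real n)\<^sup>2 * e^4 / 2304))"
proof -
  interpret prob_space "GOE n" by (rule prob_space_GOE[OF n])
  define F where "F = (\<lambda>w. mattr n (imbalance s e) (goe_mat w))"
  have L: "0 < 3 / e" using e by simp
  have s2: "2 * sqrt 2 \<le> (3::real)"
    by (rule power2_le_imp_le) (simp_all add: power_mult_distrib)
  have lipF: "\<bar>F x - F y\<bar> \<le> 3 / e * goe_dist n x y" for x y
  proof -
    have "\<bar>F x - F y\<bar> \<le> 2 / e * sqrt 2 * goe_dist n x y"
      unfolding F_def by (rule mattr_goe_lipschitz[OF n lip_imbalance[OF e s]])
    also have "\<dots> \<le> 3 / e * goe_dist n x y"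
    proof (rule mult_right_mono)
      have "2 / e * sqrt 2 = 2 * sqrt 2 / e" by simp
      also have "\<dots> \<le> 3 / e" using e by (intro divide_right_mono s2) auto
      finally show "2 / e * sqrt 2 \<le> 3 / e" .
      show "0 \<le> goe_dist n x y"
        using goe_var_pos[OF n] by (auto intro!: sum_nonneg divide_nonneg_nonneg simp: less_imp_le)
    qed
    finally show ?thesis .
  qed
  define r where "r = n * e / 8"
  have r: "0 < r" unfolding r_def using n e by simp
  have "n * e / 2 * (1 / 4) \<le> n * e / 2 * (mean_im n e - mean_im n (4 * e) / 2)"
    using m e by (intro mult_left_mono) auto
  then have mean: "(\<integral>w. F w \<partial>GOE n) + r \<le> 0"
    unfolding F_def mean_imbalance[OF n e] r_def by simp
  have mF: "F \<in> borel_measurable (GOE n)" by (rule borel_measurable_goe_lipschitz[OF lipF])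
  have "measure (GOE n) {w \<in> space (GOE n). 0 \<le> F w} \<le> measure (GOE n) {w \<in> space (GOE n). (\<integral>w. F w \<partial>GOE n) + r \<le> F w}"
    using mean mF by (intro finite_measure_mono) auto
  also have "\<dots> \<le> exp (- (r\<^sup>2 / (4 * (3 / e)\<^sup>2)))" by (rule tail_goe_lipschitz[OF n L lipF r])
  also have "r\<^sup>2 / (4 * (3 / e)\<^sup>2) = (real n)\<^sup>2 * e^4 / 2304"
    unfolding r_def using e by (simp add: power_divide power_mult_distrib power2_eq_square eval_nat_numeral field_simps)
  finally show ?thesis unfolding F_def .
qed

text \<open>All that the probabilistic part uses of the ordered eigendecomposition, with the
  eigenvectors eliminated. The first bound always holds and serves on the exceptional event; the
  second serves when both imbalance traces are negative.\<close>

definition half_close :: "nat \<Rightarrow> (real \<Rightarrow> real) \<Rightarrow> (nat \<Rightarrow> nat \<Rightarrow> real) \<Rightarrow> nat \<Rightarrow> real \<Rightarrow> bool" where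
  "half_close m f A k z \<longleftrightarrow>
     \<bar>z - matfun (2 * m) f A k k\<bar> \<le> matfun (2 * m) (\<lambda>x. \<bar>x\<bar>) A k k \<and>
     (\<forall>e>0. mattr (2 * m) (imbalance 1 e) A < 0 \<longrightarrow> mattr (2 * m) (imbalance (-1) e) A < 0 \<longrightarrow>
        \<bar>z - matfun (2 * m) f A k k\<bar> \<le> 8 * e)"

lemma diagonal_sum_close:
  assumes dg: "diagonalizes n A lam u" and k: "k < n"
    and le: "\<And>l. l < n \<Longrightarrow> \<bar>g l - f (lam l)\<bar> \<le> h (lam l)"
  shows "\<bar>(\<Sum>l<n. g l * u l k * u l k) - matfun n f A k k\<bar> \<le> matfun n h A k k"
proof -
  have "(\<Sum>l<n. g l * u l k * u l k) - matfun n f A k k = (\<Sum>l<n. (g l - f (lam l)) * (u l k * u l k))"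
    unfolding matfun_eq[OF dg k k] by (simp add: sum_subtractf algebra_simps)
  then have "\<bar>(\<Sum>l<n. g l * u l k * u l k) - matfun n f A k k\<bar> \<le> (\<Sum>l<n. \<bar>g l - f (lam l)\<bar> * (u l k * u l k))"
    using sum_abs[of "\<lambda>l. (g l - f (lam l)) * (u l k * u l k)" "{..<n}"] by (simp add: abs_mult)
  also have "\<dots> \<le> (\<Sum>l<n. h (lam l) * (u l k * u l k))"
    using le by (intro sum_mono mult_right_mono) auto
  also have "\<dots> = matfun n h A k k"
    unfolding matfun_eq[OF dg k k] by (simp add: mult.assoc)
  finally show ?thesis .
qed

text \<open>Y+ and the positive part differ only at negative eigenvalues with l < m and positive
  ones with l >= m, and there by |lam l|; the median bounds make this at most 8 e. The lower half is
  treated in the same way.\<close>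

lemma upper_lower_half_close:
  assumes ed: "eigdecomp (2 * m) A lam u" and A: "sym_mat (2 * m) A" and k: "k < 2 * m"
  shows "half_close m (\<lambda>x. max x 0) A k (\<Sum>l\<in>{0..<m}. lam l * u l k * u l k)"
    and "half_close m (\<lambda>x. min x 0) A k (\<Sum>l\<in>{m..<2 * m}. lam l * u l k * u l k)"
proof -
  define g h where "g = (\<lambda>l. if l < m then lam l else 0)" and "h = (\<lambda>l. if l < m then 0 else lam l)"
  have U: "(\<Sum>l\<in>{0..<m}. lam l * u l k * u l k) = (\<Sum>l<2 * m. g l * u l k * u l k)"
    unfolding g_def by (rule sum.mono_neutral_cong_left) auto
  have L: "(\<Sum>l\<in>{m..<2 * m}. lam l * u l k * u l k) = (\<Sum>l<2 * m. h l * u l k * u l k)"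
    unfolding h_def by (rule sum.mono_neutral_cong_left) auto
  note close = diagonal_sum_close[OF eigdecomp_diagonalizes[OF ed] k]
  have abs: "\<bar>g l - max (lam l) 0\<bar> \<le> \<bar>lam l\<bar>" "\<bar>h l - min (lam l) 0\<bar> \<le> \<bar>lam l\<bar>" for l
    by (auto simp: g_def h_def)
  have const: "matfun (2 * m) (\<lambda>x. d) A k k = d" for d
    using matfun_cmult[OF A k k, of d "\<lambda>_. 1"] matfun_1[OF A k k] by simp
  have near: "\<bar>g l - max (lam l) 0\<bar> \<le> 8 * e" "\<bar>h l - min (lam l) 0\<bar> \<le> 8 * e"
    if e: "0 < e" and neg: "mattr (2 * m) (imbalance 1 e) A < 0" "mattr (2 * m) (imbalance (-1) e) A < 0"
      and l: "l < 2 * m" for e l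
    using median_bound(1)[OF ed e neg(1), of l] median_bound(2)[OF ed e neg(2), of l] l e
    by (auto simp: g_def h_def max_def min_def abs_if not_less)
  show "half_close m (\<lambda>x. max x 0) A k (\<Sum>l\<in>{0..<m}. lam l * u l k * u l k)"
    unfolding half_close_def U
    using close[of g "\<lambda>x. max x 0" "\<lambda>x. \<bar>x\<bar>"] close[of g "\<lambda>x. max x 0" "\<lambda>x. 8 * e" for e] abs near
    by (auto simp: const)
  show "half_close m (\<lambda>x. min x 0) A k (\<Sum>l\<in>{m..<2 * m}. lam l * u l k * u l k)"
    unfolding half_close_def L
    using close[of h "\<lambda>x. min x 0" "\<lambda>x. \<bar>x\<bar>"] close[of h "\<lambda>x. min x 0" "\<lambda>x. 8 * e" for e] abs near
    by (auto simp: const)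
qed

section \<open>Conclusion\<close>

lemma exp_minus_le_power:
  fixes y :: real
  assumes "0 < y"
  shows "exp (- y) \<le> fact N / y ^ N"
proof -
  have "(\<Sum>n\<in>{N}. inverse (fact n) * y ^ n) \<le> (\<Sum>n. inverse (fact n) * y ^ n)"
    by (rule sum_le_suminf[OF summable_exp]) (use assms in auto)
  also have "\<dots> = exp y" by (simp add: exp_def)
  finally have "y ^ N / fact N \<le> exp y" by (simp add: divide_inverse mult.commute)
  then have "1 / exp y \<le> 1 / (y ^ N / fact N)"
    using assms by (intro divide_left_mono) auto
  then show ?thesis by (simp add: exp_minus inverse_eq_divide)
qed

definition cbrt_inv :: "nat \<Rightarrow> real" where "cbrt_inv n = real n powr (- 1 / 3)"

lemma cbrt_inv_props:
  assumes "0 < n"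
  shows "0 < cbrt_inv n" "cbrt_inv n \<le> 1" "real n * cbrt_inv n ^ 3 = 1"
proof -
  show "0 < cbrt_inv n" using assms by (simp add: cbrt_inv_def)
  have "real n powr (- 1 / 3) \<le> real n powr 0" using assms by (intro powr_mono) auto
  then show "cbrt_inv n \<le> 1" using assms by (simp add: cbrt_inv_def)
  have "cbrt_inv n ^ 3 = real n powr (- 1)"
    unfolding cbrt_inv_def using assms by (simp flip: powr_realpow add: powr_powr)
  then show "real n * cbrt_inv n ^ 3 = 1" using assms by (simp add: powr_minus)
qed

lemma cbrt_inv_tendsto: "cbrt_inv \<longlonglongrightarrow> 0"
  unfolding cbrt_inv_def[abs_def] by (rule tendsto_neg_powr) (auto intro: filterlim_real_sequentially)

lemma cbrt_inv_sq:
  assumes "0 < n"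
  shows "real n * (cbrt_inv n)\<^sup>2 = 1 / cbrt_inv n"
  using cbrt_inv_props[OF assms] by (simp add: field_simps power2_eq_square power3_eq_cube)

text \<open>For q = \<open>cbrt_inv n\<close> and e = c q one has n e^2 = c^2/q, so both error terms
  of the equation for b are positive powers of q. The equation becomes b^2 = 1 up to an error that
  vanishes, and b >= 0 selects the root 1.\<close>

lemma tendsto_mean_im_mesoscopic:
  assumes c: "0 < c"
  shows "(\<lambda>n. mean_im n (c * cbrt_inv n)) \<longlonglongrightarrow> 1"
proof -
  define b where "b = (\<lambda>n. mean_im n (c * cbrt_inv n))"
  define err where "err = (\<lambda>n. cbrt_inv n / c\<^sup>2 + 72 * (cbrt_inv n)\<^sup>2 / c^4)"
  have "err \<longlonglongrightarrow> 0 / c\<^sup>2 + 72 * 0\<^sup>2 / c^4"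
    unfolding err_def using c by (intro tendsto_intros cbrt_inv_tendsto) auto
  then have errlim: "err \<longlonglongrightarrow> 0" by simp
  have "(\<lambda>n. err n + c * cbrt_inv n * (1 + err n)) \<longlonglongrightarrow> 0 + c * 0 * (1 + 0)"
    by (intro tendsto_intros errlim cbrt_inv_tendsto)
  then have lim: "(\<lambda>n. err n + c * cbrt_inv n * (1 + err n)) \<longlonglongrightarrow> 0" by simp
  have "(\<lambda>n. b n - 1) \<longlonglongrightarrow> 0"
  proof (rule Lim_null_comparison[OF _ lim])
    show "eventually (\<lambda>n. norm (b n - 1) \<le> err n + c * cbrt_inv n * (1 + err n)) sequentially"
      using eventually_gt_at_top[of "0::nat"]
    proof eventually_elim
      case (elim n)
      define q where "q = cbrt_inv n"
      note q = cbrt_inv_props[OF elim, folded q_def]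
      define e where "e = c * q"
      have e: "0 < e" unfolding e_def using c q by simp
      have nq: "real n * q\<^sup>2 = 1 / q" unfolding q_def by (rule cbrt_inv_sq[OF elim])
      have ne: "real n * e\<^sup>2 = c\<^sup>2 / q"
      proof -
        have "real n * e\<^sup>2 = c\<^sup>2 * (real n * q\<^sup>2)" unfolding e_def by (simp add: power_mult_distrib)
        then show ?thesis unfolding nq by simp
      qed
      have "(real n)\<^sup>2 * e^4 = (real n * e\<^sup>2)\<^sup>2" by (simp add: power_mult_distrib flip: power_mult)
      then have ne2: "(real n)\<^sup>2 * e^4 = c^4 / q\<^sup>2" unfolding ne by (simp add: power_divide flip: power_mult)
      have err: "err n = 1 / (real n * e\<^sup>2) + 72 / ((real n)\<^sup>2 * e^4)"
        unfolding ne ne2 err_def q_def[symmetric] by simp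
      have err0: "0 \<le> err n" unfolding err_def using q c by (simp add: q_def)
      have main: "\<bar>1 - e * b n - (b n)\<^sup>2\<bar> \<le> err n"
        using mean_im_equation[OF elim e] unfolding err b_def e_def q_def by simp
      have b0: "0 \<le> b n" using mean_im_nonneg[OF e] unfolding b_def e_def q_def .
      have eb: "0 \<le> e * b n" using e b0 by simp
      \<comment> \<open>A crude upper bound on b, needed to see that e * b tends to 0.\<close>
      have "(b n)\<^sup>2 \<le> 1 + err n" using main eb by linarith
      also have "\<dots> \<le> (1 + err n)\<^sup>2"
        using mult_right_mono[of 1 "1 + err n" "1 + err n"] err0 by (simp only: power2_eq_square) simp
      finally have b1: "b n \<le> 1 + err n" by (rule power2_le_imp_le) (use err0 in simp)
      have "\<bar>b n - 1\<bar> \<le> \<bar>b n - 1\<bar> * (1 + b n)"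
        using mult_left_mono[of 1 "1 + b n" "\<bar>b n - 1\<bar>"] b0 by simp
      also have "\<dots> = \<bar>(b n - 1) * (1 + b n)\<bar>" using b0 by (simp add: abs_mult)
      also have "(b n - 1) * (1 + b n) = - (1 - e * b n - (b n)\<^sup>2) - e * b n" by (simp add: power2_eq_square algebra_simps)
      also have "\<bar>\<dots>\<bar> \<le> err n + e * b n" using main eb by linarith
      also have "e * b n \<le> e * (1 + err n)" using e b1 by (intro mult_left_mono) auto
      finally show "norm (b n - 1) \<le> err n + c * cbrt_inv n * (1 + err n)" by (simp add: e_def q_def)
    qed
  qed
  then show ?thesis unfolding b_def by (simp add: LIM_zero_iff)
qed

text \<open>Z is the entry of half of the matrix, F its Lipschitz model, B the exceptional event.
  The means differ by at most q/8 + q/16 + q/16 = q/4. Off B a deviation q of Z therefore leaves q -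
  q/8 - q/4 >= q/2 for F, whose squared Lipschitz constant 2/n gives the exponent (q/2)^2/(8/n) = n
  q^2/32.\<close>

lemma goe_perturbation:
  assumes n: "0 < n" and k: "k < n" and q: "0 < q" and f: "lip 1 f"
    and Z[measurable]: "Z \<in> borel_measurable (GOE n)" and B[measurable]: "B \<in> sets (GOE n)"
  defines "F \<equiv> \<lambda>w. matfun n f (goe_mat w) k k"
  assumes H: "AE w in GOE n. \<bar>Z w - F w\<bar> \<le> matfun n (\<lambda>x. \<bar>x\<bar>) (goe_mat w) k k"
    and near: "AE w in GOE n. w \<notin> B \<longrightarrow> \<bar>Z w - F w\<bar> \<le> q / 8"
    and PB: "measure (GOE n) B \<le> q\<^sup>2 / 128"
  shows "\<bar>(\<integral>w. Z w \<partial>GOE n) - (\<integral>w. F w \<partial>GOE n)\<bar> \<le> q / 4"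
    and "measure (GOE n) {w \<in> space (GOE n). q \<le> \<bar>Z w - (\<integral>w. Z w \<partial>GOE n)\<bar>}
      \<le> measure (GOE n) B + 2 * exp (- (real n * q\<^sup>2 / 32))"
proof -
  interpret prob_space "GOE n" by (rule prob_space_GOE[OF n])
  define A where "A = (\<lambda>w. matfun n (\<lambda>x. \<bar>x\<bar>) (goe_mat w) k k)"
  define A2 where "A2 = (\<lambda>w. matfun n (\<lambda>x. x\<^sup>2) (goe_mat w) k k)"
  have mF[measurable]: "F \<in> borel_measurable (GOE n)" unfolding F_def by (rule borel_measurable_matfun_goe[OF n k k f])
  have iF: "integrable (GOE n) F" unfolding F_def by (rule integrable_matfun_goe[OF n k k f])
  have iA: "integrable (GOE n) A" unfolding A_def by (rule integrable_matfun_goe[OF n k k lip_abs])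
  have iA2: "integrable (GOE n) A2" and EA2: "(\<integral>w. A2 w \<partial>GOE n) \<le> 2"
    unfolding A2_def by (rule goe_second_moment[OF n k])+
  have AA: "(A w)\<^sup>2 \<le> A2 w" for w
    using matfun_diag_square_le[OF sym_mat_goe k k, of "\<lambda>x. \<bar>x\<bar>" w] unfolding A_def A2_def by simp
  have A20: "0 \<le> A2 w" for w using AA[of w] zero_le_power2[of "A w"] by linarith
  have iZF: "integrable (GOE n) (\<lambda>w. Z w - F w)"
  proof (rule Bochner_Integration.integrable_bound[OF iA])
    show "AE w in GOE n. norm (Z w - F w) \<le> norm (A w)"
      using H by eventually_elim (simp add: A_def)
  qed measurable
  have "integrable (GOE n) (\<lambda>w. (Z w - F w) + F w)" using iZF iF by (rule Bochner_Integration.integrable_add)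
  then have iZ: "integrable (GOE n) Z" by simp
  have iB: "integrable (GOE n) (indicator B :: _ \<Rightarrow> real)" by (rule integrable_real_indicator) (auto simp: emeasure_eq_measure)
  have "\<bar>(\<integral>w. Z w \<partial>GOE n) - (\<integral>w. F w \<partial>GOE n)\<bar> = \<bar>\<integral>w. Z w - F w \<partial>GOE n\<bar>"
    using iZ iF by simp
  also have "\<dots> \<le> (\<integral>w. \<bar>Z w - F w\<bar> \<partial>GOE n)" by (rule integral_abs_bound)
  also have "\<dots> \<le> (\<integral>w. q / 8 + q / 32 * A2 w + 8 / q * indicator B w \<partial>GOE n)"
  proof (rule integral_mono_AE)
    show "AE w in GOE n. \<bar>Z w - F w\<bar> \<le> q / 8 + q / 32 * A2 w + 8 / q * indicator B w"
      using H near
    proof eventually_elim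
      case (elim w)
      have nn: "0 \<le> q / 32 * A2 w" using q A20[of w] by simp
      show ?case
      proof (cases "w \<in> B")
        case False
        then show ?thesis using elim nn by simp
      next
        case True
        \<comment> \<open>Yields A <= (q/32) A^2 + 8/q: on B the crude bound is traded for the
          second moment, at most 2, and the probability of B, at most q^2/128. Each costs
          q/16.\<close>
        have "0 \<le> (q * A w - 16)\<^sup>2" by simp
        then have "32 * q * A w \<le> q\<^sup>2 * (A w)\<^sup>2 + 256" by (simp add: power2_eq_square algebra_simps)
        also have "\<dots> \<le> q\<^sup>2 * A2 w + 256" using AA[of w] by (simp add: mult_left_mono)
        finally have "32 * q * A w / (32 * q) \<le> (q\<^sup>2 * A2 w + 256) / (32 * q)"
          using q by (intro divide_right_mono) auto
        then have "A w \<le> q / 32 * A2 w + 8 / q" using q by (simp add: add_divide_distrib power2_eq_square)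
        moreover have "\<bar>Z w - F w\<bar> \<le> A w" using elim(1) by (simp only: A_def)
        moreover have "indicator B w = (1::real)" using True by simp
        ultimately show ?thesis using q by simp
      qed
    qed
  qed (use iZF iA2 iB in auto)
  also have "\<dots> = q / 8 + q / 32 * (\<integral>w. A2 w \<partial>GOE n) + 8 / q * measure (GOE n) B"
    using iA2 iB by (simp add: prob_space)
  also have "\<dots> \<le> q / 8 + q / 32 * 2 + 8 / q * (q\<^sup>2 / 128)"
    using q EA2 PB by (intro add_mono mult_left_mono) auto
  also have "\<dots> = q / 4" using q by (simp add: power2_eq_square field_simps)
  finally show mean: "\<bar>(\<integral>w. Z w \<partial>GOE n) - (\<integral>w. F w \<partial>GOE n)\<bar> \<le> q / 4" .
  define L where "L = sqrt (2 / n)"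
  have L: "0 < L" unfolding L_def using n by simp
  have lipF: "\<bar>F x - F y\<bar> \<le> L * goe_dist n x y" for x y
    using matfun_goe_lipschitz[OF n k k f, of x y] unfolding F_def L_def by simp
  then have lipF': "\<bar>- F x - - F y\<bar> \<le> L * goe_dist n x y" for x y
    by (simp only: minus_diff_minus abs_minus_cancel)
  have L2: "(q / 2)\<^sup>2 / (4 * L\<^sup>2) = real n * q\<^sup>2 / 32" unfolding L_def by (simp add: power_divide)
  have q2: "0 < q / 2" using q by simp
  define m where "m = (\<integral>w. F w \<partial>GOE n)"
  define S1 where "S1 = {w \<in> space (GOE n). m + q / 2 \<le> F w}"
  define S2 where "S2 = {w \<in> space (GOE n). (\<integral>w. - F w \<partial>GOE n) + q / 2 \<le> - F w}"
  have S1: "measure (GOE n) S1 \<le> exp (- (real n * q\<^sup>2 / 32))"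
    using tail_goe_lipschitz[OF n L lipF q2] unfolding L2 S1_def m_def .
  have S2: "measure (GOE n) S2 \<le> exp (- (real n * q\<^sup>2 / 32))"
    using tail_goe_lipschitz[OF n L lipF' q2] unfolding L2 S2_def .
  have [measurable]: "S1 \<in> sets (GOE n)" "S2 \<in> sets (GOE n)" unfolding S1_def S2_def by measurable
  have "measure (GOE n) {w \<in> space (GOE n). q \<le> \<bar>Z w - (\<integral>w. Z w \<partial>GOE n)\<bar>} \<le> measure (GOE n) (B \<union> (S1 \<union> S2))"
  proof (rule finite_measure_mono_AE)
    show "AE w in GOE n. w \<in> {w \<in> space (GOE n). q \<le> \<bar>Z w - (\<integral>w. Z w \<partial>GOE n)\<bar>} \<longrightarrow> w \<in> B \<union> (S1 \<union> S2)"
      using near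
    proof eventually_elim
      case (elim w)
      show ?case
      proof
        assume w: "w \<in> {w \<in> space (GOE n). q \<le> \<bar>Z w - (\<integral>w. Z w \<partial>GOE n)\<bar>}"
        have "m + q / 2 \<le> F w \<or> - m + q / 2 \<le> - F w" if "w \<notin> B"
        proof -
          have "m + q / 2 \<le> y \<or> - m + q / 2 \<le> - y" if "\<bar>z - y\<bar> \<le> q / 8" "\<bar>E - m\<bar> \<le> q / 4" "q \<le> \<bar>z - E\<bar>" for y z E
          proof (cases "0 \<le> z - E")
            case True
            then show ?thesis using that q by (intro disjI1) linarith
          next
            case False
            then show ?thesis using that q by (intro disjI2) linarith
          qed
          from this[of "Z w" "F w" "\<integral>w. Z w \<partial>GOE n"] show ?thesis
            using elim that w mean unfolding m_def[symmetric] by simp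
        qed
        then show "w \<in> B \<union> (S1 \<union> S2)" using w unfolding S1_def S2_def m_def by auto
      qed
    qed
  qed measurable
  also have "\<dots> \<le> measure (GOE n) B + (measure (GOE n) S1 + measure (GOE n) S2)"
    by (intro order_trans[OF measure_Un_le] add_left_mono measure_Un_le) auto
  also have "\<dots> \<le> measure (GOE n) B + 2 * exp (- (real n * q\<^sup>2 / 32))" using S1 S2 by simp
  finally show "measure (GOE n) {w \<in> space (GOE n). q \<le> \<bar>Z w - (\<integral>w. Z w \<partial>GOE n)\<bar>}
      \<le> measure (GOE n) B + 2 * exp (- (real n * q\<^sup>2 / 32))" .
qed

text \<open>Common to both halves, with f the positive or the negative part. The parameter e = q/64
  is chosen so that the median bound 8 e equals the tolerance q/8 of the perturbation
  argument.\<close>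

lemma half_matrix_asymptotics:
  fixes Z :: "nat \<Rightarrow> (nat \<times> nat \<Rightarrow> real) \<Rightarrow> real" and k :: "nat \<Rightarrow> nat"
  assumes k: "\<And>n. 0 < n \<Longrightarrow> k n < n" and K: "0 < K" and f: "lip 1 f"
    and Z: "\<And>n. Z n \<in> borel_measurable (GOE n)"
  defines "F \<equiv> \<lambda>n w. matfun n f (goe_mat w) (k n) (k n)"
  assumes lim: "(\<lambda>n. \<integral>w. F n w \<partial>GOE n) \<longlonglongrightarrow> c"
    and close: "\<And>m. 0 < m \<Longrightarrow> AE w in GOE (2 * m). half_close m f (goe_mat w) (k (2 * m)) (Z (2 * m) w)"
  shows "(\<lambda>m. \<integral>w. Z (2 * m) w \<partial>GOE (2 * m)) \<longlonglongrightarrow> c"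
    and "(\<lambda>m. measure (GOE (2 * m)) {w \<in> space (GOE (2 * m)).
          \<bar>Z (2 * m) w - (\<integral>w. Z (2 * m) w \<partial>GOE (2 * m))\<bar> \<ge> real (2 * m) powr (-1/3)})
        \<in> O(\<lambda>m. real (2 * m) powr (-K))"
proof -
  define q where "q = (\<lambda>m::nat. cbrt_inv (2 * m))"
  \<comment> \<open>With e = q/64 and n q^2 = 1/q the exponent n^2 e^4/2304 becomes
    \<kappa>/q^2.\<close>
  define \<kappa> :: real where "\<kappa> = 1 / (64^4 * 2304)"
  have \<kappa>: "0 < \<kappa>" unfolding \<kappa>_def by simp
  have twice: "filterlim (\<lambda>m::nat. 2 * m) sequentially sequentially"
    by (rule filterlim_subseq) (simp add: strict_mono_def)
  have qlim: "q \<longlonglongrightarrow> 0"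
    unfolding q_def by (rule filterlim_compose[OF cbrt_inv_tendsto twice])
  have meanlim: "(\<lambda>m. mean_im (2 * m) (1 / 64 * q m) - mean_im (2 * m) (1 / 16 * q m) / 2) \<longlonglongrightarrow> 1 - 1 / 2"
    unfolding q_def
    by (intro tendsto_intros filterlim_compose[OF tendsto_mean_im_mesoscopic twice]) auto
  \<comment> \<open>The threshold on q^2 makes the exceptional event rare enough: exp(-y) <= 2/y^2
    bounds its probability by 4 q^4/\<kappa>^2, which is then at most q^2/128.\<close>
  have ev: "eventually (\<lambda>m. 0 < m \<and> (q m)\<^sup>2 < \<kappa>\<^sup>2 / 512 \<and>
      1 / 4 < mean_im (2 * m) (1 / 64 * q m) - mean_im (2 * m) (1 / 16 * q m) / 2) sequentially"
  proof (intro eventually_conj)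
    show "eventually (\<lambda>m::nat. 0 < m) sequentially" by (rule eventually_gt_at_top)
    have "(\<lambda>m. (q m)\<^sup>2) \<longlonglongrightarrow> 0\<^sup>2" by (intro tendsto_intros qlim)
    then show "eventually (\<lambda>m. (q m)\<^sup>2 < \<kappa>\<^sup>2 / 512) sequentially"
      by (rule order_tendstoD) (use \<kappa> in auto)
    show "eventually (\<lambda>m. 1 / 4 < mean_im (2 * m) (1 / 64 * q m) - mean_im (2 * m) (1 / 16 * q m) / 2) sequentially"
      by (rule order_tendstoD(1)[OF meanlim]) simp
  qed
  define E where "E = (\<lambda>m. \<integral>w. Z (2 * m) w \<partial>GOE (2 * m))"
  define P where "P = (\<lambda>m. measure (GOE (2 * m)) {w \<in> space (GOE (2 * m)). q m \<le> \<bar>Z (2 * m) w - E m\<bar>})"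
  have main: "eventually (\<lambda>m. \<bar>E m - (\<integral>w. F (2 * m) w \<partial>GOE (2 * m))\<bar> \<le> q m / 4 \<and>
      P m \<le> 2 * exp (- (\<kappa> / q m)) + 2 * exp (- (1 / 32 / q m))) sequentially"
    using ev
  proof eventually_elim
    case (elim m)
    define n where "n = 2 * m"
    have n: "0 < n" using elim by (simp add: n_def)
    interpret prob_space "GOE n" by (rule prob_space_GOE[OF n])
    have q: "0 < q m" "q m \<le> 1" using cbrt_inv_props[OF n] by (simp_all add: q_def n_def)
    have nq: "real n * (q m)\<^sup>2 = 1 / q m" unfolding q_def n_def[symmetric] by (rule cbrt_inv_sq[OF n])
    define e where "e = 1 / 64 * q m"
    have e: "0 < e" using q by (simp add: e_def)
    have e4: "4 * e = 1 / 16 * q m" and e8: "8 * e = q m / 8" by (simp_all add: e_def)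
    have gap: "1 / 4 \<le> mean_im n e - mean_im n (4 * e) / 2"
      using elim unfolding e4 unfolding e_def n_def by simp
    define B where "B = (\<lambda>s. {w \<in> space (GOE n). 0 \<le> mattr n (imbalance s e) (goe_mat w)})"
    have "(real n)\<^sup>2 * e^4 / 2304 = (real n * (q m)\<^sup>2)\<^sup>2 * \<kappa>"
      unfolding e_def \<kappa>_def by (simp add: power_mult_distrib power_divide flip: power_mult)
    then have rate: "(real n)\<^sup>2 * e^4 / 2304 = \<kappa> / (q m)\<^sup>2" unfolding nq by (simp add: power_divide)
    have PBs: "measure (GOE n) (B s) \<le> exp (- (\<kappa> / (q m)\<^sup>2))" if "\<bar>s\<bar> = 1" for s
      using imbalance_tail[OF n e that gap] unfolding B_def rate .
    have Bs: "B s \<in> sets (GOE n)" if "\<bar>s\<bar> = 1" for s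
      unfolding B_def using borel_measurable_mattr_goe[OF n lip_imbalance[OF e that]] by measurable
    define BB where "BB = B 1 \<union> B (-1)"
    have BB: "BB \<in> sets (GOE n)" unfolding BB_def using Bs[of 1] Bs[of "-1"] by auto
    have "measure (GOE n) BB \<le> measure (GOE n) (B 1) + measure (GOE n) (B (-1))"
      unfolding BB_def by (rule measure_Un_le) (use Bs in auto)
    then have PBB: "measure (GOE n) BB \<le> 2 * exp (- (\<kappa> / (q m)\<^sup>2))"
      using PBs[of 1] PBs[of "-1"] by simp
    have "exp (- (\<kappa> / (q m)\<^sup>2)) \<le> fact 2 / (\<kappa> / (q m)\<^sup>2) ^ 2"
      using \<kappa> q by (intro exp_minus_le_power) auto
    also have "\<dots> = 2 * (q m)\<^sup>2 * (q m)\<^sup>2 / \<kappa>\<^sup>2" by (simp add: power2_eq_square)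
    finally have "2 * exp (- (\<kappa> / (q m)\<^sup>2)) \<le> 2 * (2 * (q m)\<^sup>2 * (q m)\<^sup>2 / \<kappa>\<^sup>2)" by (rule mult_left_mono) simp
    also have "2 * (2 * (q m)\<^sup>2 * (q m)\<^sup>2 / \<kappa>\<^sup>2) = (q m)\<^sup>2 * (4 * (q m)\<^sup>2 / \<kappa>\<^sup>2)" by simp
    also have "4 * (q m)\<^sup>2 / \<kappa>\<^sup>2 \<le> 1 / 128" using elim \<kappa> by (simp add: field_simps)
    then have "(q m)\<^sup>2 * (4 * (q m)\<^sup>2 / \<kappa>\<^sup>2) \<le> (q m)\<^sup>2 * (1 / 128)" by (intro mult_left_mono) auto
    finally have PB: "measure (GOE n) BB \<le> (q m)\<^sup>2 / 128" using PBB by simp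
    have m0: "0 < m" using elim by simp
    note cl = close[OF m0, unfolded half_close_def, folded n_def F_def]
    have close': "AE w in GOE n. \<bar>Z n w - F n w\<bar> \<le> matfun n (\<lambda>x. \<bar>x\<bar>) (goe_mat w) (k n) (k n)"
      using cl unfolding F_def by eventually_elim (rule conjunct1)
    have near: "AE w in GOE n. w \<notin> BB \<longrightarrow> \<bar>Z n w - F n w\<bar> \<le> q m / 8"
      using cl AE_space
    proof eventually_elim
      case (elim w)
      show ?case
      proof
        assume "w \<notin> BB"
        then have "mattr n (imbalance 1 e) (goe_mat w) < 0" "mattr n (imbalance (-1) e) (goe_mat w) < 0"
          using elim(2) unfolding BB_def B_def by auto
        then show "\<bar>Z n w - F n w\<bar> \<le> q m / 8"
          using elim(1) e unfolding F_def e8[symmetric] by blast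
      qed
    qed
    note pert = goe_perturbation[OF n k[OF n] q(1) f Z BB close'[unfolded F_def] near[unfolded F_def] PB]
    have "P m \<le> measure (GOE n) BB + 2 * exp (- (real n * (q m)\<^sup>2 / 32))"
      using pert(2) unfolding P_def E_def n_def .
    also have "\<dots> \<le> 2 * exp (- (\<kappa> / q m)) + 2 * exp (- (1 / 32 / q m))"
    proof -
      have "(q m)\<^sup>2 \<le> q m" using q by (simp add: power2_eq_square mult_left_le)
      then have "\<kappa> / q m \<le> \<kappa> / (q m)\<^sup>2" using q \<kappa> by (intro divide_left_mono) auto
      then have "exp (- (\<kappa> / (q m)\<^sup>2)) \<le> exp (- (\<kappa> / q m))" by simp
      moreover have "exp (- (1 / q m / 32)) = exp (- (1 / 32 / q m))" by (simp add: mult.commute)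
      ultimately show ?thesis using PBB unfolding nq by linarith
    qed
    finally show ?case using pert(1) unfolding E_def F_def n_def by simp
  qed
  have "(\<lambda>m. E m - (\<integral>w. F (2 * m) w \<partial>GOE (2 * m))) \<longlonglongrightarrow> 0"
  proof (rule Lim_null_comparison)
    show "eventually (\<lambda>m. norm (E m - (\<integral>w. F (2 * m) w \<partial>GOE (2 * m))) \<le> q m / 4) sequentially"
      using main by eventually_elim simp
    show "(\<lambda>m. q m / 4) \<longlonglongrightarrow> 0" using tendsto_divide[OF qlim tendsto_const[of 4]] by simp
  qed
  from tendsto_add[OF this filterlim_compose[OF lim twice]]
  show "(\<lambda>m. \<integral>w. Z (2 * m) w \<partial>GOE (2 * m)) \<longlonglongrightarrow> c" unfolding E_def by simp
  \<comment> \<open>q^N is (2 m)^(-N/3), so N >= 3 K reaches the rate (2 m)^(-K).\<close>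
  obtain N :: nat where N: "3 * K \<le> N" using real_arch_simple by blast
  define C where "C = 2 * (fact N / \<kappa> ^ N) + 2 * (fact N / (1 / 32) ^ N)"
  have "P \<in> O(\<lambda>m. real (2 * m) powr (- K))"
  proof (rule bigoI[of _ C])
    show "eventually (\<lambda>m. norm (P m) \<le> C * norm (real (2 * m) powr (- K))) sequentially"
      using main eventually_gt_at_top[of "0::nat"]
    proof eventually_elim
      case (elim m)
      have n: "0 < 2 * m" using elim by simp
      have q: "0 < q m" using cbrt_inv_props[OF n] by (simp add: q_def)
      have dec: "exp (- (a / q m)) \<le> fact N / a ^ N * q m ^ N" if "0 < a" for a
        using exp_minus_le_power[of "a / q m" N] q that by (simp add: power_divide)
      have "P m \<le> 2 * (fact N / \<kappa> ^ N * q m ^ N) + 2 * (fact N / (1 / 32) ^ N * q m ^ N)"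
        using elim(1) dec[OF \<kappa>] dec[of "1 / 32"] by linarith
      also have "\<dots> = C * q m ^ N" unfolding C_def by (simp add: algebra_simps)
      also have "\<dots> \<le> C * (real (2 * m) powr (- K))"
      proof (rule mult_left_mono)
        have "q m ^ N = real (2 * m) powr (- 1 / 3 * N)"
          unfolding q_def cbrt_inv_def using n by (simp flip: powr_realpow add: powr_powr)
        also have "\<dots> \<le> real (2 * m) powr (- K)" using n N by (intro powr_mono) auto
        finally show "q m ^ N \<le> real (2 * m) powr (- K)" .
        show "0 \<le> C" unfolding C_def using \<kappa> by simp
      qed
      finally show ?case unfolding P_def by simp
    qed
  qed
  then show "(\<lambda>m. measure (GOE (2 * m)) {w \<in> space (GOE (2 * m)).
          \<bar>Z (2 * m) w - (\<integral>w. Z (2 * m) w \<partial>GOE (2 * m))\<bar> \<ge> real (2 * m) powr (-1/3)})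
        \<in> O(\<lambda>m. real (2 * m) powr (-K))"
    unfolding P_def E_def q_def cbrt_inv_def by simp
qed

theorem theoremE1:
  fixes k :: "nat \<Rightarrow> nat"
    and Yp Ym :: "nat \<Rightarrow> (nat \<times> nat \<Rightarrow> real) \<Rightarrow> real"
    and K :: real
  assumes k: "\<And>n. 0 < n \<Longrightarrow> k n < n"
    and K: "K > 0"
    and Yp_meas: "\<And>n. Yp n \<in> borel_measurable (GOE n)"
    and Ym_meas: "\<And>n. Ym n \<in> borel_measurable (GOE n)"
    and Yp_def: "\<And>n. AE \<omega> in GOE n. \<exists>lam u. eigdecomp n (goe_mat \<omega>) lam u \<and>
                   Yp n \<omega> = (\<Sum>l\<in>{0..<n div 2}. lam l * u l (k n) * u l (k n)) \<and>
                   Ym n \<omega> = (\<Sum>l\<in>{n div 2..<n}. lam l * u l (k n) * u l (k n))"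
  shows "((\<lambda>m. integral\<^sup>L (GOE (2*m)) (Yp (2*m)) - 4 / (3 * pi)) \<longlonglongrightarrow> 0) \<and>
    ((\<lambda>m. integral\<^sup>L (GOE (2*m)) (Ym (2*m)) + 4 / (3 * pi)) \<longlonglongrightarrow> 0) \<and>
    ((\<lambda>m. measure (GOE (2*m))
            {\<omega> \<in> space (GOE (2*m)).
               \<bar>Yp (2*m) \<omega> - integral\<^sup>L (GOE (2*m)) (Yp (2*m))\<bar> \<ge> real (2*m) powr (-1/3)})
         \<in> O(\<lambda>m. real (2*m) powr (-K))) \<and>
    ((\<lambda>m. measure (GOE (2*m))
            {\<omega> \<in> space (GOE (2*m)).
               \<bar>Ym (2*m) \<omega> - integral\<^sup>L (GOE (2*m)) (Ym (2*m))\<bar> \<ge> real (2*m) powr (-1/3)})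
         \<in> O(\<lambda>m. real (2*m) powr (-K)))"
proof -
  have upper: "AE w in GOE (2 * m). half_close m (\<lambda>x. max x 0) (goe_mat w) (k (2 * m)) (Yp (2 * m) w)"
    and lower: "AE w in GOE (2 * m). half_close m (\<lambda>x. min x 0) (goe_mat w) (k (2 * m)) (Ym (2 * m) w)"
    if m: "0 < m" for m
  proof -
    have km: "k (2 * m) < 2 * m" using m by (intro k) simp
    have div: "2 * m div 2 = m" by simp
    note ae = Yp_def[of "2 * m", unfolded div]
    note close = upper_lower_half_close[OF _ sym_mat_goe km]
    show "AE w in GOE (2 * m). half_close m (\<lambda>x. max x 0) (goe_mat w) (k (2 * m)) (Yp (2 * m) w)"
      using ae by eventually_elim (elim exE conjE, simp only: close(1))
    show "AE w in GOE (2 * m). half_close m (\<lambda>x. min x 0) (goe_mat w) (k (2 * m)) (Ym (2 * m) w)"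
      using ae by eventually_elim (elim exE conjE, simp only: close(2))
  qed
  note p = half_matrix_asymptotics[OF k K lip_posneg(1) Yp_meas tendsto_diagonal_posneg(1)[OF k] upper]
  note m = half_matrix_asymptotics[OF k K lip_posneg(2) Ym_meas tendsto_diagonal_posneg(2)[OF k] lower]
  have "(\<lambda>m. integral\<^sup>L (GOE (2*m)) (Yp (2*m)) - 4 / (3 * pi)) \<longlonglongrightarrow> 4 / (3 * pi) - 4 / (3 * pi)"
    by (intro tendsto_diff p(1) tendsto_const)
  moreover have "(\<lambda>m. integral\<^sup>L (GOE (2*m)) (Ym (2*m)) + 4 / (3 * pi)) \<longlonglongrightarrow> - (4 / (3 * pi)) + 4 / (3 * pi)"
    by (intro tendsto_add m(1) tendsto_const)
  ultimately show ?thesis using p(2) m(2) by simp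
qed

end
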